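(* Define the formal series $${\cal K}_A(x;y;q,t)=\sum_{\eta\in\mathbb{N}^n}\frac{d_\eta(q,t)}{d'_\eta(q,t)\,e_\eta(q,t)}\,E_\eta(x;q,t)\,E_\eta(y;q^{-1},t^{-1}).$$ Then: (a) for $1\le i\le n-1$, $(T_i)^{(x)}{\cal K}_A=\bigl(\overline{T_i^{-1}}\bigr)^{(y)}{\cal K}_A$ and $(T_i^{-1})^{(x)}{\cal K}_A=\bigl(\overline{T_i}\bigr)^{(y)}{\cal K}_A$; (b) $\widehat{\Phi}_q^{(x)}{\cal K}_A=\bigl(\overline{\Phi_q}\bigr)^{(y)}{\cal K}_A$; (c) for $1\le i\le n$, $D_i^{(x)}{\cal K}_A=y_i\,{\cal K}_A$.
   Context: Let $n\ge1$, $q,t$ generic parameters; operators act on (Laurent) polynomials or formal series in $x=(x_1,\dots,x_n)$ and $y=(y_1,\dots,y_n)$ over $\mathbb{Q}(q,t)$, termwise on series; superscript $(x)$/$(y)$ indicates the variables acted on. Let $s_i$ interchange the $i$-th and $(i+1)$-th variables, $(\tau_if)(x)=f(x_1,\dots,qx_i,\dots,x_n)$, $T_i=t+\frac{tx_i-x_{i+1}}{x_i-x_{i+1}}(s_i-1)$ (invertible, $T_i^{-1}=t^{-1}-1+t^{-1}T_i$), $\omega=s_{n-1}\cdots s_1\tau_1$, $Y_i=t^{-n+i}T_i\cdots T_{n-1}\,\omega\,T_1^{-1}\cdots T_{i-1}^{-1}$, $T_{ij}^{-1}=T_i^{-1}\cdots T_{j-2}^{-1}T_{j-1}^{-1}T_{j-2}^{-1}\cdots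 T_i^{-1}$ ($i<j$), $D_i=x_i^{-1}\bigl(1-t^{n-1}[1+(t^{-1}-1)\sum_{j=i+1}^n t^{j-i}T_{ij}^{-1}]Y_i\bigr)$, $\Phi_q=x_nT_{n-1}^{-1}\cdots T_1^{-1}$, $\widehat{\Phi}_q=T_1\cdots T_{n-1}D_n$. For an operator $A$, $\overline{A}$ is obtained by replacing $q\mapsto q^{-1}$, $t\mapsto t^{-1}$. Nonsymmetric Macdonald polynomials: for $\eta\in\mathbb{N}^n$, $x^\eta=\prod x_i^{\eta_i}$, $\eta^+$ the decreasing rearrangement; for $\nu\ne\eta$, $\nu\prec\eta$ iff $\nu^+<\eta^+$, or $\nu^+=\eta^+$ and $\nu<\eta$, where $\nu<\eta$ means $\sum_{i=1}^p(\eta_i-\nu_i)\ge0$ for all $p$. With $t^\alpha=q$ and $\bar\eta_i=\alpha\eta_i-\#\{k<i:\eta_k\ge\eta_i\}-\#\{k>i:\eta_k>\eta_i\}$, $E_\eta(x;q,t)$ is the unique polynomial $x^\eta+\sum_{\nu\prec\eta}b_{\eta\nu}x^\nu$ with $Y_iE_\eta=t^{\bar\eta_i}E_\eta$ for all $i$. Constants: for a node $s=(i,j)$ of $\eta$ ($1\le j\le\eta_i$) let $a(s)=\eta_i-j$, $a'(s)=j-1$, $l(s)=\#\{k>i:j\le\eta_k\le\eta_i\}+\#\{k<i:j\le\eta_k+1\le\eta_i\}$, $l'(s)=\#\{k>i:\eta_k>\eta_i\}+\#\{k<i:\eta_k\ge\eta_i\}$. Then $d_\eta=\prod_{s}(1-q^{a(s)+1}t^{l(s)+1})$,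 $d'_\eta=\prod_s(1-q^{a(s)+1}t^{l(s)})$, $e_\eta=\prod_s(1-q^{a'(s)+1}t^{n-l'(s)})$. *)

theory Defs
  imports Main "HOL-Computational_Algebra.Polynomial" "HOL-Computational_Algebra.Fraction_Field"
begin

type_synonym qtfield = "rat poly poly fract"

definition qq :: qtfield where "qq = Fract [:0, 1:] 1"
definition tt :: qtfield where "tt = Fract [:[:0, 1:]:] 1"

text \<open>A Laurent polynomial in x_1..x_n is a function from exponent vectors (int lists of
 length n) to coefficients with finite support. Variables are indexed 1..n
 (list position i-1).\<close>

type_synonym 'a lpoly = "int list \<Rightarrow> 'a"
type_synonym 'a lop = "'a lpoly \<Rightarrow> 'a lpoly"

definition laurent :: "nat \<Rightarrow> 'a::zero lpoly \<Rightarrow> bool" where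
  "laurent n f \<longleftrightarrow> finite {a. f a \<noteq> 0} \<and> (\<forall>a. f a \<noteq> 0 \<longrightarrow> length a = n)"

definition swp :: "nat \<Rightarrow> int list \<Rightarrow> int list" where
  "swp i a = a[i - 1 := a ! i, i := a ! (i - 1)]"

text \<open>(s_i f)(x) = f(s_i x)\<close>
definition sop :: "nat \<Rightarrow> 'a lop" where
  "sop i f = (\<lambda>a. f (swp i a))"

text \<open>(tau_i f)(x) = f(x_1,..,q x_i,..,x_n)\<close>
definition tauop :: "'a::field \<Rightarrow> nat \<Rightarrow> 'a lop" where
  "tauop q i f = (\<lambda>a. q powi (a ! (i - 1)) * f a)"

definition mulx :: "nat \<Rightarrow> 'a lop" where
  "mulx i f = (\<lambda>a. f (a[i - 1 := a ! (i - 1) - 1]))"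

definition mulxinv :: "nat \<Rightarrow> 'a lop" where
  "mulxinv i f = (\<lambda>a. f (a[i - 1 := a ! (i - 1) + 1]))"

definition divdiff :: "nat \<Rightarrow> nat \<Rightarrow> 'a::field lop" where
  "divdiff n i f = (THE g. laurent n g \<and>
      (\<lambda>a. mulx i g a - mulx (i + 1) g a) = (\<lambda>a. sop i f a - f a))"

definition Top :: "nat \<Rightarrow> 'a::field \<Rightarrow> nat \<Rightarrow> 'a lop" where
  "Top n t i f = (let g = divdiff n i f in
      (\<lambda>a. t * f a + t * mulx i g a - mulx (i + 1) g a))"

definition Tinv :: "nat \<Rightarrow> 'a::field \<Rightarrow> nat \<Rightarrow> 'a lop" where
  "Tinv n t i f = (\<lambda>a. (inverse t - 1) * f a + inverse t * Top n t i f a)"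

definition comp_ops :: "'a lop list \<Rightarrow> 'a lop" where
  "comp_ops As f = foldr (\<lambda>A g. A g) As f"

definition omega :: "nat \<Rightarrow> 'a::field \<Rightarrow> 'a lop" where
  "omega n q = comp_ops (map sop (rev [1..<n]) @ [tauop q 1])"

definition Yop :: "nat \<Rightarrow> 'a::field \<Rightarrow> 'a \<Rightarrow> nat \<Rightarrow> 'a lop" where
  "Yop n q t i f = (let g = comp_ops (map (Top n t) [i..<n] @ [omega n q] @ map (Tinv n t) [1..<i]) f
      in (\<lambda>a. t powi (int i - int n) * g a))"

definition Tijinv :: "nat \<Rightarrow> 'a::field \<Rightarrow> nat \<Rightarrow> nat \<Rightarrow> 'a lop" where
  "Tijinv n t i j = comp_ops (map (Tinv n t) ([i..<j] @ rev [i..<j - 1]))"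

definition Dop :: "nat \<Rightarrow> 'a::field \<Rightarrow> 'a \<Rightarrow> nat \<Rightarrow> 'a lop" where
  "Dop n q t i f = (let y = Yop n q t i f in
     mulxinv i (\<lambda>a. f a - t ^ (n - 1) *
        (y a + (inverse t - 1) * (\<Sum>j\<in>{i + 1..n}. t ^ (j - i) * Tijinv n t i j y a))))"

definition Phiop :: "nat \<Rightarrow> 'a::field \<Rightarrow> 'a lop" where
  "Phiop n t f = mulx n (comp_ops (map (Tinv n t) (rev [1..<n])) f)"

definition Phihat :: "nat \<Rightarrow> 'a::field \<Rightarrow> 'a \<Rightarrow> 'a lop" where
  "Phihat n q t = comp_ops (map (Top n t) [1..<n] @ [Dop n q t n])"

definition partsum :: "nat list \<Rightarrow> nat \<Rightarrow> nat" where
  "partsum v p = sum_list (take p v)"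

definition dom_le :: "nat list \<Rightarrow> nat list \<Rightarrow> bool" where
  "dom_le \<nu> \<eta> \<longleftrightarrow> (\<forall>p\<in>{1..length \<eta>}. partsum \<nu> p \<le> partsum \<eta> p)"

definition plus_part :: "nat list \<Rightarrow> nat list" where
  "plus_part \<eta> = rev (sort \<eta>)"

definition mac_prec :: "nat list \<Rightarrow> nat list \<Rightarrow> bool" where
  "mac_prec \<nu> \<eta> \<longleftrightarrow> \<nu> \<noteq> \<eta> \<and>
     ((dom_le (plus_part \<nu>) (plus_part \<eta>) \<and> plus_part \<nu> \<noteq> plus_part \<eta>) \<or>
      (plus_part \<nu> = plus_part \<eta> \<and> dom_le \<nu> \<eta>))"

text \<open>t^{bar eta_i} with t^alpha = q (i is 1-based)\<close>
definition eigval :: "'a::field \<Rightarrow> 'a \<Rightarrow> nat list \<Rightarrow> nat \<Rightarrow> 'a" where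
  "eigval q t \<eta> i = (let k = i - 1;
      c = card {m. m < k \<and> \<eta> ! m \<ge> \<eta> ! k} + card {m. k < m \<and> m < length \<eta> \<and> \<eta> ! m > \<eta> ! k}
    in q ^ (\<eta> ! k) * t powi (- int c))"

definition Emac :: "nat \<Rightarrow> 'a::field \<Rightarrow> 'a \<Rightarrow> nat list \<Rightarrow> 'a lpoly" where
  "Emac n q t \<eta> = (THE E. laurent n E \<and> E (map int \<eta>) = 1 \<and>
      (\<forall>a. E a \<noteq> 0 \<longrightarrow> (\<exists>\<nu>. length \<nu> = n \<and> a = map int \<nu> \<and> (\<nu> = \<eta> \<or> mac_prec \<nu> \<eta>))) \<and>
      (\<forall>i\<in>{1..n}. Yop n q t i E = (\<lambda>a. eigval q t \<eta> i * E a)))"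

text \<open>Nodes s = (i,j), 1-based row i (list position i-1) and 1 <= j <= eta_i.\<close>
definition arm :: "nat list \<Rightarrow> nat \<Rightarrow> nat \<Rightarrow> nat" where
  "arm \<eta> i j = \<eta> ! (i - 1) - j"
definition coarm :: "nat list \<Rightarrow> nat \<Rightarrow> nat \<Rightarrow> nat" where
  "coarm \<eta> i j = j - 1"
definition leg :: "nat list \<Rightarrow> nat \<Rightarrow> nat \<Rightarrow> nat" where
  "leg \<eta> i j = card {k. i < k \<and> k \<le> length \<eta> \<and> j \<le> \<eta> ! (k - 1) \<and> \<eta> ! (k - 1) \<le> \<eta> ! (i - 1)}
             + card {k. 1 \<le> k \<and> k < i \<and> j \<le> \<eta> ! (k - 1) + 1 \<and> \<eta> ! (k - 1) + 1 \<le> \<eta> ! (i - 1)}"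
definition coleg :: "nat list \<Rightarrow> nat \<Rightarrow> nat \<Rightarrow> nat" where
  "coleg \<eta> i j = card {k. i < k \<and> k \<le> length \<eta> \<and> \<eta> ! (k - 1) > \<eta> ! (i - 1)}
             + card {k. 1 \<le> k \<and> k < i \<and> \<eta> ! (k - 1) \<ge> \<eta> ! (i - 1)}"

definition nodeprod :: "nat list \<Rightarrow> (nat \<Rightarrow> nat \<Rightarrow> 'a::comm_monoid_mult) \<Rightarrow> 'a" where
  "nodeprod \<eta> F = (\<Prod>i\<in>{1..length \<eta>}. \<Prod>j\<in>{1..\<eta> ! (i - 1)}. F i j)"

definition dconst :: "'a::field \<Rightarrow> 'a \<Rightarrow> nat list \<Rightarrow> 'a" where
  "dconst q t \<eta> = nodeprod \<eta> (\<lambda>i j. 1 - q ^ (arm \<eta> i j + 1) * t ^ (leg \<eta> i j + 1))"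
definition dconst' :: "'a::field \<Rightarrow> 'a \<Rightarrow> nat list \<Rightarrow> 'a" where
  "dconst' q t \<eta> = nodeprod \<eta> (\<lambda>i j. 1 - q ^ (arm \<eta> i j + 1) * t ^ (leg \<eta> i j))"
definition econst :: "nat \<Rightarrow> 'a::field \<Rightarrow> 'a \<Rightarrow> nat list \<Rightarrow> 'a" where
  "econst n q t \<eta> = nodeprod \<eta> (\<lambda>i j. 1 - q ^ (coarm \<eta> i j + 1) * t ^ (n - coleg \<eta> i j))"

text \<open>Series in x and y: coefficient function (x-exponent, y-exponent). The coefficient of
 x^a y^b is the sum of the (nonzero) contributions of the terms of the series.\<close>
type_synonym 'a xyser = "int list \<Rightarrow> int list \<Rightarrow> 'a"

definition KA_term :: "nat \<Rightarrow> 'a::field \<Rightarrow> 'a \<Rightarrow> nat list \<Rightarrow> int list \<Rightarrow> int list \<Rightarrow> 'a" where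
  "KA_term n q t \<eta> a b = dconst q t \<eta> / (dconst' q t \<eta> * econst n q t \<eta>)
       * Emac n q t \<eta> a * Emac n (inverse q) (inverse t) \<eta> b"

definition KA :: "nat \<Rightarrow> 'a::field \<Rightarrow> 'a \<Rightarrow> 'a xyser" where
  "KA n q t = (\<lambda>a b. \<Sum>\<eta>\<in>{\<eta>. length \<eta> = n \<and> KA_term n q t \<eta> a b \<noteq> 0}. KA_term n q t \<eta> a b)"

definition opx :: "'a lop \<Rightarrow> 'a xyser \<Rightarrow> 'a xyser" where
  "opx A K = (\<lambda>a b. A (\<lambda>a'. K a' b) a)"
definition opy :: "'a lop \<Rightarrow> 'a xyser \<Rightarrow> 'a xyser" where
  "opy B K = (\<lambda>a b. B (\<lambda>b'. K a b') b)"

end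

theory Submission
  imports Defs
begin

text \<open>
  A Laurent polynomial is determined by its values at points with distinct nonzero coordinates, so
  the affine Hecke relations reduce to identities between rational functions. The operators
  \<open>Y_i\<close> are triangular for the order on compositions and their diagonal entries separate
  compositions; looking at a maximal exponent one sees that a joint eigenfunction with the
  eigenvalues of \<open>\<eta>\<close> is a multiple of \<open>E_\<eta>\<close>. Since \<open>\<Phi>\<close> and
  \<open>T_i - const\<close> permute the joint eigenfunctions, this gives the existence of all
  \<open>E_\<eta>\<close> as well as the action of \<open>T_i\<close>, \<open>\<Phi>\<close> and of the lowering operator on
  them, the last one because composing it with \<open>\<Phi>\<close> gives \<open>1 - q t^(n-1) Y_1\<close>. Both
  sides of (a) and (b) then agree term by term because passing from \<open>\<eta>\<close> to
  \<open>s_i \<eta>\<close> or \<open>\<Phi> \<eta>\<close> changes a single node of the products \<open>d\<close>, \<open>d'\<close>,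
  \<open>e\<close>. Finally (c) follows from (b) by \<open>D_i = t^(-1) T_i D_(i+1) T_i\<close>.
\<close>

section \<open>Laurent polynomials and their evaluation\<close>

text \<open>Two definite descriptions shape the proof. The divided difference inside
  \<open>Top\<close> and the polynomial \<open>Emac\<close> are both given by \<open>THE\<close>, so
  nothing can be said about them before existence and uniqueness are known; linearity of operators
  is therefore claimed on Laurent polynomials only. Genericity enters as one hypothesis, that
  \<open>q powi a * t powi b = 1\<close> forces both exponents to vanish. It makes the field
  infinite, separates the spectrum and keeps the denominators nonzero, and it is invariant under
  inverting both parameters. Hence the results about \<open>E_\<eta>\<close> are available a second
  time for the variables y, and (a) and (b) compare explicit matrix entries at (q,t) and at the
  inverse parameters. The kernel is an infinite series; what makes it tractable is the grading.
  \<open>E_\<eta>\<close> is homogeneous of degree |\<eta>|, so a coefficient of the kernel is a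
  finite sum once the degree in one set of variables is bounded. The step from (b) to (c) applies
  operators in x after operators in y; their commutation on the kernel rests on all of them shifting
  the degree by a constant.\<close>

lemma laurentI:
  assumes "finite {a. f a \<noteq> 0}" "\<And>a. f a \<noteq> 0 \<Longrightarrow> length a = n"
  shows "laurent n f"
  using assms by (auto simp: laurent_def)

lemma laurent_zero [simp]: "laurent n (\<lambda>_. 0)"
  by (simp add: laurent_def)

lemma laurent_finite: "laurent n f \<Longrightarrow> finite {a. f a \<noteq> 0}"
  by (simp add: laurent_def)

lemma laurent_length: "laurent n f \<Longrightarrow> length a \<noteq> n \<Longrightarrow> f a = 0"
  by (auto simp: laurent_def)

lemma laurent_comb:
  fixes f g :: "'a::field lpoly"
  assumes "laurent n f" "laurent n g"
  shows "laurent n (\<lambda>a. c * f a + d * g a)"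
proof (rule laurentI)
  have "{a. c * f a + d * g a \<noteq> 0} \<subseteq> {a. f a \<noteq> 0} \<union> {a. g a \<noteq> 0}" by auto
  then show "finite {a. c * f a + d * g a \<noteq> 0}"
    using laurent_finite[OF assms(1)] laurent_finite[OF assms(2)] by (simp add: finite_subset)
  show "length a = n" if "c * f a + d * g a \<noteq> 0" for a
  proof (rule ccontr)
    assume "length a \<noteq> n"
    then have "f a = 0" "g a = 0" using assms laurent_length by blast+
    with that show False by simp
  qed
qed

lemma laurent_scale:
  fixes f :: "'a::field lpoly"
  shows "laurent n f \<Longrightarrow> laurent n (\<lambda>a. c * f a)"
  using laurent_comb[of n f f c 0] by simp

lemma laurent_add:
  fixes f g :: "'a::field lpoly"
  shows "laurent n f \<Longrightarrow> laurent n g \<Longrightarrow> laurent n (\<lambda>a. f a + g a)"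
  using laurent_comb[of n f g 1 1] by simp

lemma laurent_diff:
  fixes f g :: "'a::field lpoly"
  shows "laurent n f \<Longrightarrow> laurent n g \<Longrightarrow> laurent n (\<lambda>a. f a - g a)"
  using laurent_comb[of n f g 1 "-1"] by simp

lemma laurent_sum:
  fixes f :: "'b \<Rightarrow> 'a::field lpoly"
  assumes "\<And>j. j \<in> J \<Longrightarrow> laurent n (f j)"
  shows "laurent n (\<lambda>a. \<Sum>j\<in>J. c j * f j a)"
  using assms
proof (induction J rule: infinite_finite_induct)
  case (insert j J)
  then show ?case using laurent_comb[of n "f j" "\<lambda>a. \<Sum>j\<in>J. c j * f j a" "c j" 1] by simp
qed auto

text \<open>Removing one monomial lowers the size of the support. The rule reduces the existence of
  divided differences to monomials.\<close>

lemma laurent_induct [consumes 1, case_names zero add]: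
  fixes f :: "'a::field lpoly"
  assumes "laurent n f"
    and zero: "P (\<lambda>_. 0)"
    and add: "\<And>f b c. laurent n f \<Longrightarrow> P f \<Longrightarrow> length b = n \<Longrightarrow> P (\<lambda>a. f a + (if a = b then c else 0))"
  shows "P f"
  using assms(1)
proof (induction "card {a. f a \<noteq> 0}" arbitrary: f)
  case 0
  then have "{a. f a \<noteq> 0} = {}" using laurent_finite[OF "0.prems"] by simp
  then have "f = (\<lambda>_. 0)" by (auto simp: fun_eq_iff)
  then show ?case using zero by simp
next
  case (Suc k)
  have fin: "finite {a. f a \<noteq> 0}" using Suc.prems laurent_finite by blast
  obtain b where b: "f b \<noteq> 0" using Suc.hyps(2) by (metis (mono_tags, lifting) card.empty empty_Collect_eq nat.distinct(1))
  let ?g = "\<lambda>a. if a = b then 0 else f a"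
  have eq: "{a. ?g a \<noteq> 0} = {a. f a \<noteq> 0} - {b}" by auto
  have "card {a. ?g a \<noteq> 0} = k" unfolding eq using Suc.hyps(2) b fin by (simp add: card_Diff_singleton)
  moreover have lg: "laurent n ?g"
    using Suc.prems unfolding laurent_def eq by auto
  ultimately have "P ?g" by (intro Suc.hyps(1)) auto
  then have "P (\<lambda>a. ?g a + (if a = b then f b else 0))"
    using add[OF lg, of b "f b"] b Suc.prems by (auto simp: laurent_def)
  also have "(\<lambda>a. ?g a + (if a = b then f b else 0)) = f" by auto
  finally show ?case .
qed

text \<open>A left inverse on exponents of length \<open>n\<close> places the new support inside an
  image of the old one. The exchange and the shifts of exponents are instances.\<close>

lemma laurent_reindex:
  assumes f: "laurent n f"
    and h: "\<And>a. length (h a) = length a" "\<And>a. length a = n \<Longrightarrow> h' (h a) = a"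
  shows "laurent n (\<lambda>a. f (h a))"
proof (rule laurentI)
  show len: "length a = n" if "f (h a) \<noteq> 0" for a
    using that f h(1) laurent_length by metis
  have "{a. f (h a) \<noteq> 0} \<subseteq> h' ` {b. f b \<noteq> 0}"
    using len h by (force simp: image_iff)
  then show "finite {a. f (h a) \<noteq> 0}" using f laurent_finite finite_surj by blast
qed

lemma length_swp [simp]: "length (swp i a) = length a"
  by (simp add: swp_def)

lemma swp_swp: "1 \<le> i \<Longrightarrow> i < length a \<Longrightarrow> swp i (swp i a) = a"
  by (auto simp: swp_def nth_list_update list_eq_iff_nth_eq)

lemma laurent_sop: "laurent n f \<Longrightarrow> 1 \<le> i \<Longrightarrow> i < n \<Longrightarrow> laurent n (sop i f)"
  unfolding sop_def by (rule laurent_reindex[where h' = "swp i"]) (auto simp: swp_swp)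

lemma laurent_mulx: "laurent n f \<Longrightarrow> 1 \<le> i \<Longrightarrow> i \<le> n \<Longrightarrow> laurent n (mulx i f)"
  unfolding mulx_def
  by (rule laurent_reindex[where h' = "\<lambda>a. a[i - 1 := a ! (i - 1) + 1]"]) auto

lemma laurent_mulxinv: "laurent n f \<Longrightarrow> 1 \<le> i \<Longrightarrow> i \<le> n \<Longrightarrow> laurent n (mulxinv i f)"
  unfolding mulxinv_def
  by (rule laurent_reindex[where h' = "\<lambda>a. a[i - 1 := a ! (i - 1) - 1]"]) auto

lemma laurent_tauop: "laurent n f \<Longrightarrow> laurent n (tauop q i f)"
  unfolding laurent_def tauop_def by (auto elim: rev_finite_subset)

section \<open>Evaluation at points with coordinates in the field\<close>

definition mon :: "(nat \<Rightarrow> 'a::field) \<Rightarrow> int list \<Rightarrow> 'a" where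
  "mon x a = (\<Prod>i<length a. x i powi (a ! i))"

text \<open>Points are indexed from 0 like list positions, so the variable written x_i is the
  coordinate \<open>x (i - 1)\<close>.\<close>

definition ev :: "'a::field lpoly \<Rightarrow> (nat \<Rightarrow> 'a) \<Rightarrow> 'a" where
  "ev f x = (\<Sum>a\<in>{a. f a \<noteq> 0}. f a * mon x a)"

lemma ev_superset:
  assumes "finite A" "{a. f a \<noteq> 0} \<subseteq> A"
  shows "ev f x = (\<Sum>a\<in>A. f a * mon x a)"
  unfolding ev_def by (rule sum.mono_neutral_left) (use assms in auto)

lemma ev_comb:
  assumes "laurent n f" "laurent n g"
  shows "ev (\<lambda>a. c * f a + d * g a) x = c * ev f x + d * ev g x"
proof -
  let ?A = "{a. f a \<noteq> 0} \<union> {a. g a \<noteq> 0}"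
  have fin: "finite ?A" using assms laurent_finite by blast
  have "ev f x = (\<Sum>a\<in>?A. f a * mon x a)" "ev g x = (\<Sum>a\<in>?A. g a * mon x a)"
    "ev (\<lambda>a. c * f a + d * g a) x = (\<Sum>a\<in>?A. (c * f a + d * g a) * mon x a)"
    by (rule ev_superset[OF fin]; auto)+
  then show ?thesis by (simp add: sum_distrib_left sum.distrib algebra_simps)
qed

lemma ev_scale: "laurent n f \<Longrightarrow> ev (\<lambda>a. c * f a) x = c * ev f x"
  using ev_comb[of n f f c 0 x] by simp

lemma ev_diff: "laurent n f \<Longrightarrow> laurent n g \<Longrightarrow> ev (\<lambda>a. f a - g a) x = ev f x - ev g x"
  using ev_comb[of n f g 1 "-1" x] by simp

lemma ev_reindex:
  assumes f: "laurent n f"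
    and h: "\<And>a. length (h a) = length a" "\<And>a. length a = n \<Longrightarrow> h' (h a) = a"
      "\<And>a. length (h' a) = length a" "\<And>a. length a = n \<Longrightarrow> h (h' a) = a"
  shows "ev (\<lambda>a. f (h a)) x = (\<Sum>b\<in>{b. f b \<noteq> 0}. f b * mon x (h' b))"
  unfolding ev_def
proof (rule sum.reindex_bij_witness[where i = h' and j = h])
  fix a assume "a \<in> {a. f (h a) \<noteq> 0}"
  then have nz: "f (h a) \<noteq> 0" by simp
  then have "length (h a) = n" using laurent_length[OF f] by blast
  then have *: "h' (h a) = a" using h(1,2) by simp
  show "h' (h a) = a" by (rule *)
  show "h a \<in> {b. f b \<noteq> 0}" using nz by simp
  show "f (h a) * mon x (h' (h a)) = f (h a) * mon x a" unfolding * ..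
next
  fix b assume "b \<in> {b. f b \<noteq> 0}"
  then have nz: "f b \<noteq> 0" by simp
  then have "length b = n" using laurent_length[OF f] by blast
  then have *: "h (h' b) = b" by (rule h(4))
  show "h (h' b) = b" by (rule *)
  show "h' b \<in> {a. f (h a) \<noteq> 0}" using nz unfolding mem_Collect_eq * .
qed

lemma prod_split2:
  fixes f :: "nat \<Rightarrow> 'a::comm_monoid_mult"
  assumes "j < n" "k < n" "j \<noteq> k"
  shows "prod f {..<n} = f j * f k * prod f ({..<n} - {j, k})"
proof -
  have "prod f {..<n} = f j * prod f ({..<n} - {j})" using assms by (simp add: prod.remove)
  also have "prod f ({..<n} - {j}) = f k * prod f ({..<n} - {j} - {k})"
    using assms by (simp add: prod.remove)
  also have "{..<n} - {j} - {k} = {..<n} - {j, k}" by auto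
  finally show ?thesis by (simp add: mult.assoc)
qed

lemma sum_split2:
  fixes f :: "nat \<Rightarrow> 'a::comm_monoid_add"
  assumes "j < n" "k < n" "j \<noteq> k"
  shows "sum f {..<n} = f j + f k + sum f ({..<n} - {j, k})"
proof -
  have "sum f {..<n} = f j + sum f ({..<n} - {j})" using assms by (simp add: sum.remove)
  also have "sum f ({..<n} - {j}) = f k + sum f ({..<n} - {j} - {k})"
    using assms by (simp add: sum.remove)
  also have "{..<n} - {j} - {k} = {..<n} - {j, k}" by auto
  finally show ?thesis by (simp add: add.assoc)
qed

text \<open>The counterpart of \<open>swp\<close> on arguments. The codomain is left open because
  the same exchange later acts on relabellings of positions.\<close>

definition swpt :: "nat \<Rightarrow> (nat \<Rightarrow> 'a) \<Rightarrow> nat \<Rightarrow> 'a" where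
  "swpt i x = x(i - 1 := x i, i := x (i - 1))"

lemma mon_swp:
  assumes "1 \<le> i" "i < length a"
  shows "mon x (swp i a) = mon (swpt i x) a"
proof -
  let ?n = "length a"
  have ii: "i - 1 < ?n" "i < ?n" "i - 1 \<noteq> i" using assms by auto
  have "(\<Prod>k\<in>{..<?n} - {i - 1, i}. x k powi (swp i a ! k))
      = (\<Prod>k\<in>{..<?n} - {i - 1, i}. swpt i x k powi (a ! k))"
    by (rule prod.cong) (auto simp: swp_def swpt_def nth_list_update)
  moreover have "swp i a ! (i - 1) = a ! i" "swp i a ! i = a ! (i - 1)"
    "swpt i x (i - 1) = x i" "swpt i x i = x (i - 1)"
    using ii by (simp_all add: swp_def swpt_def nth_list_update)
  ultimately show ?thesis
    unfolding mon_def length_swp prod_split2[OF ii] by (simp add: mult.commute)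
qed

lemma mon_update:
  assumes "k < length a" "x k \<noteq> 0"
  shows "mon x (a[k := a ! k + e]) = x k powi e * mon x a"
proof -
  have "mon x (a[k := a ! k + e])
      = x k powi (a ! k + e) * (\<Prod>i\<in>{..<length a} - {k}. x i powi (a[k := a ! k + e] ! i))"
    unfolding mon_def using assms by (simp add: prod.remove[of _ k])
  also have "(\<Prod>i\<in>{..<length a} - {k}. x i powi (a[k := a ! k + e] ! i))
      = (\<Prod>i\<in>{..<length a} - {k}. x i powi (a ! i))"
    by (rule prod.cong) auto
  also have "x k powi (a ! k + e) * \<dots> = x k powi e * mon x a"
    unfolding mon_def using assms by (simp add: prod.remove[of _ k] power_int_add mult_ac)
  finally show ?thesis .
qed

lemma ev_sop:
  assumes "laurent n f" "1 \<le> i" "i < n"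
  shows "ev (sop i f) x = ev f (swpt i x)"
proof -
  have "ev (sop i f) x = (\<Sum>b\<in>{b. f b \<noteq> 0}. f b * mon x (swp i b))"
    unfolding sop_def by (rule ev_reindex[OF assms(1)]) (use assms in \<open>auto simp: swp_swp\<close>)
  also have "\<dots> = ev f (swpt i x)"
    unfolding ev_def using assms by (intro sum.cong) (auto simp: mon_swp laurent_def)
  finally show ?thesis .
qed

lemma ev_mulx:
  assumes "laurent n f" "1 \<le> i" "i \<le> n" "x (i - 1) \<noteq> 0"
  shows "ev (mulx i f) x = x (i - 1) * ev f x"
proof -
  have "ev (mulx i f) x = (\<Sum>b\<in>{b. f b \<noteq> 0}. f b * mon x (b[i - 1 := b ! (i - 1) + 1]))"
    unfolding mulx_def by (rule ev_reindex[OF assms(1)]) (use assms in auto)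
  also have "\<dots> = (\<Sum>b\<in>{b. f b \<noteq> 0}. x (i - 1) * (f b * mon x b))"
    using assms mon_update[of "i - 1" _ x 1]
    by (intro sum.cong refl) (auto simp: laurent_def)
  finally show ?thesis by (simp add: ev_def sum_distrib_left)
qed

lemma ev_tauop:
  assumes "laurent n f" "1 \<le> i" "i \<le> n" "q \<noteq> 0"
  shows "ev (tauop q i f) x = ev f (x(i - 1 := q * x (i - 1)))"
proof -
  have *: "mon (x(i - 1 := q * x (i - 1))) a = q powi (a ! (i - 1)) * mon x a"
    if "length a = n" for a
  proof -
    have i: "i - 1 \<in> {..<n}" using assms by auto
    have "(\<Prod>k\<in>{..<n} - {i - 1}. (x(i - 1 := q * x (i - 1))) k powi (a ! k))
        = (\<Prod>k\<in>{..<n} - {i - 1}. x k powi (a ! k))"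
      by (rule prod.cong) auto
    then show ?thesis unfolding mon_def that
      using i by (simp add: prod.remove[of _ "i - 1"] power_int_mult_distrib mult_ac)
  qed
  have "{a. tauop q i f a \<noteq> 0} = {a. f a \<noteq> 0}" using assms by (auto simp: tauop_def power_int_not_zero)
  then show ?thesis unfolding ev_def
    using assms(1) * by (intro sum.cong) (auto simp: tauop_def laurent_def)
qed

section \<open>Kronecker substitution and generic points\<close>

lemma digits_unique:
  fixes N :: nat
  assumes "\<forall>i<n. d i < N" "\<forall>i<n. e i < N" "(\<Sum>i<n. d i * N ^ i) = (\<Sum>i<n. e i * N ^ i)"
  shows "\<forall>i<n. d i = e i"
  using assms
proof (induction n arbitrary: d e)
  case (Suc n)
  have sp: "(\<Sum>i<Suc n. g i * N ^ i) = g 0 + N * (\<Sum>i<n. g (Suc i) * N ^ i)" for g :: "nat \<Rightarrow> nat"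
    by (simp only: sum.lessThan_Suc_shift) (simp add: sum_distrib_left mult_ac)
  have eq: "d 0 + N * (\<Sum>i<n. d (Suc i) * N ^ i) = e 0 + N * (\<Sum>i<n. e (Suc i) * N ^ i)"
    using Suc.prems(3) unfolding sp .
  have lt: "d 0 < N" "e 0 < N" using Suc.prems by auto
  have "(d 0 + N * (\<Sum>i<n. d (Suc i) * N ^ i)) mod N = d 0"
    "(e 0 + N * (\<Sum>i<n. e (Suc i) * N ^ i)) mod N = e 0"
    using lt by simp_all
  with eq have 0: "d 0 = e 0" by metis
  with eq lt have "(\<Sum>i<n. d (Suc i) * N ^ i) = (\<Sum>i<n. e (Suc i) * N ^ i)" by simp
  then have "\<forall>i<n. d (Suc i) = e (Suc i)"
    using Suc.IH[of "\<lambda>i. d (Suc i)" "\<lambda>i. e (Suc i)"] Suc.prems(1,2) by blast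
  with 0 show ?case by (auto simp: less_Suc_eq_0_disj)
qed simp

text \<open>Nonzero coordinates admit negative exponents; distinct ones admit division by x_i -
  x_{i+1}.\<close>

definition generic_pt :: "nat \<Rightarrow> (nat \<Rightarrow> 'a::field) \<Rightarrow> bool" where
  "generic_pt n x \<longleftrightarrow> (\<forall>i<n. x i \<noteq> 0) \<and> inj_on x {..<n}"

text \<open>Kronecker substitution \<open>x_i = z ^ (N ^ i)\<close> with \<open>N\<close> large turns a nonzero Laurent
  polynomial into a nonzero univariate one.\<close>

lemma ev_nonzero:
  fixes f :: "'a::field lpoly"
  assumes inf: "infinite (UNIV :: 'a set)" and f: "laurent n f" and "f a0 \<noteq> 0"
  shows "\<exists>x. generic_pt n x \<and> ev f x \<noteq> 0"
proof -
  let ?S = "{a. f a \<noteq> 0}"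
  have fin: "finite ?S" using f laurent_finite by blast
  have finset: "finite (\<Union>a\<in>?S. abs ` set a)" using fin by auto
  \<comment> \<open>The shift by \<open>B\<close> makes all exponents nonnegative and leaves digits
    between 0 and 2 B, so base 2 B + 1 separates them. The inserted 1 guarantees
    \<open>N \<ge> 2\<close>, which keeps the powers \<open>N ^ i\<close> distinct.\<close>
  define B where "B = Max (insert 1 (\<Union>a\<in>?S. abs ` set a))"
  have B1: "B \<ge> 1" unfolding B_def using finset by (intro Max_ge) auto
  have Bge: "\<bar>a ! i\<bar> \<le> B" if "a \<in> ?S" "i < n" for a i
    unfolding B_def using finset that f by (intro Max_ge) (auto simp: laurent_def)
  define N where "N = nat (2 * B + 1)"
  have N: "N \<ge> 2" unfolding N_def using B1 by auto
  define e where "e a = (\<Sum>i<n. nat (a ! i + B) * N ^ i)" for a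
  have inj: "inj_on e ?S"
  proof (rule inj_onI)
    fix a b assume ab: "a \<in> ?S" "b \<in> ?S" "e a = e b"
    have "\<forall>i<n. nat (a ! i + B) = nat (b ! i + B)"
      by (rule digits_unique[where N = N]) (use ab Bge in \<open>force simp: N_def e_def\<close>)+
    then have "\<forall>i<n. a ! i = b ! i" using ab Bge by (smt (verit) nat_eq_iff2)
    then show "a = b" using ab f by (auto simp: laurent_def intro!: nth_equalityI)
  qed
  define P where "P = (\<Sum>a\<in>?S. monom (f a) (e a))"
  have "coeff P (e a0) = (\<Sum>a\<in>?S. if a = a0 then f a else 0)"
    unfolding P_def coeff_sum using inj assms(3)
    by (intro sum.cong) (auto simp: inj_on_def)
  also have "\<dots> = f a0" using fin assms(3) by (simp add: sum.delta)
  finally have "P \<noteq> 0" using assms(3) by auto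
  \<comment> \<open>The roots of \<open>Q i j\<close> are the arguments at which coordinates
    \<open>i\<close> and \<open>j\<close> of the substituted point coincide.\<close>
  define Q where "Q i j = monom (1::'a) (N ^ j) - monom 1 (N ^ i)" for i j
  have Q: "Q i j \<noteq> 0" if "i < j" for i j
  proof
    assume "Q i j = 0"
    then have "coeff (Q i j) (N ^ j) = 0" by simp
    moreover have "N ^ i \<noteq> N ^ j" using that N by auto
    ultimately show False by (simp add: Q_def)
  qed
  let ?bad = "{z. poly P z = 0} \<union> {0} \<union> (\<Union>i<n. \<Union>j\<in>{i<..<n}. {z. poly (Q i j) z = 0})"
  have "finite ?bad" using \<open>P \<noteq> 0\<close> Q by (auto intro!: poly_roots_finite)
  then have "\<exists>z. z \<notin> ?bad" by (rule ex_new_if_finite[OF inf])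
  then obtain z where z: "z \<notin> ?bad" ..
  define x where "x i = z ^ (N ^ i)" for i
  have z0: "z \<noteq> 0" using z by auto
  have ne: "x i \<noteq> x j" if "i < j" "j < n" for i j
  proof -
    have "poly (Q i j) z \<noteq> 0" using z that by auto
    then show ?thesis by (auto simp: Q_def poly_monom x_def)
  qed
  have "generic_pt n x"
    unfolding generic_pt_def inj_on_def
  proof (intro conjI allI impI ballI)
    show "x i \<noteq> 0" for i using z0 by (simp add: x_def)
    show "i = j" if "i \<in> {..<n}" "j \<in> {..<n}" "x i = x j" for i j
      using that ne[of i j] ne[of j i] by (cases i j rule: linorder_cases) auto
  qed
  moreover have "ev f x \<noteq> 0"
  proof
    assume ev0: "ev f x = 0"
    \<comment> \<open>The shift by \<open>B\<close> contributes one power of \<open>z\<close> common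
      to all monomials, so \<open>poly P z\<close> and \<open>ev f x\<close> vanish
      together.\<close>
    have *: "z ^ e a = z powi (\<Sum>i<n. B * int (N ^ i)) * mon x a" if "a \<in> ?S" for a
    proof -
      have len: "length a = n" using that f by (auto simp: laurent_def)
      have "z ^ e a = (\<Prod>i<n. z ^ (nat (a ! i + B) * N ^ i))"
        unfolding e_def by (simp add: power_sum)
      also have "\<dots> = (\<Prod>i<n. z powi (B * int (N ^ i)) * x i powi (a ! i))"
      proof (rule prod.cong, rule refl)
        fix i assume "i \<in> {..<n}"
        then have "a ! i + B \<ge> 0" using Bge[OF that, of i] by auto
        then have "z ^ (nat (a ! i + B) * N ^ i) = z powi ((a ! i + B) * int (N ^ i))"
          by (simp add: power_int_def nat_mult_distrib nat_power_eq)
        also have "\<dots> = z powi (B * int (N ^ i)) * z powi (int (N ^ i) * (a ! i))"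
          using z0 by (simp add: power_int_add[symmetric] algebra_simps)
        also have "z powi (int (N ^ i) * (a ! i)) = x i powi (a ! i)"
          by (simp only: power_int_mult x_def power_int_of_nat)
        finally show "z ^ (nat (a ! i + B) * N ^ i) = z powi (B * int (N ^ i)) * x i powi (a ! i)" .
      qed
      also have "\<dots> = (\<Prod>i<n. z powi (B * int (N ^ i))) * mon x a"
        by (simp add: prod.distrib mon_def len)
      also have "(\<Prod>i<k. z powi (B * int (N ^ i))) = z powi (\<Sum>i<k. B * int (N ^ i))" for k
        by (induction k) (use z0 in \<open>auto simp: power_int_add\<close>)
      finally show ?thesis .
    qed
    have "poly P z = (\<Sum>a\<in>?S. f a * z ^ e a)"
      by (simp add: P_def poly_sum poly_monom)
    also have "\<dots> = (\<Sum>a\<in>?S. z powi (\<Sum>i<n. B * int (N ^ i)) * (f a * mon x a))"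
      using * by (intro sum.cong) auto
    also have "\<dots> = 0" using ev0 by (simp add: ev_def sum_distrib_left[symmetric])
    finally show False using z by auto
  qed
  ultimately show ?thesis by blast
qed

lemma laurent_eqI:
  fixes f g :: "'a::field lpoly"
  assumes "infinite (UNIV :: 'a set)" "laurent n f" "laurent n g"
    and eq: "\<And>x. generic_pt n x \<Longrightarrow> ev f x = ev g x"
  shows "f = g"
proof (rule ccontr)
  assume "f \<noteq> g"
  then obtain a where "f a - g a \<noteq> 0" by (auto simp: fun_eq_iff)
  then obtain x where "generic_pt n x" "ev (\<lambda>a. f a - g a) x \<noteq> 0"
    using ev_nonzero[OF assms(1) laurent_diff[OF assms(2,3)]] by blast
  then show False using eq ev_diff[OF assms(2,3)] by simp
qed

lemma generic_pt_swpt: "generic_pt n x \<Longrightarrow> 1 \<le> i \<Longrightarrow> i < n \<Longrightarrow> generic_pt n (swpt i x)"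
proof -
  assume x: "generic_pt n x" and i: "1 \<le> i" "i < n"
  define \<sigma> where "\<sigma> j = (if j = i - 1 then i else if j = i then i - 1 else j)" for j
  have "swpt i x = x \<circ> \<sigma>" using i by (auto simp: swpt_def \<sigma>_def fun_eq_iff)
  moreover have "inj_on \<sigma> {..<n}" using i by (auto simp: inj_on_def \<sigma>_def split: if_splits)
  moreover have "\<sigma> j < n" if "j < n" for j using i that by (auto simp: \<sigma>_def)
  moreover have "inj_on x (\<sigma> ` {..<n})"
    by (rule inj_on_subset[of x "{..<n}"]) (use x calculation(3) in \<open>auto simp: generic_pt_def\<close>)
  ultimately show ?thesis using x comp_inj_on[of \<sigma> "{..<n}" x] by (auto simp: generic_pt_def)
qed

lemma generic_ptD:
  assumes "generic_pt n x"
  shows "i < n \<Longrightarrow> x i \<noteq> 0" "i < n \<Longrightarrow> j < n \<Longrightarrow> i \<noteq> j \<Longrightarrow> x i \<noteq> x j"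
  using assms by (auto simp: generic_pt_def inj_on_def)

section \<open>Demazure--Lusztig operators\<close>

declare One_nat_def [simp del]

text \<open>Both clauses are restricted to Laurent polynomials: outside them the description behind
  \<open>divdiff\<close> has no known value.\<close>

definition linop :: "nat \<Rightarrow> 'a::field lop \<Rightarrow> bool" where
  "linop n A \<longleftrightarrow> (\<forall>f. laurent n f \<longrightarrow> laurent n (A f)) \<and>
     (\<forall>f g c d. laurent n f \<longrightarrow> laurent n g \<longrightarrow>
        A (\<lambda>a. c * f a + d * g a) = (\<lambda>a. c * A f a + d * A g a))"

lemma linop_laurent: "linop n A \<Longrightarrow> laurent n f \<Longrightarrow> laurent n (A f)"
  by (simp add: linop_def)

lemma linop_comb:
  "linop n A \<Longrightarrow> laurent n f \<Longrightarrow> laurent n g \<Longrightarrow>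
    A (\<lambda>a. c * f a + d * g a) = (\<lambda>a. c * A f a + d * A g a)"
  by (simp add: linop_def)

lemma linop_scale: "linop n A \<Longrightarrow> laurent n f \<Longrightarrow> A (\<lambda>a. c * f a) = (\<lambda>a. c * A f a)"
  using linop_comb[of n A f f c 0] by simp

lemma linop_zero: "linop n A \<Longrightarrow> A (\<lambda>_. 0) = (\<lambda>_. 0)"
  using linop_scale[of n A "\<lambda>_. 0" 0] by simp

lemma linop_sum:
  assumes A: "linop n A" and f: "\<And>j. j \<in> J \<Longrightarrow> laurent n (f j)"
  shows "A (\<lambda>a. \<Sum>j\<in>J. c j * f j a) = (\<lambda>a. \<Sum>j\<in>J. c j * A (f j) a)"
  using f
proof (induction J rule: infinite_finite_induct)
  case (insert j J)
  have "A (\<lambda>a. \<Sum>j\<in>insert j J. c j * f j a)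
      = A (\<lambda>a. c j * f j a + 1 * (\<Sum>j\<in>J. c j * f j a))"
    using insert by simp
  also have "\<dots> = (\<lambda>a. c j * A (f j) a + 1 * A (\<lambda>a. \<Sum>j\<in>J. c j * f j a) a)"
    using insert by (intro linop_comb[OF A] laurent_sum) auto
  finally show ?case using insert by simp
qed (use linop_zero[OF A] in auto)

lemma linop_comp:
  assumes "linop n A" "linop n B"
  shows "linop n (\<lambda>f. A (B f))"
  using assms unfolding linop_def by auto

lemma linop_comp_ops:
  assumes "\<And>A. A \<in> set As \<Longrightarrow> linop n A"
  shows "linop n (comp_ops As)"
  using assms
proof (induction As)
  case Nil
  then show ?case by (simp add: linop_def comp_ops_def)
next
  case (Cons A As)
  then have "linop n (\<lambda>f. A (comp_ops As f))" by (intro linop_comp[of n A "comp_ops As"]) auto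
  then show ?case by (simp add: comp_ops_def)
qed

lemma comp_ops_Nil [simp]: "comp_ops [] f = f"
  by (simp add: comp_ops_def)

lemma comp_ops_Cons [simp]: "comp_ops (A # As) f = A (comp_ops As f)"
  by (simp add: comp_ops_def)

lemma comp_ops_append [simp]: "comp_ops (As @ Bs) f = comp_ops As (comp_ops Bs f)"
  by (simp add: comp_ops_def)

lemma linop_scaled: "linop n A \<Longrightarrow> linop n (\<lambda>f a. c * A f a)"
  unfolding linop_def by (auto simp: laurent_scale algebra_simps)

lemma linop_plus:
  "linop n A \<Longrightarrow> linop n B \<Longrightarrow> linop n (\<lambda>f a. A f a + B f a)"
  unfolding linop_def by (auto simp: laurent_add algebra_simps)

lemma linop_id: "linop n (\<lambda>f. f)"
  by (simp add: linop_def)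

lemma linop_setsum:
  "(\<And>j. j \<in> J \<Longrightarrow> linop n (A j)) \<Longrightarrow> linop n (\<lambda>f a. \<Sum>j\<in>J. A j f a)"
proof (induction J rule: infinite_finite_induct)
  case (insert j J)
  then show ?case using linop_plus[of n "A j" "\<lambda>f a. \<Sum>j\<in>J. A j f a"] by simp
qed (auto simp: linop_def)

lemma linop_sop: "1 \<le> i \<Longrightarrow> i < n \<Longrightarrow> linop n (sop i)"
  using laurent_sop by (fastforce simp: linop_def sop_def)

lemma linop_mulx: "1 \<le> i \<Longrightarrow> i \<le> n \<Longrightarrow> linop n (mulx i)"
  using laurent_mulx by (fastforce simp: linop_def mulx_def)

lemma linop_mulxinv: "1 \<le> i \<Longrightarrow> i \<le> n \<Longrightarrow> linop n (mulxinv i)"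
  using laurent_mulxinv by (fastforce simp: linop_def mulxinv_def)

lemma linop_tauop: "linop n (tauop q i)"
  using laurent_tauop by (auto simp: linop_def tauop_def algebra_simps)

section \<open>Existence of divided differences\<close>

lemma divdiff_monomial:
  fixes c :: "'a::field"
  assumes b: "length b = n" and i: "1 \<le> i" "i < n" and le: "b ! (i - 1) \<le> b ! i"
  shows "\<exists>g. laurent n g \<and> (\<lambda>a. mulx i g a - mulx (i + 1) g a)
      = (\<lambda>a. (if swp i a = b then c else 0) - (if a = b then c else 0))"
proof -
  define k where "k = i - 1"
  have k: "i = Suc k" "k < n" "Suc k < n" using i by (auto simp: k_def)
  define p r where "p = b ! k" and "r = b ! Suc k"
  have pr: "p \<le> r" using le by (simp add: p_def r_def k)
  \<comment> \<open>The quotient of x_i^r x_{i+1}^p - x_i^p x_{i+1}^r by x_i - x_{i+1} is the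
    geometric sum of x_i^u x_{i+1}^(p+r-1-u) over p \<le> u < r. The first condition says that
    \<open>a\<close> agrees with \<open>b\<close> away from the two positions.\<close>
  define g where "g a = (if a[k := p, Suc k := r] = b \<and> a ! k + a ! Suc k = p + r - 1
      \<and> p \<le> a ! k \<and> a ! k < r then c else 0)" for a
  have "{a. g a \<noteq> 0} \<subseteq> (\<lambda>u. b[k := u, Suc k := p + r - 1 - u]) ` {p..r}"
  proof
    fix a assume "a \<in> {a. g a \<noteq> 0}"
    then have a: "a[k := p, Suc k := r] = b" "a ! k + a ! Suc k = p + r - 1" "p \<le> a ! k" "a ! k < r"
      by (auto simp: g_def split: if_splits)
    then have "length a = n" using b by auto
    then have "b[k := a ! k, Suc k := a ! Suc k] = a"
      using k by (auto simp: a(1)[symmetric] nth_list_update list_eq_iff_nth_eq)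
    moreover have "a ! Suc k = p + r - 1 - a ! k" using a by simp
    ultimately have "a = b[k := a ! k, Suc k := p + r - 1 - a ! k]" by simp
    then show "a \<in> (\<lambda>u. b[k := u, Suc k := p + r - 1 - u]) ` {p..r}" using a by (intro image_eqI[of _ _ "a ! k"]) auto
  qed
  then have fin: "finite {a. g a \<noteq> 0}" by (rule finite_subset) auto
  have lg: "laurent n g"
    by (rule laurentI[OF fin]) (use b in \<open>auto simp: g_def split: if_splits\<close>)
  have "mulx i g a - mulx (i + 1) g a = (if swp i a = b then c else 0) - (if a = b then c else 0)" for a
  proof (cases "length a = n")
    case False
    then show ?thesis using b lg by (auto simp: mulx_def laurent_length)
  next
    case True
    define u v where "u = a ! k" and "v = a ! Suc k"
    define C where "C \<longleftrightarrow> a[k := p, Suc k := r] = b"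
    have 1: "mulx i g a = (if C \<and> u + v = p + r \<and> p < u \<and> u \<le> r then c else 0)"
      using True k by (auto simp: mulx_def g_def C_def u_def v_def)
    have "a[Suc k := v - 1, k := p, Suc k := r] = a[k := p, Suc k := r]"
      using True k by (auto simp: list_eq_iff_nth_eq nth_list_update)
    then have 2: "mulx (i + 1) g a = (if C \<and> u + v = p + r \<and> p \<le> u \<and> u < r then c else 0)"
      using True k by (auto simp: mulx_def g_def C_def u_def v_def simp flip: Suc_eq_plus1)
    have 3: "a = b \<longleftrightarrow> C \<and> u = p \<and> v = r"
    proof
      assume "a = b" then show "C \<and> u = p \<and> v = r"
        by (auto simp: C_def u_def v_def p_def r_def)
    next
      assume "C \<and> u = p \<and> v = r"
      then have C: "b = a[k := a ! k, Suc k := a ! Suc k]" by (auto simp: C_def u_def v_def)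
      then show "a = b" by simp
    qed
    have 4: "swp i a = b \<longleftrightarrow> C \<and> v = p \<and> u = r"
    proof
      assume s: "swp i a = b"
      then have sb: "b = a[k := v, Suc k := u]" by (simp add: swp_def k u_def v_def)
      then have "p = v" "r = u" using True k by (auto simp: p_def r_def)
      then show "C \<and> v = p \<and> u = r" using sb by (simp add: C_def)
    next
      assume "C \<and> v = p \<and> u = r"
      then show "swp i a = b" by (auto simp: C_def u_def v_def swp_def k)
    qed
    show ?thesis unfolding 1 2 3 4 using pr
      by (cases C; cases "u + v = p + r"; cases "u = r"; cases "u = p"; simp)
  qed
  then show ?thesis using lg by blast
qed

lemma divdiff_exists:
  fixes f :: "'a::field lpoly"
  assumes f: "laurent n f" and i: "1 \<le> i" "i < n"
  shows "\<exists>g. laurent n g \<and> (\<lambda>a. mulx i g a - mulx (i + 1) g a) = (\<lambda>a. sop i f a - f a)"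
  using f
proof (induction rule: laurent_induct)
  case zero
  show ?case by (rule exI[of _ "\<lambda>_. 0"]) (simp add: mulx_def sop_def)
next
  case (add f b c)
  obtain g where g: "laurent n g" "\<And>a. mulx i g a - mulx (i + 1) g a = sop i f a - f a"
    using add by (auto simp: fun_eq_iff)
  have "\<exists>h. laurent n h \<and> (\<forall>a. mulx i h a - mulx (i + 1) h a
      = (if swp i a = b then c else 0) - (if a = b then c else 0))"
  proof (cases "b ! (i - 1) \<le> b ! i")
    case True
    then show ?thesis using divdiff_monomial[of b n i c] add i by (simp add: fun_eq_iff)
  next
    case False
    \<comment> \<open>A descending pair is exchanged first; s_i - 1 changes sign under this
      exchange, whence the factor -1 on \<open>h\<close>.\<close>
    have "swp i b ! (i - 1) \<le> swp i b ! i" using False add i by (simp add: swp_def)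
    then obtain h where h: "laurent n h" "\<And>a. mulx i h a - mulx (i + 1) h a
      = (if swp i a = swp i b then c else 0) - (if a = swp i b then c else 0)"
      using divdiff_monomial[of "swp i b" n i c] add i by (auto simp: fun_eq_iff)
    have eqs: "swp i a = swp i b \<longleftrightarrow> a = b" "a = swp i b \<longleftrightarrow> swp i a = b" for a
      using add i by (metis length_swp swp_swp)+
    have "laurent n (\<lambda>a. - 1 * h a)" by (rule laurent_scale[OF h(1)])
    moreover have "mulx i (\<lambda>a. - 1 * h a) a - mulx (i + 1) (\<lambda>a. - 1 * h a) a
      = (if swp i a = b then c else 0) - (if a = b then c else 0)" for a
    proof -
      have "mulx i (\<lambda>a. - 1 * h a) a - mulx (i + 1) (\<lambda>a. - 1 * h a) a
        = - (mulx i h a - mulx (i + 1) h a)" by (simp add: mulx_def)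
      also have "\<dots> = (if swp i a = b then c else 0) - (if a = b then c else 0)"
        unfolding h(2) eqs(1) eqs(2)[of a] by simp
      finally show ?thesis .
    qed
    ultimately show ?thesis by blast
  qed
  then obtain h where h: "laurent n h" "\<And>a. mulx i h a - mulx (i + 1) h a
      = (if swp i a = b then c else 0) - (if a = b then c else 0)" by blast
  show ?case
  proof (intro exI[of _ "\<lambda>a. g a + h a"] conjI ext)
    show "laurent n (\<lambda>a. g a + h a)" by (rule laurent_add[OF g(1) h(1)])
    fix a
    show "mulx i (\<lambda>a. g a + h a) a - mulx (i + 1) (\<lambda>a. g a + h a) a
        = sop i (\<lambda>a. f a + (if a = b then c else 0)) a - (f a + (if a = b then c else 0))"
    proof -
      have "mulx i (\<lambda>a. g a + h a) a - mulx (i + 1) (\<lambda>a. g a + h a) a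
        = (mulx i g a - mulx (i + 1) g a) + (mulx i h a - mulx (i + 1) h a)" by (simp add: mulx_def)
      then show ?thesis unfolding g(2) h(2) by (simp add: sop_def)
    qed
  qed
qed

text \<open>With \<open>hecke_b\<close> these are the coefficients in T_i f = a f + b s_i f, as
  functions of u = x_i and v = x_{i+1}.\<close>

definition hecke_a :: "'a::field \<Rightarrow> 'a \<Rightarrow> 'a \<Rightarrow> 'a" where
  "hecke_a t u v = (1 - t) * v / (u - v)"
definition hecke_b :: "'a::field \<Rightarrow> 'a \<Rightarrow> 'a \<Rightarrow> 'a" where
  "hecke_b t u v = (t * u - v) / (u - v)"

text \<open>The braid relation compares six coefficients, one for each element of S_3. Those of the
  two products of length two and of the longest element agree factor by factor; the identities here
  belong to the two simple transpositions, after cancelling a factor \<open>hecke_b\<close>, and to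
  the neutral element.\<close>

lemma hecke_ab_braid:
  assumes "u \<noteq> v" "u \<noteq> w" "v \<noteq> w"
  shows "hecke_a t u v * hecke_a t v w + hecke_a t u w * hecke_a t v u = hecke_a t v w * hecke_a t u w"
    and "hecke_a t u v * hecke_a t u w = hecke_a t v w * hecke_a t u v + hecke_a t u w * hecke_a t w v"
    and "hecke_a t u v * hecke_a t u v * hecke_a t v w + hecke_b t u v * hecke_a t u w * hecke_b t v u
      = hecke_a t v w * hecke_a t v w * hecke_a t u v + hecke_b t v w * hecke_a t u w * hecke_b t w v"
proof -
  have nz: "u - v \<noteq> 0" "v - u \<noteq> 0" "u - w \<noteq> 0" "v - w \<noteq> 0" "w - v \<noteq> 0" using assms by auto
  have vu: "v - u = - (u - v)" and wv: "w - v = - (v - w)" by simp_all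
  show "hecke_a t u v * hecke_a t v w + hecke_a t u w * hecke_a t v u = hecke_a t v w * hecke_a t u w"
    unfolding hecke_a_def using nz by (simp add: divide_simps) (simp add: algebra_simps)
  show "hecke_a t u v * hecke_a t u w = hecke_a t v w * hecke_a t u v + hecke_a t u w * hecke_a t w v"
    unfolding hecke_a_def using nz by (simp add: divide_simps) (simp add: algebra_simps)
  show "hecke_a t u v * hecke_a t u v * hecke_a t v w + hecke_b t u v * hecke_a t u w * hecke_b t v u
      = hecke_a t v w * hecke_a t v w * hecke_a t u v + hecke_b t v w * hecke_a t u w * hecke_b t w v"
    unfolding hecke_a_def hecke_b_def using nz by (simp add: divide_simps) (simp add: algebra_simps)
qed

section \<open>Affine Hecke relations for the operators \<open>T i\<close>\<close>

locale hecke =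
  fixes n :: nat and t :: "'a::field"
  assumes infinite_field: "infinite (UNIV :: 'a set)" and t_nonzero [simp]: "t \<noteq> 0"
begin

abbreviation "T \<equiv> Top n t"
abbreviation "Ti \<equiv> Tinv n t"

text \<open>Uniqueness holds because x_i - x_{i+1} is nonzero at every generic point, so the
  defining equation determines all values there.\<close>

lemma divdiff_props:
  fixes f :: "'a lpoly"
  assumes f: "laurent n f" and i: "1 \<le> i" "i < n"
  shows "laurent n (divdiff n i f)"
    and "\<And>a. mulx i (divdiff n i f) a - mulx (i + 1) (divdiff n i f) a = sop i f a - f a"
proof -
  let ?P = "\<lambda>g. laurent n g \<and> (\<lambda>a. mulx i g a - mulx (i + 1) g a) = (\<lambda>a. sop i f a - f a)"
  obtain g where g: "?P g" using divdiff_exists[OF f i] by blast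
  have uniq: "g' = g" if g': "?P g'" for g'
  proof (rule laurent_eqI[OF infinite_field, where n = n])
    show "laurent n g'" "laurent n g" using g g' by auto
    fix x :: "nat \<Rightarrow> 'a" assume x: "generic_pt n x"
    have *: "(x (i - 1) - x i) * ev h x = ev (\<lambda>a. sop i f a - f a) x" if h: "?P h" for h
    proof -
      have lh: "laurent n h" using h by blast
      have "ev (\<lambda>a. sop i f a - f a) x = ev (\<lambda>a. mulx i h a - mulx (i + 1) h a) x" using h by simp
      also have "\<dots> = x (i - 1) * ev h x - x i * ev h x"
        using i generic_ptD[OF x] lh ev_mulx[of n h i x] ev_mulx[of n h "i + 1" x]
        by (subst ev_diff[of n]) (auto intro!: laurent_mulx)
      finally show ?thesis by (simp add: algebra_simps)
    qed
    have "x (i - 1) - x i \<noteq> 0" using generic_ptD(2)[OF x, of "i - 1" i] i by auto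
    then show "ev g' x = ev g x" using *[OF g] *[OF g'] by (metis mult_left_cancel)
  qed
  then have "?P (divdiff n i f)" unfolding divdiff_def by (rule theI[of ?P, OF g])
  then show "laurent n (divdiff n i f)"
    "\<And>a. mulx i (divdiff n i f) a - mulx (i + 1) (divdiff n i f) a = sop i f a - f a"
    by (auto simp: fun_eq_iff)
qed

lemma laurent_T:
  assumes "laurent n f" "1 \<le> i" "i < n"
  shows "laurent n (T i f)"
proof -
  let ?g = "divdiff n i f"
  have "laurent n (\<lambda>a. 1 * (t * f a + t * mulx i ?g a) + (- 1) * mulx (i + 1) ?g a)"
    using divdiff_props(1)[OF assms] assms
    by (intro laurent_comb laurent_mulx) auto
  then show ?thesis by (simp add: Top_def Let_def)
qed

lemma laurent_Ti: "laurent n f \<Longrightarrow> 1 \<le> i \<Longrightarrow> i < n \<Longrightarrow> laurent n (Ti i f)"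
  unfolding Tinv_def by (intro laurent_comb laurent_T)

text \<open>Only the two coordinates involved are constrained. This matters for
  \<open>omega\<close>, which moves a generic point to one whose first coordinate q x_n may coincide
  with another.\<close>

lemma ev_T:
  assumes f: "laurent n f" and i: "1 \<le> i" "i < n"
    and x: "x (i - 1) \<noteq> 0" "x i \<noteq> 0" "x (i - 1) \<noteq> x i"
  shows "ev (T i f) x = hecke_a t (x (i - 1)) (x i) * ev f x + hecke_b t (x (i - 1)) (x i) * ev f (swpt i x)"
proof -
  let ?g = "divdiff n i f"
  have g: "laurent n ?g" and eq: "\<And>a. mulx i ?g a - mulx (i + 1) ?g a = sop i f a - f a"
    using divdiff_props[OF f i] by auto
  have m: "ev (mulx i ?g) x = x (i - 1) * ev ?g x" "ev (mulx (i + 1) ?g) x = x i * ev ?g x"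
    using ev_mulx[OF g, of i x] ev_mulx[OF g, of "i + 1" x] i x by auto
  have lm: "laurent n (mulx i ?g)" "laurent n (mulx (i + 1) ?g)" using g i by (auto intro!: laurent_mulx)
  have "ev (\<lambda>a. mulx i ?g a - mulx (i + 1) ?g a) x = ev (\<lambda>a. sop i f a - f a) x" unfolding eq ..
  then have e: "(x (i - 1) - x i) * ev ?g x = ev f (swpt i x) - ev f x"
    unfolding ev_diff[OF lm] m ev_diff[OF laurent_sop[OF f i] f] ev_sop[OF f i]
    by (simp add: algebra_simps)
  have "T i f = (\<lambda>a. 1 * (t * f a + t * mulx i ?g a) + (- 1) * mulx (i + 1) ?g a)"
    by (simp add: Top_def Let_def)
  then have "ev (T i f) x = t * ev f x + (t * x (i - 1) - x i) * ev ?g x"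
    using ev_comb[OF laurent_comb[OF f lm(1), of t t] lm(2), of 1 "-1" x] ev_comb[OF f lm(1), of t t x] m
    by (simp add: algebra_simps)
  also have "ev ?g x = (ev f (swpt i x) - ev f x) / (x (i - 1) - x i)"
    using e x by (simp add: field_simps)
  also have "t * ev f x + (t * x (i - 1) - x i) * ((ev f (swpt i x) - ev f x) / (x (i - 1) - x i))
      = hecke_a t (x (i - 1)) (x i) * ev f x + hecke_b t (x (i - 1)) (x i) * ev f (swpt i x)"
    using x(3) by (simp add: hecke_a_def hecke_b_def divide_simps) (simp add: algebra_simps)
  finally show ?thesis .
qed

lemma ev_T_generic:
  assumes "laurent n f" "1 \<le> i" "i < n" "generic_pt n x"
  shows "ev (T i f) x = hecke_a t (x (i - 1)) (x i) * ev f x + hecke_b t (x (i - 1)) (x i) * ev f (swpt i x)"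
  using assms generic_ptD[OF assms(4)] by (intro ev_T) auto

lemma linop_T: "1 \<le> i \<Longrightarrow> i < n \<Longrightarrow> linop n (T i)"
  unfolding linop_def
proof (intro conjI allI impI)
  assume i: "1 \<le> i" "i < n"
  show "laurent n (T i f)" if "laurent n f" for f using that i by (rule laurent_T)
  fix f g :: "'a lpoly" and c d :: 'a assume fg: "laurent n f" "laurent n g"
  show "T i (\<lambda>a. c * f a + d * g a) = (\<lambda>a. c * T i f a + d * T i g a)"
  proof (rule laurent_eqI[OF infinite_field, where n = n])
    show "laurent n (T i (\<lambda>a. c * f a + d * g a))" "laurent n (\<lambda>a. c * T i f a + d * T i g a)"
      using fg i by (auto intro!: laurent_T laurent_comb)
    fix x :: "nat \<Rightarrow> 'a" assume x: "generic_pt n x"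
    show "ev (T i (\<lambda>a. c * f a + d * g a)) x = ev (\<lambda>a. c * T i f a + d * T i g a) x"
      using fg i x by (simp add: ev_T_generic laurent_comb ev_comb[of n] laurent_T algebra_simps)
  qed
qed

lemma linop_Ti: "1 \<le> i \<Longrightarrow> i < n \<Longrightarrow> linop n (Ti i)"
  using linop_plus[OF linop_scaled[OF linop_id] linop_scaled[OF linop_T], of i "inverse t - 1" "inverse t"]
  by (simp add: Tinv_def[abs_def])

lemma T_quadratic:
  assumes f: "laurent n f" and i: "1 \<le> i" "i < n"
  shows "T i (T i f) = (\<lambda>a. (t - 1) * T i f a + t * f a)"
proof (rule laurent_eqI[OF infinite_field, where n = n])
  show "laurent n (T i (T i f))" "laurent n (\<lambda>a. (t - 1) * T i f a + t * f a)"
    using assms by (auto intro!: laurent_T laurent_comb)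
  fix x :: "nat \<Rightarrow> 'a" assume x: "generic_pt n x"
  define u v where "u = x (i - 1)" and "v = x i"
  have uv: "u \<noteq> v" using generic_ptD(2)[OF x, of "i - 1" i] i by (simp add: u_def v_def)
  have s: "swpt i x (i - 1) = v" "swpt i x i = u" "swpt i (swpt i x) = x"
    using i by (auto simp: swpt_def u_def v_def)
  have "ev (T i (T i f)) x = hecke_a t u v * (hecke_a t u v * ev f x + hecke_b t u v * ev f (swpt i x))
      + hecke_b t u v * (hecke_a t v u * ev f (swpt i x) + hecke_b t v u * ev f x)"
    using x f i by (simp add: ev_T_generic laurent_T generic_pt_swpt s u_def[symmetric] v_def[symmetric])
  moreover have "ev (\<lambda>a. (t - 1) * T i f a + t * f a) x
      = (t - 1) * (hecke_a t u v * ev f x + hecke_b t u v * ev f (swpt i x)) + t * ev f x"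
    using x f i by (simp add: ev_T_generic ev_comb[of n] laurent_T u_def[symmetric] v_def[symmetric])
  moreover have "hecke_a t u v * hecke_a t u v + hecke_b t u v * hecke_b t v u = (t - 1) * hecke_a t u v + t"
    using uv unfolding hecke_a_def hecke_b_def by (simp add: divide_simps) (simp add: algebra_simps)
  moreover have "hecke_a t u v + hecke_a t v u = t - 1"
    using uv unfolding hecke_a_def by (simp add: divide_simps) (simp add: algebra_simps)
  ultimately show "ev (T i (T i f)) x = ev (\<lambda>a. (t - 1) * T i f a + t * f a) x"
    by algebra
qed

lemma T_Ti [simp]:
  assumes "laurent n f" "1 \<le> i" "i < n"
  shows "T i (Ti i f) = f"
proof -
  have "T i (Ti i f) = (\<lambda>a. (inverse t - 1) * T i f a + inverse t * T i (T i f) a)"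
    unfolding Tinv_def using assms by (intro linop_comb[OF linop_T]) (auto intro: laurent_T)
  moreover have "(inverse t - 1) * T i f a + inverse t * T i (T i f) a = f a" for a
    unfolding T_quadratic[OF assms] by (simp add: field_simps)
  ultimately show ?thesis by (simp only:)
qed

lemma Ti_T [simp]:
  assumes "laurent n f" "1 \<le> i" "i < n"
  shows "Ti i (T i f) = f"
proof -
  have "Ti i (T i f) a = f a" for a
    unfolding Tinv_def T_quadratic[OF assms] by (simp add: field_simps)
  then show ?thesis by blast
qed

lemma T_braid:
  assumes f: "laurent n f" and i: "1 \<le> i" "i + 1 < n"
  shows "T i (T (i + 1) (T i f)) = T (i + 1) (T i (T (i + 1) f))"
proof (rule laurent_eqI[OF infinite_field, where n = n])
  obtain k where k: "i = Suc k" using i by (cases i) auto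
  have kn: "Suc (Suc k) < n" using i k by simp
  show "laurent n (T i (T (i + 1) (T i f)))" "laurent n (T (i + 1) (T i (T (i + 1) f)))"
    using f i by (auto intro!: laurent_T)
  fix x :: "nat \<Rightarrow> 'a" assume x: "generic_pt n x"
  define u v w where "u = x k" and "v = x (Suc k)" and "w = x (Suc (Suc k))"
  have ne: "u \<noteq> v" "u \<noteq> w" "v \<noteq> w"
    using generic_ptD(2)[OF x] kn by (auto simp: u_def v_def w_def)
  let ?s = "swpt (Suc k)" and ?r = "swpt (Suc (Suc k))"
  have c: "?s y k = y (Suc k)" "?s y (Suc k) = y k" "?s y (Suc (Suc k)) = y (Suc (Suc k))"
    "?r y k = y k" "?r y (Suc k) = y (Suc (Suc k))" "?r y (Suc (Suc k)) = y (Suc k)"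
    "?s (?s y) = y" "?r (?r y) = y" for y :: "nat \<Rightarrow> 'a"
    by (auto simp: swpt_def)
  have br: "?r (?s (?r x)) = ?s (?r (?s x))"
    by (auto simp: swpt_def fun_eq_iff)
  \<comment> \<open>The six values of \<open>f\<close> on the orbit of the point; \<open>br\<close>
    identifies the two words for the longest element.\<close>
  define p0 p1 p2 p12 p21 p121 where "p0 = ev f x" and "p1 = ev f (?s x)" and "p2 = ev f (?r x)"
    and "p12 = ev f (?s (?r x))" and "p21 = ev f (?r (?s x))" and "p121 = ev f (?s (?r (?s x)))"
  note ps = p0_def[symmetric] p1_def[symmetric] p2_def[symmetric] p12_def[symmetric]
    p21_def[symmetric] p121_def[symmetric] u_def[symmetric] v_def[symmetric] w_def[symmetric]
  let ?a = "hecke_a t" and ?b = "hecke_b t"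
  have L: "ev (T (Suc k) (T (Suc (Suc k)) (T (Suc k) f))) x
    = ?a u v * (?a v w * (?a u v * p0 + ?b u v * p1) + ?b v w * (?a u w * p2 + ?b u w * p12))
    + ?b u v * (?a u w * (?a v u * p1 + ?b v u * p0) + ?b u w * (?a v w * p21 + ?b v w * p121))"
    using x f kn by (simp add: ev_T_generic laurent_T generic_pt_swpt c ps)
  have R: "ev (T (Suc (Suc k)) (T (Suc k) (T (Suc (Suc k)) f))) x
    = ?a v w * (?a u v * (?a v w * p0 + ?b v w * p2) + ?b u v * (?a u w * p1 + ?b u w * p21))
    + ?b v w * (?a u w * (?a w v * p2 + ?b w v * p0) + ?b u w * (?a u v * p12 + ?b u v * p121))"
    using x f kn by (simp add: ev_T_generic laurent_T generic_pt_swpt c ps br)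
  have "ev (T (Suc k) (T (Suc (Suc k)) (T (Suc k) f))) x = ev (T (Suc (Suc k)) (T (Suc k) (T (Suc (Suc k)) f))) x"
    unfolding L R using hecke_ab_braid[OF ne, of t] by algebra
  then show "ev (T i (T (i + 1) (T i f))) x = ev (T (i + 1) (T i (T (i + 1) f))) x"
    by (simp add: k flip: Suc_eq_plus1)
qed

lemma T_commute:
  assumes f: "laurent n f" and i: "1 \<le> i" "i + 1 < j" "j < n"
  shows "T i (T j f) = T j (T i f)"
proof (rule laurent_eqI[OF infinite_field, where n = n])
  show "laurent n (T i (T j f))" "laurent n (T j (T i f))"
    using f i by (auto intro!: laurent_T)
  fix x :: "nat \<Rightarrow> 'a" assume x: "generic_pt n x"
  have ne: "i - 1 \<noteq> j - 1" "i - 1 \<noteq> j" "i \<noteq> j - 1" "i \<noteq> j" using i by auto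
  have c: "swpt i x (j - 1) = x (j - 1)" "swpt i x j = x j" "swpt j x (i - 1) = x (i - 1)" "swpt j x i = x i"
    using ne by (simp_all add: swpt_def)
  have s: "swpt i (swpt j x) = swpt j (swpt i x)"
    unfolding swpt_def using ne by (intro ext) (simp add: fun_upd_def)
  show "ev (T i (T j f)) x = ev (T j (T i f)) x"
    using x f i by (simp add: ev_T_generic laurent_T generic_pt_swpt c s algebra_simps)
qed

text \<open>The cross relation of the affine Hecke algebra. Later identities mixing variables and
  generators come from it or from plain commutation.\<close>

lemma T_mulx:
  assumes f: "laurent n f" and i: "1 \<le> i" "i < n"
  shows "T i (mulx i f) = (\<lambda>a. t * mulx (i + 1) (Ti i f) a)"
proof (rule laurent_eqI[OF infinite_field, where n = n])
  show "laurent n (T i (mulx i f))" "laurent n (\<lambda>a. t * mulx (i + 1) (Ti i f) a)"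
    using f i by (auto intro!: laurent_T laurent_mulx laurent_scale laurent_Ti)
  fix x :: "nat \<Rightarrow> 'a" assume x: "generic_pt n x"
  define u v where "u = x (i - 1)" and "v = x i"
  have uv: "u \<noteq> v" using generic_ptD(2)[OF x, of "i - 1" i] i by (simp add: u_def v_def)
  have nz: "u \<noteq> 0" "v \<noteq> 0" using generic_ptD(1)[OF x] i by (auto simp: u_def v_def)
  have s: "swpt i x (i - 1) = v" using i by (auto simp: swpt_def u_def v_def)
  have m: "ev (mulx i f) x = u * ev f x" "ev (mulx i f) (swpt i x) = v * ev f (swpt i x)"
    using ev_mulx[OF f, of i x] ev_mulx[OF f, of i "swpt i x"] i nz s by (auto simp: u_def)
  have m2: "ev (mulx (i + 1) (Ti i f)) x = v * ev (Ti i f) x"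
    using ev_mulx[OF laurent_Ti[OF f i], of "i + 1" x] i nz by (auto simp: v_def)
  have "ev (T i (mulx i f)) x = hecke_a t u v * (u * ev f x) + hecke_b t u v * (v * ev f (swpt i x))"
    using x f i by (simp add: ev_T_generic laurent_mulx m u_def[symmetric] v_def[symmetric])
  moreover have "ev (\<lambda>a. t * mulx (i + 1) (Ti i f) a) x = t * (v * ev (Ti i f) x)"
    using m2 ev_scale[OF laurent_mulx[OF laurent_Ti[OF f i], of "i + 1"], of t x] i by simp
  moreover have "ev (Ti i f) x = (inverse t - 1) * ev f x
      + inverse t * (hecke_a t u v * ev f x + hecke_b t u v * ev f (swpt i x))"
    unfolding Tinv_def using x f i
    by (simp add: ev_comb[of n] laurent_T ev_T_generic u_def[symmetric] v_def[symmetric])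
  moreover have "hecke_a t u v * u = v * (1 - t + hecke_a t u v)"
    using uv by (simp add: hecke_a_def divide_simps) (simp add: algebra_simps)
  moreover have "t * inverse t = 1" by simp
  ultimately show "ev (T i (mulx i f)) x = ev (\<lambda>a. t * mulx (i + 1) (Ti i f) a) x"
    by algebra
qed

lemma T_mulx_commute:
  assumes f: "laurent n f" and i: "1 \<le> i" "i < n" and j: "1 \<le> j" "j \<le> n" "j \<noteq> i" "j \<noteq> i + 1"
  shows "T i (mulx j f) = mulx j (T i f)"
proof (rule laurent_eqI[OF infinite_field, where n = n])
  show "laurent n (T i (mulx j f))" "laurent n (mulx j (T i f))"
    using f i j by (auto intro!: laurent_T laurent_mulx)
  fix x :: "nat \<Rightarrow> 'a" assume x: "generic_pt n x"
  have s: "swpt i x (j - 1) = x (j - 1)" using i j by (auto simp: swpt_def)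
  have nz: "x (j - 1) \<noteq> 0" "swpt i x (j - 1) \<noteq> 0" unfolding s using generic_ptD(1)[OF x] j by auto
  show "ev (T i (mulx j f)) x = ev (mulx j (T i f)) x"
    using x f i j nz
    by (simp add: ev_T_generic laurent_T laurent_mulx ev_mulx[of n] generic_pt_swpt s algebra_simps)
qed

end

section \<open>Coefficients of \<open>T i f\<close> and mixed relations\<close>

context hecke
begin

text \<open>Along the exponents with fixed sum at the two positions, the divided difference is a
  telescoping sum of coefficients of s_i f - f. It vanishes far out, and \<open>spread\<close> keeps
  it zero until the pair itself is reached from the outside. This turns the implicit definition of
  T_i into a two-term formula on leading exponents.\<close>

lemma T_coeff:
  assumes f: "laurent n f" and i: "1 \<le> i" "i < n" and a: "length a = n"
    and spread: "\<And>x y. x + y = a ! (i - 1) + a ! i \<Longrightarrow> max x y > max (a ! (i - 1)) (a ! i) \<Longrightarrow>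
      f (a[i - 1 := x, i := y]) = 0"
  shows "T i f a = (if a ! (i - 1) < a ! i then f (swp i a) + (t - 1) * f a else t * f (swp i a))"
proof -
  obtain k where k: "i = Suc k" using i by (cases i) auto
  have kn: "k < n" "Suc k < n" using i k by auto
  define pt where "pt x y = a[k := x, Suc k := y]" for x y
  define u v where "u = a ! k" and "v = a ! Suc k"
  let ?g = "divdiff n i f"
  have g: "laurent n ?g" and geq: "\<And>a. mulx i ?g a - mulx (i + 1) ?g a = sop i f a - f a"
    using divdiff_props[OF f i] by auto
  have sh: "(pt x y)[k := x'] = pt x' y" "(pt x y)[Suc k := y'] = pt x y'" "swp i (pt x y) = pt y x"
    "pt x y ! k = x" "pt x y ! Suc k = y" "length (pt x y) = n" for x y x' y'
    using kn a by (auto simp: pt_def swp_def k list_update_swap[of k "Suc k"])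
  have step: "?g (pt (x - 1) y) - ?g (pt x (y - 1)) = f (pt y x) - f (pt x y)" for x y
    using geq[of "pt x y"] by (simp add: mulx_def sop_def k sh sh(3)[unfolded k] flip: Suc_eq_plus1)
  \<comment> \<open>Finite support: along any such line of exponents some coefficient of the divided
    difference is zero, and this is where the telescoping starts.\<close>
  have vanish: "\<exists>j::nat. ?g (pt (x + s * int j) (y - s * int j)) = 0" if "s \<noteq> 0" for x y s :: int
  proof (rule ccontr)
    assume "\<nexists>j::nat. ?g (pt (x + s * int j) (y - s * int j)) = 0"
    then have "range (\<lambda>j::nat. pt (x + s * int j) (y - s * int j)) \<subseteq> {a. ?g a \<noteq> 0}" by auto
    then have "finite (range (\<lambda>j::nat. pt (x + s * int j) (y - s * int j)))"
      using laurent_finite[OF g] finite_subset by blast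
    moreover have "inj (\<lambda>j::nat. pt (x + s * int j) (y - s * int j))"
    proof (rule injI)
      fix j l assume "pt (x + s * int j) (y - s * int j) = pt (x + s * int l) (y - s * int l)"
      then have "x + s * int j = x + s * int l" using sh(4) by metis
      then show "j = l" using that by simp
    qed
    ultimately show False using finite_imageD infinite_UNIV_nat by blast
  qed
  have up: "?g (pt (x - 1) y) = 0"
    if *: "\<And>j::nat. f (pt (y - int j) (x + int j)) = f (pt (x + int j) (y - int j))" for x y
  proof -
    have "?g (pt (x - 1) y) = ?g (pt (x - 1 + int j) (y - int j))" for j
    proof (induction j)
      case (Suc j)
      then show ?case using step[of "x + int j" "y - int j"] *[of j] by (simp add: algebra_simps)
    qed simp
    moreover obtain j :: nat where "?g (pt (x - 1 + 1 * int j) (y - 1 * int j)) = 0"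
      using vanish[of 1 "x - 1" y] by auto
    ultimately show ?thesis by simp
  qed
  have down: "?g (pt x (y - 1)) = 0"
    if *: "\<And>j::nat. f (pt (y + int j) (x - int j)) = f (pt (x - int j) (y + int j))" for x y
  proof -
    have "?g (pt x (y - 1)) = ?g (pt (x - int j) (y - 1 + int j))" for j
    proof (induction j)
      case (Suc j)
      then show ?case using step[of "x - int j" "y + int j"] *[of j] by (simp add: algebra_simps)
    qed simp
    moreover obtain j :: nat where "?g (pt (x + (-1) * int j) (y - 1 - (-1) * int j)) = 0"
      using vanish[of "-1" x "y - 1"] by auto
    ultimately show ?thesis by simp
  qed
  have f0: "f (pt x y) = 0" if "x + y = u + v" "max x y > max u v" for x y
    using spread[of x y] that by (simp add: pt_def k u_def v_def)
  have apt: "a = pt u v" and swa: "swp i a = pt v u"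
    using sh(3)[of u v] by (simp_all add: pt_def u_def v_def)
  have Ta: "T i f a = t * f (pt u v) + t * ?g (pt (u - 1) v) - ?g (pt u (v - 1))"
    unfolding apt by (simp add: Top_def Let_def mulx_def k sh flip: Suc_eq_plus1)
  show ?thesis
  proof (cases "u < v")
    case True
    \<comment> \<open>Written as \<open>v + 1 - 1\<close> to match \<open>down\<close> at the pair
      (u - 1, v + 1), the first one spread outwards.\<close>
    have "?g (pt (u - 1) (v + 1 - 1)) = 0"
      by (rule down) (use True in \<open>simp add: f0\<close>)
    then have "?g (pt (u - 1) v) = 0" by simp
    then show ?thesis using Ta step[of u v] True unfolding swa apt[symmetric]
      by (simp add: k u_def[symmetric] v_def[symmetric] apt[symmetric] algebra_simps)
  next
    case False
    have "?g (pt (u + 1 - 1) (v - 1)) = 0"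
      by (rule up) (use False in \<open>simp add: f0\<close>)
    then have g0: "?g (pt u (v - 1)) = 0" by simp
    then have g1: "?g (pt (u - 1) v) = f (pt v u) - f (pt u v)" using step[of u v] by simp
    have "T i f a = t * f (pt v u)" unfolding Ta g0 g1 by (simp add: algebra_simps)
    then show ?thesis using False unfolding swa by (simp add: k u_def v_def)
  qed
qed

lemma Ti_coeff:
  assumes f: "laurent n f" and i: "1 \<le> i" "i < n" and a: "length a = n"
    and spread: "\<And>x y. x + y = a ! (i - 1) + a ! i \<Longrightarrow> max x y > max (a ! (i - 1)) (a ! i) \<Longrightarrow>
      f (a[i - 1 := x, i := y]) = 0"
  shows "Ti i f a = (if a ! (i - 1) > a ! i then f (swp i a) + (inverse t - 1) * f a
     else inverse t * f (swp i a))"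
proof (cases "a ! (i - 1)" "a ! i" rule: linorder_cases)
  case equal
  then have "swp i a = a" using i a by (metis list_update_id swp_def)
  then show ?thesis using T_coeff[OF assms] equal unfolding Tinv_def by (simp add: field_simps)
qed (use T_coeff[OF assms] in \<open>simp_all add: Tinv_def field_simps\<close>)

lemma Ti_commute:
  assumes f: "laurent n f" and i: "1 \<le> i" "i + 1 < j" "j < n"
  shows "T i (Ti j f) = Ti j (T i f)" "T j (Ti i f) = Ti i (T j f)"
proof -
  have l: "laurent n (T j f)" "laurent n (T i f)" using f i by (auto intro: laurent_T)
  show "T i (Ti j f) = Ti j (T i f)"
    unfolding Tinv_def using f i l
    by (subst linop_comb[OF linop_T]) (auto simp: T_commute[OF assms])
  show "T j (Ti i f) = Ti i (T j f)"
    unfolding Tinv_def using f i l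
    by (subst linop_comb[OF linop_T]) (auto simp: T_commute[OF assms])
qed

text \<open>The braid relation with two of its generators moved to the other side as inverses; these
  forms let a single generator pass a chain of inverses.\<close>

lemma T_Ti_braid:
  assumes f: "laurent n f" and i: "1 \<le> i" "i + 1 < n"
  shows "T i (Ti (i + 1) (Ti i f)) = Ti (i + 1) (Ti i (T (i + 1) f))"
    and "T (i + 1) (Ti i (Ti (i + 1) f)) = Ti i (Ti (i + 1) (T i f))"
proof -
  note [intro] = laurent_T laurent_Ti
  have i': "i < n" "1 \<le> i + 1" using i by auto
  define g where "g = Ti (i + 1) (Ti i f)"
  have lg: "laurent n g" unfolding g_def using f i i' by blast
  have "T i g = Ti (i + 1) (Ti i (T i (T (i + 1) (T i g))))"
    using lg i i' by (simp add: laurent_T)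
  also have "T i (T (i + 1) (T i g)) = T (i + 1) (T i (T (i + 1) g))"
    using T_braid[OF lg i] .
  also have "T i (T (i + 1) g) = f" unfolding g_def using f i i' by (simp add: laurent_Ti)
  finally show "T i (Ti (i + 1) (Ti i f)) = Ti (i + 1) (Ti i (T (i + 1) f))" unfolding g_def .
  define h where "h = Ti i (Ti (i + 1) f)"
  have lh: "laurent n h" unfolding h_def using f i i' by blast
  have "T (i + 1) h = Ti i (Ti (i + 1) (T (i + 1) (T i (T (i + 1) h))))"
    using lh i i' by (simp add: laurent_T)
  also have "T (i + 1) (T i (T (i + 1) h)) = T i (T (i + 1) (T i h))"
    using T_braid[OF lh i] by simp
  also have "T (i + 1) (T i h) = f" unfolding h_def using f i i' by (simp add: laurent_Ti)
  finally show "T (i + 1) (Ti i (Ti (i + 1) f)) = Ti i (Ti (i + 1) (T i f))" unfolding h_def .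
qed

lemma Ti_mulx_Ti:
  assumes f: "laurent n f" and i: "1 \<le> i" "i < n"
  shows "Ti i (mulx (i + 1) (Ti i f)) = (\<lambda>a. inverse t * mulx i f a)"
proof -
  have lm: "laurent n (mulx i f)" "laurent n (mulx (i + 1) (Ti i f))"
    using f i by (auto intro!: laurent_mulx laurent_Ti)
  have "mulx (i + 1) (Ti i f) = (\<lambda>a. inverse t * T i (mulx i f) a)"
    unfolding T_mulx[OF assms] by (simp add: fun_eq_iff)
  then have "Ti i (mulx (i + 1) (Ti i f)) = (\<lambda>a. inverse t * Ti i (T i (mulx i f)) a)"
    using linop_scale[OF linop_Ti[OF i] laurent_T[OF lm(1) i]] by simp
  then show ?thesis using lm i by simp
qed

lemma mulxinv_mulx [simp]: "laurent n f \<Longrightarrow> 1 \<le> i \<Longrightarrow> i \<le> n \<Longrightarrow> mulxinv i (mulx i f) = f"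
  by (auto simp: mulxinv_def mulx_def fun_eq_iff laurent_length) (metis add_diff_cancel_right' diff_add_cancel length_list_update list_update_beyond list_update_id list_update_overwrite not_le_imp_less nth_list_update_eq)

lemma mulx_mulxinv [simp]: "laurent n f \<Longrightarrow> 1 \<le> i \<Longrightarrow> i \<le> n \<Longrightarrow> mulx i (mulxinv i f) = f"
  by (auto simp: mulxinv_def mulx_def fun_eq_iff laurent_length) (metis add_diff_cancel_right' diff_add_cancel length_list_update list_update_beyond list_update_id list_update_overwrite not_le_imp_less nth_list_update_eq)

lemma T_mulxinv_T:
  assumes f: "laurent n f" and i: "1 \<le> i" "i < n"
  shows "T i (mulxinv (i + 1) (T i f)) = (\<lambda>a. t * mulxinv i f a)"
proof -
  have l: "laurent n (mulxinv i f)" using f i by (auto intro: laurent_mulxinv)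
  have "T i f = T i (mulx i (mulxinv i f))" using f i by simp
  also have "\<dots> = (\<lambda>a. t * mulx (i + 1) (Ti i (mulxinv i f)) a)" by (rule T_mulx[OF l i])
  finally have "mulxinv (i + 1) (T i f) = (\<lambda>a. t * mulxinv (i + 1) (mulx (i + 1) (Ti i (mulxinv i f))) a)"
    by (simp add: mulxinv_def)
  also have "\<dots> = (\<lambda>a. t * Ti i (mulxinv i f) a)" using l i by (simp add: laurent_Ti)
  finally show ?thesis using linop_scale[OF linop_T[OF i] laurent_Ti[OF l i], of t] l i by simp
qed

section \<open>Moving a generator through a chain\<close>

lemma comp_ops_commute:
  assumes "\<And>k g. k \<in> set ks \<Longrightarrow> laurent n g \<Longrightarrow> A (B k g) = B k (A g)"
    and "\<And>k g. k \<in> set ks \<Longrightarrow> laurent n g \<Longrightarrow> laurent n (B k g)" and "laurent n f"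
  shows "A (comp_ops (map B ks) f) = comp_ops (map B ks) (A f) \<and> laurent n (comp_ops (map B ks) f)"
  using assms(1,2) by (induction ks) (use assms(3) in auto)

lemma laurent_Ts: "laurent n f \<Longrightarrow> set ks \<subseteq> {1..<n} \<Longrightarrow> laurent n (comp_ops (map T ks) f)"
  by (induction ks) (auto intro: laurent_T)

lemma laurent_Tis: "laurent n f \<Longrightarrow> set ks \<subseteq> {1..<n} \<Longrightarrow> laurent n (comp_ops (map Ti ks) f)"
  by (induction ks) (auto intro: laurent_Ti)

lemma linop_Ts: "set ks \<subseteq> {1..<n} \<Longrightarrow> linop n (comp_ops (map T ks))"
  by (rule linop_comp_ops) (auto intro!: linop_T)

lemma linop_Tis: "set ks \<subseteq> {1..<n} \<Longrightarrow> linop n (comp_ops (map Ti ks))"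
  by (rule linop_comp_ops) (auto intro!: linop_Ti)

lemma T_Ts_commute:
  assumes "laurent n f" "set ks \<subseteq> {1..<n}" "1 \<le> i" "i < n" "\<And>k. k \<in> set ks \<Longrightarrow> k + 1 < i \<or> i + 1 < k"
  shows "T i (comp_ops (map T ks) f) = comp_ops (map T ks) (T i f)"
  by (rule comp_ops_commute[THEN conjunct1]) (use assms T_commute[of _ i] T_commute[of _ _ i] in \<open>fastforce intro: laurent_T\<close>)+

lemma T_Tis_commute:
  assumes "laurent n f" "set ks \<subseteq> {1..<n}" "1 \<le> i" "i < n" "\<And>k. k \<in> set ks \<Longrightarrow> k + 1 < i \<or> i + 1 < k"
  shows "T i (comp_ops (map Ti ks) f) = comp_ops (map Ti ks) (T i f)"
  by (rule comp_ops_commute[THEN conjunct1]) (use assms Ti_commute(1)[of _ i] Ti_commute(2)[of _ _ i] in \<open>fastforce intro: laurent_Ti\<close>)+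

lemma Tis_Ts:
  assumes "laurent n f" "set ks \<subseteq> {1..<n}"
  shows "comp_ops (map Ti (rev ks)) (comp_ops (map T ks) f) = f"
    and "comp_ops (map T ks) (comp_ops (map Ti (rev ks)) f) = f"
proof -
  show "comp_ops (map Ti (rev ks)) (comp_ops (map T ks) f) = f"
    using assms by (induction ks) (auto simp: laurent_Ts)
  show "comp_ops (map T ks) (comp_ops (map Ti (rev ks)) f) = f"
    using assms by (induction ks arbitrary: f) (auto simp: laurent_Tis laurent_Ti)
qed

lemma upt_split2:
  assumes "j \<le> i" "i + 1 < m"
  shows "[j..<m] = [j..<i] @ [i, i + 1] @ [i + 2..<m]"
proof -
  have "[j..<m] = [j..<i] @ [i..<m]" using assms upt_add_eq_append[of j i "m - i"] by simp
  moreover have "[i..<m] = [i, i + 1] @ [i + 2..<m]" using assms by (simp add: upt_conv_Cons)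
  ultimately show ?thesis by simp
qed

text \<open>T_{i+1} passes the generators below i, turns into T_i by the braid relation at the pair
  T_i T_{i+1}, and passes the rest. The two variants for chains of inverses follow the same
  pattern.\<close>

lemma T_chain_up:
  assumes f: "laurent n f" and i: "1 \<le> j" "j \<le> i" "i + 1 < n"
  shows "T (i + 1) (comp_ops (map T [j..<n]) f) = comp_ops (map T [j..<n]) (T i f)"
proof -
  let ?A = "comp_ops (map T [j..<i])" and ?B = "comp_ops (map T [i + 2..<n])"
  have e: "comp_ops (map T [j..<n]) g = ?A (T i (T (i + 1) (?B g)))" for g
    using i by (simp add: upt_split2)
  have lB: "laurent n (?B g)" if "laurent n g" for g using that i by (intro laurent_Ts) auto
  have "T (i + 1) (?A (T i (T (i + 1) (?B f)))) = ?A (T (i + 1) (T i (T (i + 1) (?B f))))"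
    by (rule T_Ts_commute) (use i lB[OF f] in \<open>auto intro!: laurent_T\<close>)
  also have "\<dots> = ?A (T i (T (i + 1) (T i (?B f))))" using T_braid[OF lB[OF f]] i by simp
  also have "T i (?B f) = ?B (T i f)" by (rule T_Ts_commute) (use i f in auto)
  finally show ?thesis unfolding e .
qed

lemma Ti_chain_up:
  assumes f: "laurent n f" and i: "1 \<le> i" "i + 1 < j" "j \<le> n"
  shows "T (i + 1) (comp_ops (map Ti [1..<j]) f) = comp_ops (map Ti [1..<j]) (T i f)"
proof -
  let ?A = "comp_ops (map Ti [1..<i])" and ?B = "comp_ops (map Ti [i + 2..<j])"
  have e: "comp_ops (map Ti [1..<j]) g = ?A (Ti i (Ti (i + 1) (?B g)))" for g
    using i by (simp add: upt_split2)
  have lB: "laurent n (?B g)" if "laurent n g" for g using that i by (intro laurent_Tis) auto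
  have "T (i + 1) (?A (Ti i (Ti (i + 1) (?B f)))) = ?A (T (i + 1) (Ti i (Ti (i + 1) (?B f))))"
    by (rule T_Tis_commute) (use i lB[OF f] in \<open>auto intro!: laurent_Ti\<close>)
  also have "\<dots> = ?A (Ti i (Ti (i + 1) (T i (?B f))))" using T_Ti_braid(2)[OF lB[OF f], of i] i by simp
  also have "T i (?B f) = ?B (T i f)" by (rule T_Tis_commute) (use i f in auto)
  finally show ?thesis unfolding e .
qed

lemma Ti_chain_down:
  assumes f: "laurent n f" and i: "1 \<le> i" "i + 1 < n"
  shows "T i (comp_ops (map Ti (rev [1..<n])) f) = comp_ops (map Ti (rev [1..<n])) (T (i + 1) f)"
proof -
  let ?A = "comp_ops (map Ti (rev [1..<i]))" and ?B = "comp_ops (map Ti (rev [i + 2..<n]))"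
  have e: "comp_ops (map Ti (rev [1..<n])) g = ?B (Ti (i + 1) (Ti i (?A g)))" for g
    using i by (simp add: upt_split2)
  have lA: "laurent n (?A g)" if "laurent n g" for g using that i by (intro laurent_Tis) auto
  have "T i (?B (Ti (i + 1) (Ti i (?A f)))) = ?B (T i (Ti (i + 1) (Ti i (?A f))))"
    by (rule T_Tis_commute) (use i lA[OF f] in \<open>auto intro!: laurent_Ti\<close>)
  also have "\<dots> = ?B (Ti (i + 1) (Ti i (T (i + 1) (?A f))))" using T_Ti_braid(1)[OF lA[OF f], of i] i by simp
  also have "T (i + 1) (?A f) = ?A (T (i + 1) f)" by (rule T_Tis_commute) (use i f in auto)
  finally show ?thesis unfolding e .
qed

section \<open>The raising operator against the generators\<close>

abbreviation "Phi \<equiv> Phiop n t"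

lemma linop_Phi: "1 \<le> n \<Longrightarrow> linop n Phi"
proof -
  assume "1 \<le> n"
  then have "linop n (\<lambda>f. mulx n (comp_ops (map Ti (rev [1..<n])) f))"
    by (intro linop_comp[of n "mulx n" "comp_ops (map Ti (rev [1..<n]))"] linop_mulx linop_Tis) auto
  then show ?thesis by (simp add: Phiop_def[abs_def])
qed

lemma T_Phi:
  assumes f: "laurent n f" and i: "1 \<le> i" "i + 1 < n"
  shows "T i (Phi f) = Phi (T (i + 1) f)"
proof -
  have "T i (mulx n (comp_ops (map Ti (rev [1..<n])) f)) = mulx n (T i (comp_ops (map Ti (rev [1..<n])) f))"
    by (rule T_mulx_commute) (use i f in \<open>auto intro!: laurent_Tis\<close>)
  then show ?thesis unfolding Phiop_def Ti_chain_down[OF assms] .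
qed

text \<open>The cross relation collapses the product from the inside: T_m^{-1} x_{m+1} T_m^{-1} =
  t^{-1} x_m, one factor t^{-1} for each layer.\<close>

lemma Ti_mulx_chain:
  assumes f: "laurent n f" and m: "1 \<le> m" "m \<le> n"
  shows "comp_ops (map Ti [1..<m]) (mulx m (comp_ops (map Ti (rev [1..<m])) f))
    = (\<lambda>a. inverse t ^ (m - 1) * mulx 1 f a)"
  using m
proof (induction m rule: nat_induct_at_least)
  case base
  show ?case by simp
next
  case (Suc m)
  let ?L = "comp_ops (map Ti (rev [1..<m])) f"
  have lL: "laurent n ?L" using f Suc by (intro laurent_Tis) auto
  have up: "[1..<Suc m] = [1..<m] @ [m]" using Suc.hyps by simp
  have "comp_ops (map Ti [1..<Suc m]) (mulx (Suc m) (comp_ops (map Ti (rev [1..<Suc m])) f))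
    = comp_ops (map Ti [1..<m]) (Ti m (mulx (m + 1) (Ti m ?L)))"
    unfolding up by (simp flip: Suc_eq_plus1)
  also have "Ti m (mulx (m + 1) (Ti m ?L)) = (\<lambda>a. inverse t * mulx m ?L a)"
    using Ti_mulx_Ti[OF lL, of m] Suc by simp
  also have "comp_ops (map Ti [1..<m]) (\<lambda>a. inverse t * mulx m ?L a)
    = (\<lambda>a. inverse t * comp_ops (map Ti [1..<m]) (mulx m ?L) a)"
    by (rule linop_scale[OF linop_Tis]) (use Suc lL in \<open>auto intro!: laurent_mulx\<close>)
  also have "\<dots> = (\<lambda>a. inverse t ^ (Suc m - 1) * mulx 1 f a)"
  proof -
    obtain k where "m = Suc k" using Suc.hyps by (cases m) auto
    then show ?thesis using Suc by (simp add: mult.assoc)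
  qed
  finally show ?case .
qed

end

section \<open>Cherednik operators\<close>

text \<open>Multiplicative independence of \<open>q\<close> and \<open>t\<close> is the form in
  which genericity is used. It passes to the inverse parameters and makes the powers of
  \<open>q\<close> distinct, which gives an infinite field.\<close>

locale macdonald =
  fixes n :: nat and q t :: "'a::field"
  assumes n_pos: "1 \<le> n" and q_nonzero [simp]: "q \<noteq> 0" and t_nz: "t \<noteq> 0"
    and independent: "\<And>a b :: int. q powi a * t powi b = 1 \<Longrightarrow> a = 0 \<and> b = 0"
begin

sublocale hecke n t
proof
  have "inj (\<lambda>m::nat. q ^ m)"
  proof (rule injI)
    fix m l :: nat assume "q ^ m = q ^ l"
    then have "q powi (int m - int l) * t powi 0 = 1" by (simp add: power_int_diff)
    then show "m = l" using independent by fastforce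
  qed
  then show "infinite (UNIV :: 'a set)"
    using finite_imageD[of "\<lambda>m::nat. q ^ m" UNIV] finite_subset[of "range (\<lambda>m::nat. q ^ m)" UNIV] by auto
qed (rule t_nz)

abbreviation "om \<equiv> omega n q"
abbreviation "Y \<equiv> Yop n q t"

lemma linop_omega: "linop n om"
  unfolding omega_def using n_pos
  by (intro linop_comp_ops) (auto intro!: linop_sop linop_tauop)

lemma laurent_omega: "laurent n f \<Longrightarrow> laurent n (om f)"
  using linop_laurent[OF linop_omega] .

text \<open>The point on the right is (q x_n, x_1, ..., x_{n-1}), so \<open>omega\<close> is a
  cyclic shift twisted by \<open>q\<close>.\<close>

lemma ev_omega:
  assumes f: "laurent n f"
  shows "ev (om f) x = ev f (\<lambda>k. if k = 0 then q * x (n - 1) else if k < n then x (k - 1) else x k)"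
proof -
  have "laurent n (comp_ops (map sop (rev [1..<m])) g) \<and> ev (comp_ops (map sop (rev [1..<m])) g) x
      = ev g (\<lambda>k. if k = 0 then x (m - 1) else if k < m then x (k - 1) else x k)"
    if "laurent n g" "1 \<le> m" "m \<le> n" for g :: "'a lpoly" and m and x :: "nat \<Rightarrow> 'a"
    using that(2,3)
  proof (induction m arbitrary: x rule: nat_induct_at_least)
    case base
    have "x = (\<lambda>k. if k = 0 then x (1 - 1) else if k < 1 then x (k - 1) else x k)" by auto
    then show ?case using that by simp
  next
    case (Suc m)
    let ?h = "comp_ops (map sop (rev [1..<m])) g"
    have e: "comp_ops (map sop (rev [1..<Suc m])) g = sop m ?h" using Suc.hyps by simp
    have lh: "laurent n ?h" using Suc by simp
    have "ev (sop m ?h) x = ev ?h (swpt m x)" by (rule ev_sop[OF lh]) (use Suc in auto)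
    also have "\<dots> = ev g (\<lambda>k. if k = 0 then swpt m x (m - 1) else if k < m then swpt m x (k - 1) else swpt m x k)"
      using Suc by simp
    also have "(\<lambda>k. if k = 0 then swpt m x (m - 1) else if k < m then swpt m x (k - 1) else swpt m x k)
        = (\<lambda>k. if k = 0 then x (Suc m - 1) else if k < Suc m then x (k - 1) else x k)"
      using Suc.hyps by (intro ext) (auto simp: swpt_def less_Suc_eq)
    finally show ?case unfolding e using laurent_sop[OF lh, of m] Suc by simp
  qed
  note * = this
  have "ev (om f) x = ev (comp_ops (map sop (rev [1..<n])) (tauop q 1 f)) x"
    by (simp add: omega_def)
  also have "\<dots> = ev (tauop q 1 f) (\<lambda>k. if k = 0 then x (n - 1) else if k < n then x (k - 1) else x k)"
    using *[OF laurent_tauop[OF f] n_pos order_refl] by blast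
  also have "\<dots> = ev f (\<lambda>k. if k = 0 then q * x (n - 1) else if k < n then x (k - 1) else x k)"
    by (subst ev_tauop[OF f]) (use n_pos in \<open>auto intro!: arg_cong[where f = "ev f"]\<close>)
  finally show ?thesis .
qed

lemma omega_T:
  assumes f: "laurent n f" and i: "1 \<le> i" "i + 1 < n"
  shows "om (T (i + 1) f) = T i (om f)"
proof (rule laurent_eqI[OF infinite_field, where n = n])
  show "laurent n (om (T (i + 1) f))" "laurent n (T i (om f))"
    using f i by (auto intro!: laurent_omega laurent_T)
  fix x :: "nat \<Rightarrow> 'a" assume x: "generic_pt n x"
  obtain k where k: "i = Suc k" using i by (cases i) auto
  let ?r = "\<lambda>x k. if k = 0 then q * x (n - 1) else if k < n then x (k - 1) else x k"
  have c: "?r x (i + 1 - 1) = x (i - 1)" "?r x (i + 1) = x i" using i by auto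
  have s: "swpt (i + 1) (?r x) = ?r (swpt i x)"
    using i by (intro ext) (auto simp: swpt_def k split: if_splits)
  have nz: "x (i - 1) \<noteq> 0" "x i \<noteq> 0" "x (i - 1) \<noteq> x i"
    using generic_ptD[OF x] i by auto
  have "ev (om (T (i + 1) f)) x = ev (T (i + 1) f) (?r x)"
    using f i by (intro ev_omega laurent_T) auto
  \<comment> \<open>The shifted point may fail to be generic, so \<open>ev_T\<close> is applied to
    the two coordinates in question.\<close>
  also have "\<dots> = hecke_a t (?r x (i + 1 - 1)) (?r x (i + 1)) * ev f (?r x)
      + hecke_b t (?r x (i + 1 - 1)) (?r x (i + 1)) * ev f (swpt (i + 1) (?r x))"
    by (rule ev_T[OF f]) (use i nz in \<open>auto simp: c\<close>)
  also have "\<dots> = hecke_a t (x (i - 1)) (x i) * ev (om f) x + hecke_b t (x (i - 1)) (x i) * ev (om f) (swpt i x)"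
    unfolding c s ev_omega[OF f] ..
  also have "\<dots> = ev (T i (om f)) x"
    by (rule ev_T[symmetric]) (use f i nz in \<open>auto intro!: laurent_omega\<close>)
  finally show "ev (om (T (i + 1) f)) x = ev (T i (om f)) x" .
qed

lemma omega_Ti:
  assumes f: "laurent n f" and i: "1 \<le> i" "i + 1 < n"
  shows "om (Ti (i + 1) f) = Ti i (om f)"
  unfolding Tinv_def using f i
  by (subst linop_comb[OF linop_omega]) (auto intro!: laurent_T simp: omega_T[OF assms])

lemma omega_mulx_1:
  assumes f: "laurent n f"
  shows "om (mulx 1 f) = (\<lambda>a. q * mulx n (om f) a)"
proof (rule laurent_eqI[OF infinite_field, where n = n])
  show "laurent n (om (mulx 1 f))" "laurent n (\<lambda>a. q * mulx n (om f) a)"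
    using f n_pos by (auto intro!: laurent_omega laurent_mulx laurent_scale)
  fix x :: "nat \<Rightarrow> 'a" assume x: "generic_pt n x"
  have nz: "x (n - 1) \<noteq> 0" using generic_ptD(1)[OF x] n_pos by auto
  have "ev (om (mulx 1 f)) x = q * x (n - 1) * ev (om f) x"
    unfolding ev_omega[OF f] ev_omega[OF laurent_mulx[OF f order_refl n_pos]]
    by (subst ev_mulx[OF f]) (use n_pos nz in auto)
  also have "\<dots> = q * ev (mulx n (om f)) x"
    using ev_mulx[OF laurent_omega[OF f] n_pos order_refl, of x] nz by simp
  also have "\<dots> = ev (\<lambda>a. q * mulx n (om f) a) x"
    by (rule ev_scale[symmetric, where n = n]) (use f n_pos in \<open>auto intro!: laurent_mulx laurent_omega\<close>)
  finally show "ev (om (mulx 1 f)) x = ev (\<lambda>a. q * mulx n (om f) a) x" .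
qed

lemma omega_mulx_n:
  assumes f: "laurent n f" and n2: "2 \<le> n"
  shows "om (mulx n f) = mulx (n - 1) (om f)"
proof (rule laurent_eqI[OF infinite_field, where n = n])
  show "laurent n (om (mulx n f))" "laurent n (mulx (n - 1) (om f))"
    using f n2 by (auto intro!: laurent_omega laurent_mulx)
  fix x :: "nat \<Rightarrow> 'a" assume x: "generic_pt n x"
  have nz: "x (n - 1 - 1) \<noteq> 0" using generic_ptD(1)[OF x] n2 by auto
  have "ev (om (mulx n f)) x = x (n - 1 - 1) * ev (om f) x"
    unfolding ev_omega[OF f] ev_omega[OF laurent_mulx[OF f n_pos order_refl]]
    by (subst ev_mulx[OF f]) (use n2 nz in auto)
  also have "\<dots> = ev (mulx (n - 1) (om f)) x"
    by (rule ev_mulx[symmetric]) (use f n2 nz in \<open>auto intro!: laurent_omega\<close>)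
  finally show "ev (om (mulx n f)) x = ev (mulx (n - 1) (om f)) x" .
qed

section \<open>Relations among Cherednik operators, generators and the raising operator\<close>

lemma Y_eq:
  "Y i f = (\<lambda>a. t powi (int i - int n) * comp_ops (map T [i..<n]) (om (comp_ops (map Ti [1..<i]) f)) a)"
  by (simp add: Yop_def Let_def)

lemma linop_Y: "1 \<le> i \<Longrightarrow> i \<le> n \<Longrightarrow> linop n (Y i)"
proof -
  assume i: "1 \<le> i" "i \<le> n"
  have "linop n (comp_ops (map T [i..<n] @ [om] @ map Ti [1..<i]))"
    by (rule linop_comp_ops) (use i in \<open>auto intro!: linop_T linop_Ti linop_omega\<close>)
  from linop_scaled[OF this] show ?thesis by (simp add: Yop_def[abs_def] Let_def)
qed

lemma laurent_Y: "laurent n f \<Longrightarrow> 1 \<le> i \<Longrightarrow> i \<le> n \<Longrightarrow> laurent n (Y i f)"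
  using linop_laurent[OF linop_Y] .

text \<open>The right factor T_i cancels the last inverse in \<open>Y (i + 1)\<close>, the left one
  lengthens its chain of generators; the prefactors differ by \<open>t\<close>.\<close>

lemma T_Y_T:
  assumes f: "laurent n f" and i: "1 \<le> i" "i < n"
  shows "T i (Y (i + 1) (T i f)) = (\<lambda>a. t * Y i f a)"
proof -
  let ?V = "comp_ops (map Ti [1..<i])"
  have "[1..<i + 1] = [1..<i] @ [i]" using i upt_Suc_append[of 1 i] by (simp flip: Suc_eq_plus1)
  then have V: "comp_ops (map Ti [1..<i + 1]) (T i f) = ?V f" using f i by simp
  have lV: "laurent n (?V f)" using f i by (intro laurent_Tis) auto
  let ?W = "comp_ops (map T [i + 1..<n]) (om (?V f))"
  have lW: "laurent n ?W" using i lV by (intro laurent_Ts laurent_omega) auto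
  have "T i (Y (i + 1) (T i f)) = (\<lambda>a. t powi (int (i + 1) - int n) * T i ?W a)"
    unfolding Y_eq V by (rule linop_scale[OF linop_T[OF i] lW])
  also have "\<dots> = (\<lambda>a. t * Y i f a)"
  proof -
    have "t powi (int (i + 1) - int n) = t * t powi (int i - int n)"
      using power_int_add[of t 1 "int i - int n"] by (simp add: algebra_simps)
    moreover have "[i..<n] = i # [i + 1..<n]" using i by (simp add: upt_conv_Cons flip: Suc_eq_plus1)
    ultimately show ?thesis by (simp add: Y_eq mult.assoc)
  qed
  finally show ?thesis .
qed

text \<open>For j < i the generator becomes T_{i-1} on passing the left chain, and
  \<open>omega\<close> restores T_i before the inverses. For j > i + 1 it passes the left chain
  unchanged, becomes T_{i+1} at \<open>omega\<close>, and the inverses restore T_i.\<close>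

lemma T_Y_commute:
  assumes f: "laurent n f" and i: "1 \<le> i" "i < n" and j: "1 \<le> j" "j \<le> n" "j \<noteq> i" "j \<noteq> i + 1"
  shows "T i (Y j f) = Y j (T i f)"
proof -
  let ?V = "comp_ops (map Ti [1..<j])" and ?W = "comp_ops (map T [j..<n])"
  have lV: "laurent n (?V g)" if "laurent n g" for g using that j by (intro laurent_Tis) auto
  have lW: "laurent n (?W g)" if "laurent n g" for g using that j by (intro laurent_Ts) auto
  have lT: "laurent n (T i f)" using f i by (rule laurent_T)
  have "T i (Y j f) = (\<lambda>a. t powi (int j - int n) * T i (?W (om (?V f))) a)"
    unfolding Y_eq by (rule linop_scale[OF linop_T[OF i]]) (intro lW laurent_omega lV f)
  also have "T i (?W (om (?V f))) = ?W (om (?V (T i f)))"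
  proof (cases "j < i")
    case True
    then have i1: "i - 1 + 1 = i" "1 \<le> i - 1" "j \<le> i - 1" using i j by auto
    have "T i (?W (om (?V f))) = ?W (T (i - 1) (om (?V f)))"
      using T_chain_up[of "om (?V f)" j "i - 1"] i i1 j laurent_omega[OF lV[OF f]] by simp
    also have "T (i - 1) (om (?V f)) = om (T i (?V f))"
      using omega_T[OF lV[OF f], of "i - 1"] i i1 by simp
    also have "T i (?V f) = ?V (T i f)"
      by (rule T_Tis_commute) (use f i j True in auto)
    finally show ?thesis .
  next
    case False
    then have ij: "i + 1 < j" using j by auto
    have "T i (?W (om (?V f))) = ?W (T i (om (?V f)))"
      by (rule T_Ts_commute) (use f i j ij in \<open>auto intro!: laurent_omega lV\<close>)
    also have "T i (om (?V f)) = om (T (i + 1) (?V f))"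
      using omega_T[OF lV[OF f], of i] i ij j by simp
    also have "T (i + 1) (?V f) = ?V (T i f)"
      by (rule Ti_chain_up[OF f]) (use i ij j in auto)
    finally show ?thesis .
  qed
  finally show ?thesis unfolding Y_eq .
qed

lemma Phi_Y_1:
  assumes f: "laurent n f"
  shows "Phi (Y 1 f) = (\<lambda>a. t powi (1 - int n) * mulx n (om f) a)"
proof -
  have "Phi (Y 1 f) = (\<lambda>a. t powi (1 - int n) * Phi (comp_ops (map T [1..<n]) (om f)) a)"
    unfolding Y_eq
    by (simp, rule linop_scale[OF linop_Phi[OF n_pos]]) (use f in \<open>auto intro!: laurent_Ts laurent_omega\<close>)
  moreover have "Phi (comp_ops (map T [1..<n]) (om f)) = mulx n (om f)"
    unfolding Phiop_def by (subst Tis_Ts(1)) (use f in \<open>auto intro!: laurent_omega\<close>)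
  ultimately show ?thesis by simp
qed

text \<open>Both sides are multiples of x_n \<open>omega\<close>: on the left the inverses of
  \<open>Y n\<close> meet \<open>Phi\<close> and collapse to x_1, on the right \<open>Phi\<close>
  undoes the chain of \<open>Y 1\<close>.\<close>

lemma Y_n_Phi:
  assumes f: "laurent n f"
  shows "Y n (Phi f) = (\<lambda>a. q * Phi (Y 1 f) a)"
proof -
  have "Y n (Phi f) = om (comp_ops (map Ti [1..<n]) (Phi f))" unfolding Y_eq by simp
  also have "comp_ops (map Ti [1..<n]) (Phi f) = (\<lambda>a. inverse t ^ (n - 1) * mulx 1 f a)"
    unfolding Phiop_def by (rule Ti_mulx_chain[OF f n_pos order_refl])
  also have "om \<dots> = (\<lambda>a. inverse t ^ (n - 1) * om (mulx 1 f) a)"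
    by (rule linop_scale[OF linop_omega]) (use f n_pos in \<open>auto intro: laurent_mulx\<close>)
  also have "\<dots> = (\<lambda>a. inverse t ^ (n - 1) * (q * mulx n (om f) a))"
    unfolding omega_mulx_1[OF f] ..
  also have "inverse t ^ (n - 1) = t powi (1 - int n)"
  proof -
    have "1 - int n = - int (n - 1)" using n_pos by simp
    then show ?thesis by (simp only: power_int_minus power_int_of_nat power_inverse)
  qed
  finally show ?thesis unfolding Phi_Y_1[OF f] by (simp add: algebra_simps)
qed

lemma Ts_Phi:
  assumes f: "laurent n f" and m: "1 \<le> m" "m < n"
  shows "Phi (comp_ops (map T [m + 1..<n]) f) = comp_ops (map T [m..<n - 1]) (Phi f)"
  using m
proof (induction "n - m" arbitrary: m)
  case (Suc d)
  show ?case
  proof (cases "m + 1 = n")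
    case True
    then show ?thesis using Suc by simp
  next
    case False
    then have m: "m + 1 < n" using Suc by simp
    have "Phi (comp_ops (map T [m + 1..<n]) f) = Phi (T (m + 1) (comp_ops (map T [m + 1 + 1..<n]) f))"
      using m by (simp add: upt_conv_Cons flip: Suc_eq_plus1)
    also have "\<dots> = T m (Phi (comp_ops (map T [m + 1 + 1..<n]) f))"
      by (rule T_Phi[symmetric]) (use f Suc m in \<open>auto intro!: laurent_Ts\<close>)
    also have "Phi (comp_ops (map T [m + 1 + 1..<n]) f) = comp_ops (map T [m + 1..<n - 1]) (Phi f)"
      using Suc.hyps(1)[of "m + 1"] Suc m by simp
    also have "T m \<dots> = comp_ops (map T [m..<n - 1]) (Phi f)"
    proof -
      have "[m..<n - 1] = m # [m + 1..<n - 1]" using m by (simp add: upt_conv_Cons flip: Suc_eq_plus1)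
      then show ?thesis by simp
    qed
    finally show ?thesis .
  qed
qed simp

lemma omega_Tis:
  assumes f: "laurent n f" and m: "1 \<le> m" "m < n"
  shows "om (comp_ops (map Ti (rev [2..<m + 1])) f) = comp_ops (map Ti (rev [1..<m])) (om f)"
  using m
proof (induction m rule: nat_induct_at_least)
  case base
  show ?case by simp
next
  case (Suc m)
  have "[2..<Suc m + 1] = [2..<m + 1] @ [m + 1]" using Suc.hyps by simp
  then have "om (comp_ops (map Ti (rev [2..<Suc m + 1])) f) = om (Ti (m + 1) (comp_ops (map Ti (rev [2..<m + 1])) f))"
    by simp
  also have "\<dots> = Ti m (om (comp_ops (map Ti (rev [2..<m + 1])) f))"
    by (rule omega_Ti) (use f Suc in \<open>auto intro!: laurent_Tis\<close>)
  also have "\<dots> = Ti m (comp_ops (map Ti (rev [1..<m])) (om f))" using Suc by simp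
  finally show ?case using Suc.hyps by simp
qed

lemma mulx_Ti:
  assumes f: "laurent n f" and i: "1 \<le> i" "i < n"
  shows "mulx (i + 1) (Ti i f) = (\<lambda>a. inverse t * T i (mulx i f) a)"
  unfolding T_mulx[OF assms] by (simp add: fun_eq_iff)

text \<open>Both sides reduce to t^(1-n) T_1 ... T_{n-1} x_{n-1} T_{n-2}^{-1} ... T_1^{-1}
  \<open>omega\<close> T_1^{-1}. On the right the last generator of the first chain arises from the
  cross relation \<open>mulx_Ti\<close>.\<close>

lemma Y_1_Phi:
  assumes f: "laurent n f" and n2: "2 \<le> n"
  shows "Y 1 (Phi f) = Phi (Y 2 f)"
proof -
  let ?L = "\<lambda>m. comp_ops (map Ti (rev [1..<m]))"
  have lf: "laurent n (Ti 1 f)" using f n2 by (intro laurent_Ti) auto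
  have L_n: "?L n g = Ti (n - 1) (?L (n - 1) g)" for g
  proof -
    have "[1..<n] = [1..<n - 1] @ [n - 1]" using n2 upt_Suc_append[of 1 "n - 1"] by simp
    then show ?thesis by simp
  qed
  have "?L n f = comp_ops (map Ti (rev [2..<n])) (Ti 1 f)"
  proof -
    have "[1..<n] = 1 # [2..<n]" using n2 by (simp add: upt_conv_Cons numeral_2_eq_2 One_nat_def)
    then show ?thesis by simp
  qed
  then have oL: "om (?L n f) = ?L (n - 1) (om (Ti 1 f))"
    using omega_Tis[OF lf, of "n - 1"] n2 by simp
  have "Y 1 (Phi f) = (\<lambda>a. t powi (1 - int n) * comp_ops (map T [1..<n]) (om (Phi f)) a)"
    unfolding Y_eq by simp
  also have "om (Phi f) = mulx (n - 1) (om (?L n f))"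
    unfolding Phiop_def by (rule omega_mulx_n[OF _ n2]) (use f in \<open>auto intro!: laurent_Tis\<close>)
  also have "\<dots> = mulx (n - 1) (?L (n - 1) (om (Ti 1 f)))" unfolding oL ..
  finally have 1: "Y 1 (Phi f) = (\<lambda>a. t powi (1 - int n) *
      comp_ops (map T [1..<n]) (mulx (n - 1) (?L (n - 1) (om (Ti 1 f)))) a)" .
  let ?g = "?L (n - 1) (om (Ti 1 f))"
  have lg: "laurent n ?g" using lf by (intro laurent_Tis laurent_omega) auto
  have lmg: "laurent n (mulx (n - 1) ?g)" using lg n2 by (intro laurent_mulx) auto
  have "Y 2 f = (\<lambda>a. t powi (2 - int n) * comp_ops (map T [2..<n]) (om (Ti 1 f)) a)"
    unfolding Y_eq by (simp add: upt_conv_Cons)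
  then have "Phi (Y 2 f) = (\<lambda>a. t powi (2 - int n) * Phi (comp_ops (map T [2..<n]) (om (Ti 1 f))) a)"
    using linop_scale[OF linop_Phi[OF n_pos] laurent_Ts[OF laurent_omega[OF lf]], of "[2..<n]"] by simp
  also have "Phi (comp_ops (map T [2..<n]) (om (Ti 1 f))) = comp_ops (map T [1..<n - 1]) (Phi (om (Ti 1 f)))"
    using Ts_Phi[OF laurent_omega[OF lf], of 1] n2 by (simp add: numeral_2_eq_2 flip: Suc_eq_plus1)
  also have "Phi (om (Ti 1 f)) = mulx (n - 1 + 1) (Ti (n - 1) ?g)"
    unfolding Phiop_def L_n using n2 by simp
  also have "\<dots> = (\<lambda>a. inverse t * T (n - 1) (mulx (n - 1) ?g) a)"
    by (rule mulx_Ti[OF lg]) (use n2 in auto)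
  also have "comp_ops (map T [1..<n - 1]) \<dots> = (\<lambda>a. inverse t *
      comp_ops (map T [1..<n - 1]) (T (n - 1) (mulx (n - 1) ?g)) a)"
    by (rule linop_scale[OF linop_Ts]) (use n2 lmg in \<open>auto intro!: laurent_T\<close>)
  also have "comp_ops (map T [1..<n - 1]) (T (n - 1) (mulx (n - 1) ?g))
      = comp_ops (map T [1..<n]) (mulx (n - 1) ?g)"
  proof -
    have "[1..<n] = [1..<n - 1] @ [n - 1]" using n2 upt_Suc_append[of 1 "n - 1"] by simp
    then show ?thesis by simp
  qed
  also have "(\<lambda>a. t powi (2 - int n) * (inverse t * comp_ops (map T [1..<n]) (mulx (n - 1) ?g) a))
    = (\<lambda>a. t powi (1 - int n) * comp_ops (map T [1..<n]) (mulx (n - 1) ?g) a)"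
  proof -
    have "t powi (2 - int n) * inverse t = t powi (1 - int n)"
      using power_int_add[of t "2 - int n" "-1"] by (simp add: power_int_minus)
    then show ?thesis by (simp add: mult.assoc[symmetric])
  qed
  finally show ?thesis unfolding 1 ..
qed

lemma Y_step:
  assumes f: "laurent n f" and i: "1 \<le> i" "i < n"
  shows "Y (i + 1) f = (\<lambda>a. t * Ti i (Y i (Ti i f)) a)"
proof -
  have l: "laurent n (Ti i f)" using f i by (rule laurent_Ti)
  have "T i (Y (i + 1) (T i (Ti i f))) = (\<lambda>a. t * Y i (Ti i f) a)" by (rule T_Y_T[OF l i])
  then have "Ti i (T i (Y (i + 1) f)) = Ti i (\<lambda>a. t * Y i (Ti i f) a)" using f i by simp
  then show ?thesis using f i l linop_scale[OF linop_Ti[OF i] laurent_Y[OF l]] by (simp add: laurent_Y)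
qed

text \<open>\<open>Y_step\<close> expresses Y_{i+1} through Y_i and inverses, and \<open>Phi\<close>
  shifts the index of these inverses, so everything rests on the case i = 1.\<close>

lemma Y_Phi:
  assumes f: "laurent n f" and i: "1 \<le> i" "i < n"
  shows "Y i (Phi f) = Phi (Y (i + 1) f)"
  using i f
proof (induction i arbitrary: f rule: nat_induct_at_least)
  case base
  then show ?case using Y_1_Phi[of f] by (simp add: numeral_2_eq_2 flip: Suc_eq_plus1)
next
  case (Suc i)
  let ?f = "Ti (i + 1) f"
  have lf: "laurent n ?f" using Suc by (intro laurent_Ti) auto
  have lP: "laurent n (Phi g)" if "laurent n g" for g using linop_laurent[OF linop_Phi[OF n_pos] that] .
  have TiPhi: "Ti i (Phi g) = Phi (Ti (i + 1) g)" if g: "laurent n g" for g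
    unfolding Tinv_def using g Suc
    by (subst linop_comb[OF linop_Phi[OF n_pos]]) (auto intro!: laurent_T simp: T_Phi)
  have "Y (i + 1) (Phi f) = (\<lambda>a. t * Ti i (Y i (Ti i (Phi f))) a)"
    by (rule Y_step) (use Suc lP in auto)
  also have "Ti i (Phi f) = Phi ?f" by (rule TiPhi[OF Suc.prems(2)])
  also have "Y i (Phi ?f) = Phi (Y (i + 1) ?f)" using Suc lf by simp
  also have "Ti i (Phi (Y (i + 1) ?f)) = Phi (Ti (i + 1) (Y (i + 1) ?f))"
    by (rule TiPhi) (use Suc lf in \<open>auto intro!: laurent_Y\<close>)
  also have "(\<lambda>a. t * Phi (Ti (i + 1) (Y (i + 1) ?f)) a) = Phi (\<lambda>a. t * Ti (i + 1) (Y (i + 1) ?f) a)"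
    by (rule linop_scale[OF linop_Phi[OF n_pos], symmetric]) (use Suc lf in \<open>auto intro!: laurent_Y laurent_Ti\<close>)
  also have "(\<lambda>a. t * Ti (i + 1) (Y (i + 1) ?f) a) = Y (i + 1 + 1) f"
    by (rule Y_step[symmetric]) (use Suc in auto)
  finally show ?case by (simp flip: Suc_eq_plus1)
qed

lemma Dop_n: "Dop n q t n f = mulxinv n (\<lambda>a. f a - t ^ (n - 1) * Y n f a)"
  by (simp add: Dop_def Let_def)

text \<open>D_n is x_n^{-1} (1 - t^(n-1) Y_n), and by \<open>Y_n_Phi\<close> the factor
  \<open>Phi\<close> moves to the left of the bracket. Its x_n then cancels x_n^{-1}, and its
  inverses cancel the generators of \<open>Phihat\<close>.\<close>

lemma Phihat_Phi:
  assumes f: "laurent n f"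
  shows "Phihat n q t (Phi f) = (\<lambda>a. f a - q * t ^ (n - 1) * Y 1 f a)"
proof -
  have lY: "laurent n (Y 1 f)" using f n_pos by (intro laurent_Y) auto
  let ?h = "\<lambda>a. f a - q * t ^ (n - 1) * Y 1 f a"
  have lh: "laurent n ?h" using laurent_comb[OF f lY, of 1 "- (q * t ^ (n - 1))"] by simp
  have "Phi ?h = (\<lambda>a. Phi f a - t ^ (n - 1) * Y n (Phi f) a)"
    using linop_comb[OF linop_Phi[OF n_pos] f lY, of 1 "- (q * t ^ (n - 1))"]
    by (simp add: Y_n_Phi[OF f] mult.assoc mult.left_commute)
  then have "Dop n q t n (Phi f) = mulxinv n (Phi ?h)" unfolding Dop_n by simp
  also have "\<dots> = comp_ops (map Ti (rev [1..<n])) ?h"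
    unfolding Phiop_def by (rule mulxinv_mulx) (use lh n_pos in \<open>auto intro!: laurent_Tis\<close>)
  finally show ?thesis
    using Tis_Ts(2)[OF lh, of "[1..<n]"] by (simp add: Phihat_def)
qed

end

section \<open>Triangularity\<close>

text \<open>The dominance order on sorted exponents is encoded by the convex functionals
  \<open>\<Sum>i. max (a ! i - c) 0\<close>, which avoids sorting.\<close>

definition excess :: "int \<Rightarrow> int list \<Rightarrow> int" where
  "excess c a = (\<Sum>i<length a. max (a ! i - c) 0)"

definition psum :: "int list \<Rightarrow> nat \<Rightarrow> int" where
  "psum a p = (\<Sum>i<p. a ! i)"

text \<open>The order of the theorem with the degree fixed, carried over to integer exponents.
  Excesses agree at all thresholds exactly for rearrangements, so the strict alternative means
  different sorted forms, and the other one compares partial sums as they stand.\<close>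

definition below :: "int list \<Rightarrow> int list \<Rightarrow> bool" where
  "below a b \<longleftrightarrow> length a = length b \<and> psum a (length a) = psum b (length b) \<and>
     (\<forall>c. excess c a \<le> excess c b) \<and>
     ((\<exists>c. excess c a < excess c b) \<or> (\<forall>p\<le>length a. psum a p \<le> psum b p))"

definition sbelow :: "int list \<Rightarrow> int list \<Rightarrow> bool" where
  "sbelow a b \<longleftrightarrow> below a b \<and> a \<noteq> b"

lemma below_refl: "below a a"
  by (simp add: below_def)

lemma below_trans:
  assumes "below a b" "below b c"
  shows "below a c"
  unfolding below_def
proof (intro conjI allI)
  show "length a = length c" "psum a (length a) = psum c (length c)" using assms by (auto simp: below_def)
  have le: "excess x a \<le> excess x b" "excess x b \<le> excess x c" for x using assms by (auto simp: below_def)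
  then show "excess x a \<le> excess x c" for x using order_trans by blast
  show "(\<exists>x. excess x a < excess x c) \<or> (\<forall>p\<le>length a. psum a p \<le> psum c p)"
  proof (cases "\<exists>x. excess x a < excess x b \<or> excess x b < excess x c")
    case True
    then show ?thesis using le by (meson le_less_trans less_le_trans)
  next
    case False
    then have "\<forall>p\<le>length a. psum a p \<le> psum b p" "\<forall>p\<le>length b. psum b p \<le> psum c p"
      using assms unfolding below_def by blast+
    moreover have "length a = length b" using assms by (simp add: below_def)
    ultimately show ?thesis by fastforce
  qed
qed

lemma below_antisym:
  assumes "below a b" "below b a"
  shows "a = b"
proof -
  have len: "length a = length b" using assms by (simp add: below_def)
  have "excess c a = excess c b" for c
    by (rule antisym) (use assms in \<open>auto simp: below_def\<close>)
  then have eq: "psum a p = psum b p" if "p \<le> length a" for p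
    by (intro antisym) (use assms that in \<open>auto simp: below_def\<close>)
  show ?thesis
  proof (rule nth_equalityI[OF len])
    fix i assume "i < length a"
    then show "a ! i = b ! i" using eq[of i] eq[of "Suc i"] by (simp add: psum_def)
  qed
qed

lemma sbelow_trans: "sbelow a b \<Longrightarrow> sbelow b c \<Longrightarrow> sbelow a c"
  unfolding sbelow_def using below_trans below_antisym by blast

lemma sbelow_length: "sbelow a b \<Longrightarrow> length a = length b"
  by (simp add: sbelow_def below_def)

lemma sum_update2:
  fixes g :: "int \<Rightarrow> int"
  assumes "j < length a" "k < length a" "j \<noteq> k"
  shows "(\<Sum>i<length a. g (a[j := x, k := y] ! i)) = (\<Sum>i<length a. g (a ! i)) - g (a ! j) - g (a ! k) + g x + g y"
proof -
  have "(\<Sum>i\<in>{..<length a} - {j, k}. g (a[j := x, k := y] ! i)) = (\<Sum>i\<in>{..<length a} - {j, k}. g (a ! i))"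
    by (rule sum.cong) auto
  then show ?thesis using assms by (simp add: sum_split2[OF assms])
qed

lemma excess_spread:
  assumes "j < length a" "k < length a" "j \<noteq> k" "x + y = a ! j + a ! k" "max x y > max (a ! j) (a ! k)"
  shows "excess c a \<le> excess c (a[j := x, k := y])"
    and "\<exists>c. excess c a < excess c (a[j := x, k := y])"
proof -
  have ex: "excess c (a[j := x, k := y]) = excess c a - max (a ! j - c) 0 - max (a ! k - c) 0 + max (x - c) 0 + max (y - c) 0" for c
    using sum_update2[OF assms(1-3), of "\<lambda>v. max (v - c) 0" x y] by (simp add: excess_def)
  show "excess c a \<le> excess c (a[j := x, k := y])" unfolding ex using assms(4,5) by linarith
  \<comment> \<open>Convexity is strict at the larger old entry: there both old contributions vanish
    and a new one is positive.\<close>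
  show "\<exists>c. excess c a < excess c (a[j := x, k := y])"
    unfolding ex by (rule exI[of _ "max (a ! j) (a ! k)"]) (use assms(4,5) in linarith)
qed

lemma sbelow_spread:
  assumes jk: "j < length a" "k < length a" "j \<noteq> k"
    and xy: "x + y = a ! j + a ! k" "max x y > max (a ! j) (a ! k)"
  shows "sbelow a (a[j := x, k := y])"
proof -
  have "psum a (length a) = psum (a[j := x, k := y]) (length (a[j := x, k := y]))"
    using sum_update2[OF jk, of "\<lambda>v. v" x y] xy by (simp add: psum_def)
  then show ?thesis
    using excess_spread[OF jk xy] unfolding sbelow_def below_def by force
qed

lemma sbelow_swap:
  assumes jk: "j < k" "k < length a" and lt: "a ! j < a ! k"
  shows "sbelow a (a[j := a ! k, k := a ! j])"
proof -
  let ?b = "a[j := a ! k, k := a ! j]"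
  have jk': "j < length a" "k < length a" "j \<noteq> k" using jk by auto
  have ex: "excess c ?b = excess c a" for c
    using sum_update2[OF jk', of "\<lambda>v. max (v - c) 0" "a ! k" "a ! j"] by (simp add: excess_def)
  have ps: "psum a p \<le> psum ?b p" if "p \<le> length a" for p
  proof (cases "k < p")
    case True
    have "(\<Sum>i\<in>{..<p} - {j, k}. ?b ! i) = (\<Sum>i\<in>{..<p} - {j, k}. a ! i)" by (rule sum.cong) auto
    moreover have jp: "j < p" "k < p" "j \<noteq> k" using True jk by auto
    ultimately show ?thesis unfolding psum_def sum_split2[OF jp] using jk by simp
  next
    case False
    show ?thesis unfolding psum_def
      by (rule sum_mono) (use False jk lt that in \<open>auto simp: nth_list_update\<close>)
  qed
  have "psum a (length a) = psum ?b (length ?b)"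
    using sum_update2[OF jk', of "\<lambda>v. v" "a ! k" "a ! j"] by (simp add: psum_def)
  then have "below a ?b" using ps ex by (simp add: below_def)
  moreover have "?b ! j \<noteq> a ! j" using jk lt by simp
  ultimately show ?thesis by (metis sbelow_def)
qed

section \<open>Relabelled exponents and triangular operators\<close>

definition pm :: "(nat \<Rightarrow> nat) \<Rightarrow> int list \<Rightarrow> int list" where
  "pm \<sigma> a = map (\<lambda>p. a ! \<sigma> p) [0..<length a]"

lemma length_pm [simp]: "length (pm \<sigma> a) = length a"
  by (simp add: pm_def)

lemma nth_pm [simp]: "p < length a \<Longrightarrow> pm \<sigma> a ! p = a ! \<sigma> p"
  by (simp add: pm_def)

definition perm_on :: "nat \<Rightarrow> (nat \<Rightarrow> nat) \<Rightarrow> bool" where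
  "perm_on n \<sigma> \<longleftrightarrow> inj_on \<sigma> {..<n} \<and> \<sigma> ` {..<n} \<subseteq> {..<n}"

lemma pm_update2:
  assumes "perm_on (length a) \<sigma>" "j < length a" "k < length a" "j \<noteq> k"
  shows "pm \<sigma> (a[\<sigma> j := x, \<sigma> k := y]) = (pm \<sigma> a)[j := x, k := y]"
proof (rule nth_equalityI)
  fix p assume "p < length (pm \<sigma> (a[\<sigma> j := x, \<sigma> k := y]))"
  then have p: "p < length a" by simp
  have lt: "\<sigma> p < length a" "\<sigma> j < length a" "\<sigma> k < length a" using assms p by (auto simp: perm_on_def)
  have "\<sigma> p = \<sigma> j \<longleftrightarrow> p = j" "\<sigma> p = \<sigma> k \<longleftrightarrow> p = k" "\<sigma> j \<noteq> \<sigma> k"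
    using assms p by (auto simp: perm_on_def inj_on_def)
  then show "pm \<sigma> (a[\<sigma> j := x, \<sigma> k := y]) ! p = (pm \<sigma> a)[j := x, k := y] ! p"
    using p lt by (auto simp: nth_list_update)
qed simp

lemma pm_swpt: "1 \<le> k \<Longrightarrow> k < length a \<Longrightarrow> pm (swpt k \<sigma>) a = swp k (pm \<sigma> a)"
  by (rule nth_equalityI) (auto simp: swpt_def swp_def nth_list_update)

text \<open>The operator \<open>A\<close> is triangular up to the relabellings \<open>\<sigma>\<close>, \<open>\<sigma>'\<close> of its source and target
  exponents, with diagonal entries \<open>d\<close>. Phrasing this through vanishing above \<open>\<mu>\<close> makes the
  property compose without mentioning matrix entries.\<close>

definition tri :: "nat \<Rightarrow> 'a::field lop \<Rightarrow> (nat \<Rightarrow> nat) \<Rightarrow> (nat \<Rightarrow> nat) \<Rightarrow> (int list \<Rightarrow> 'a) \<Rightarrow> bool" where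
  "tri n A \<sigma> \<sigma>' d \<longleftrightarrow> (\<forall>F \<mu>. laurent n F \<longrightarrow> length \<mu> = n \<longrightarrow>
     (\<forall>\<nu>. sbelow \<mu> \<nu> \<longrightarrow> F (pm \<sigma> \<nu>) = 0) \<longrightarrow> A F (pm \<sigma>' \<mu>) = d \<mu> * F (pm \<sigma> \<mu>))"

text \<open>Vanishing of \<open>F\<close> above \<mu> passes to \<open>A F\<close>: if \<nu> is
  above \<mu>, everything above \<nu> is also above \<mu>, so the diagonal formula for
  \<open>A\<close> applies at \<nu> and gives 0.\<close>

lemma tri_comp:
  fixes A B :: "'a::field lop"
  assumes A: "tri n A \<sigma> \<sigma>' d" and B: "tri n B \<sigma>' \<sigma>'' e" and l: "linop n A"
  shows "tri n (\<lambda>F. B (A F)) \<sigma> \<sigma>'' (\<lambda>\<mu>. e \<mu> * d \<mu>)"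
  unfolding tri_def
proof (intro allI impI)
  fix F :: "'a lpoly" and \<mu> assume F: "laurent n F" and mu: "length \<mu> = n" and v: "\<forall>\<nu>. sbelow \<mu> \<nu> \<longrightarrow> F (pm \<sigma> \<nu>) = 0"
  have "A F (pm \<sigma>' \<nu>) = 0" if "sbelow \<mu> \<nu>" for \<nu>
  proof -
    have "A F (pm \<sigma>' \<nu>) = d \<nu> * F (pm \<sigma> \<nu>)"
      using A F v that sbelow_trans[OF that] sbelow_length[OF that] mu unfolding tri_def by simp
    then show ?thesis using v that by simp
  qed
  then have "B (A F) (pm \<sigma>'' \<mu>) = e \<mu> * A F (pm \<sigma>' \<mu>)"
    using B linop_laurent[OF l F] mu unfolding tri_def by blast
  moreover have "A F (pm \<sigma>' \<mu>) = d \<mu> * F (pm \<sigma> \<mu>)" using A F mu v unfolding tri_def by blast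
  ultimately show "B (A F) (pm \<sigma>'' \<mu>) = e \<mu> * d \<mu> * F (pm \<sigma> \<mu>)" by simp
qed

lemma tri_sop: "1 \<le> k \<Longrightarrow> k < n \<Longrightarrow> tri n (sop k) \<sigma> (swpt k \<sigma>) (\<lambda>_. 1)"
  unfolding tri_def by (auto simp: sop_def pm_swpt swp_swp)

lemma tri_tauop: "1 \<le> n \<Longrightarrow> tri n (tauop q 1) \<sigma> \<sigma> (\<lambda>\<mu>. q powi (\<mu> ! \<sigma> 0))"
  unfolding tri_def by (auto simp: tauop_def)

context hecke
begin

text \<open>Supplies the hypothesis \<open>spread\<close> of \<open>T_coeff\<close>: spreading two
  entries of \<mu> apart leads to an exponent above \<mu>, whatever the relabelling.\<close>

lemma tri_T_spread:
  assumes \<sigma>: "perm_on n \<sigma>" and k: "1 \<le> k" "k < n" and mu: "length \<mu> = n"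
    and v: "\<forall>\<nu>. sbelow \<mu> \<nu> \<longrightarrow> F (pm \<sigma> \<nu>) = 0"
    and xy: "x + y = swp k (pm \<sigma> \<mu>) ! (k - 1) + swp k (pm \<sigma> \<mu>) ! k"
      "max x y > max (swp k (pm \<sigma> \<mu>) ! (k - 1)) (swp k (pm \<sigma> \<mu>) ! k)"
  shows "F ((swp k (pm \<sigma> \<mu>))[k - 1 := x, k := y]) = 0"
proof -
  let ?m = "pm \<sigma> \<mu>"
  have kk: "k - 1 < n" "k < n" "k - 1 \<noteq> k" using k by auto
  have s: "swp k ?m ! (k - 1) = \<mu> ! \<sigma> k" "swp k ?m ! k = \<mu> ! \<sigma> (k - 1)"
    using kk mu by (auto simp: swp_def nth_list_update)
  have ne: "\<sigma> (k - 1) < length \<mu>" "\<sigma> k < length \<mu>" "\<sigma> (k - 1) \<noteq> \<sigma> k"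
    using \<sigma> kk mu by (auto simp: perm_on_def inj_on_def)
  have "sbelow \<mu> (\<mu>[\<sigma> (k - 1) := x, \<sigma> k := y])"
    by (rule sbelow_spread[OF ne]) (use xy in \<open>auto simp: s\<close>)
  then have "F ((pm \<sigma> \<mu>)[k - 1 := x, k := y]) = 0"
    using v pm_update2[of \<mu> \<sigma> "k - 1" k x y] \<sigma> kk mu by metis
  moreover have "(swp k ?m)[k - 1 := x, k := y] = ?m[k - 1 := x, k := y]"
    using kk mu by (intro nth_equalityI) (auto simp: swp_def nth_list_update)
  ultimately show ?thesis by simp
qed

lemma swp_pm:
  assumes "perm_on n \<sigma>" "1 \<le> k" "k < n" "length \<mu> = n"
  shows "swp k (pm \<sigma> \<mu>) = pm \<sigma> (\<mu>[\<sigma> (k - 1) := \<mu> ! \<sigma> k, \<sigma> k := \<mu> ! \<sigma> (k - 1)])"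
  using assms pm_update2[of \<mu> \<sigma> "k - 1" k] by (simp add: swp_def)

text \<open>\<open>T_coeff\<close> has an extra term at the exchanged exponent when the entry at
  \<open>\<sigma> k\<close> is the smaller one. As \<open>\<sigma> k\<close> precedes
  \<open>\<sigma> (k - 1)\<close>, the exchange moves the larger entry to the front, which is above
  \<mu>, and the term vanishes. For the inverses the two positions trade roles.\<close>

lemma tri_T:
  assumes \<sigma>: "perm_on n \<sigma>" and k: "1 \<le> k" "k < n" and lt: "\<sigma> k < \<sigma> (k - 1)"
  shows "tri n (T k) \<sigma> (swpt k \<sigma>) (\<lambda>\<mu>. if \<mu> ! \<sigma> (k - 1) \<le> \<mu> ! \<sigma> k then t else 1)"
  unfolding tri_def
proof (intro allI impI)
  fix F :: "'a lpoly" and \<mu> assume F: "laurent n F" and mu: "length \<mu> = n" and v: "\<forall>\<nu>. sbelow \<mu> \<nu> \<longrightarrow> F (pm \<sigma> \<nu>) = 0"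
  let ?m = "pm \<sigma> \<mu>"
  have kk: "k - 1 < n" "k < n" "k - 1 \<noteq> k" using k by auto
  have s: "swp k ?m ! (k - 1) = \<mu> ! \<sigma> k" "swp k ?m ! k = \<mu> ! \<sigma> (k - 1)"
    using kk mu by (auto simp: swp_def nth_list_update)
  have ss: "swp k (swp k ?m) = ?m" using k mu by (simp add: swp_swp)
  have ne: "\<sigma> (k - 1) < length \<mu>" using \<sigma> kk mu by (auto simp: perm_on_def)
  have "T k F (swp k ?m) = (if \<mu> ! \<sigma> k < \<mu> ! \<sigma> (k - 1) then F ?m + (t - 1) * F (swp k ?m) else t * F ?m)"
    using T_coeff[OF F k, of "swp k ?m"] tri_T_spread[OF \<sigma> k mu v] mu unfolding s ss by simp
  moreover have "F (swp k ?m) = 0" if "\<mu> ! \<sigma> k < \<mu> ! \<sigma> (k - 1)"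
    using sbelow_swap[OF lt ne that] v unfolding swp_pm[OF \<sigma> k mu]
    using lt by (metis list_update_swap less_irrefl)
  ultimately show "T k F (pm (swpt k \<sigma>) \<mu>) = (if \<mu> ! \<sigma> (k - 1) \<le> \<mu> ! \<sigma> k then t else 1) * F ?m"
    using k mu by (auto simp: pm_swpt)
qed

lemma tri_Ti:
  assumes \<sigma>: "perm_on n \<sigma>" and k: "1 \<le> k" "k < n" and lt: "\<sigma> (k - 1) < \<sigma> k"
  shows "tri n (Ti k) \<sigma> (swpt k \<sigma>) (\<lambda>\<mu>. if \<mu> ! \<sigma> k \<le> \<mu> ! \<sigma> (k - 1) then inverse t else 1)"
  unfolding tri_def
proof (intro allI impI)
  fix F :: "'a lpoly" and \<mu> assume F: "laurent n F" and mu: "length \<mu> = n" and v: "\<forall>\<nu>. sbelow \<mu> \<nu> \<longrightarrow> F (pm \<sigma> \<nu>) = 0"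
  let ?m = "pm \<sigma> \<mu>"
  have kk: "k - 1 < n" "k < n" "k - 1 \<noteq> k" using k by auto
  have s: "swp k ?m ! (k - 1) = \<mu> ! \<sigma> k" "swp k ?m ! k = \<mu> ! \<sigma> (k - 1)"
    using kk mu by (auto simp: swp_def nth_list_update)
  have ss: "swp k (swp k ?m) = ?m" using k mu by (simp add: swp_swp)
  have ne: "\<sigma> k < length \<mu>" using \<sigma> kk mu by (auto simp: perm_on_def)
  have "Ti k F (swp k ?m) = (if \<mu> ! \<sigma> (k - 1) < \<mu> ! \<sigma> k then F ?m + (inverse t - 1) * F (swp k ?m) else inverse t * F ?m)"
    using Ti_coeff[OF F k, of "swp k ?m"] tri_T_spread[OF \<sigma> k mu v] mu unfolding s ss by simp
  moreover have "F (swp k ?m) = 0" if "\<mu> ! \<sigma> (k - 1) < \<mu> ! \<sigma> k"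
    using sbelow_swap[OF lt ne that] v unfolding swp_pm[OF \<sigma> k mu] by blast
  ultimately show "Ti k F (pm (swpt k \<sigma>) \<mu>) = (if \<mu> ! \<sigma> k \<le> \<mu> ! \<sigma> (k - 1) then inverse t else 1) * F ?m"
    using k mu by (auto simp: pm_swpt)
qed

end

text \<open>The relabelling that moves the entry at position \<open>i\<close> to position \<open>m\<close>.\<close>

definition mv :: "nat \<Rightarrow> nat \<Rightarrow> nat \<Rightarrow> nat" where
  "mv i m p = (if p = m then i else if m < p \<and> p \<le> i then p - 1 else if i \<le> p \<and> p < m then p + 1 else p)"

lemma mv_id: "mv i i = (\<lambda>p. p)"
  by (auto simp: mv_def)

lemma pm_id [simp]: "pm (\<lambda>p. p) a = a"
  by (simp add: pm_def map_nth)

lemma perm_on_mv: "i < n \<Longrightarrow> m < n \<Longrightarrow> perm_on n (mv i m)"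
  by (auto simp: perm_on_def inj_on_def mv_def split: if_splits)

lemma swpt_mv_down: "swpt (Suc m) (mv i (Suc m)) = mv i m"
  by (rule ext) (auto simp: swpt_def mv_def)

lemma swpt_mv_up: "swpt (Suc m) (mv i m) = mv i (Suc m)"
  by (rule ext) (auto simp: swpt_def mv_def)

section \<open>Leading coefficients of the Cherednik operators\<close>

context macdonald
begin

lemma tri_Tis:
  assumes "m \<le> i" "i < n"
  shows "tri n (comp_ops (map Ti [m + 1..<i + 1])) (mv i i) (mv i m)
    (\<lambda>\<mu>. \<Prod>p\<in>{m..<i}. if \<mu> ! i \<le> \<mu> ! p then inverse t else 1)"
  using assms(1)
proof (induction rule: inc_induct)
  case base
  show ?case by (simp add: tri_def)
next
  case (step m)
  have "tri n (Ti (Suc m)) (mv i (Suc m)) (swpt (Suc m) (mv i (Suc m)))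
      (\<lambda>\<mu>. if \<mu> ! mv i (Suc m) (Suc m) \<le> \<mu> ! mv i (Suc m) (Suc m - 1) then inverse t else 1)"
    by (rule tri_Ti) (use step assms in \<open>auto intro!: perm_on_mv simp: mv_def\<close>)
  then have "tri n (Ti (Suc m)) (mv i (Suc m)) (mv i m) (\<lambda>\<mu>. if \<mu> ! i \<le> \<mu> ! m then inverse t else 1)"
    unfolding swpt_mv_down using step by (simp add: mv_def)
  from tri_comp[OF step.IH this linop_Tis]
  have "tri n (\<lambda>F. Ti (Suc m) (comp_ops (map Ti [Suc m + 1..<i + 1]) F)) (mv i i) (mv i m)
    (\<lambda>\<mu>. (if \<mu> ! i \<le> \<mu> ! m then inverse t else 1) * (\<Prod>p\<in>{Suc m..<i}. if \<mu> ! i \<le> \<mu> ! p then inverse t else 1))"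
    using assms by auto
  moreover have "[m + 1..<i + 1] = Suc m # [Suc m + 1..<i + 1]" using step by (simp add: upt_conv_Cons del: upt_Suc)
  moreover have "{m..<i} = insert m {Suc m..<i}" using step by auto
  ultimately show ?case by (simp add: comp_ops_def)
qed

lemma tri_sops:
  assumes "m < n"
  shows "tri n (comp_ops (map sop (rev [1..<m + 1]))) (mv i 0) (mv i m) (\<lambda>_. 1 :: 'a)"
  using assms
proof (induction m)
  case 0
  show ?case by (simp add: tri_def)
next
  case (Suc m)
  have l: "linop n (comp_ops (map sop (rev [1..<m + 1])) :: 'a lop)"
    by (rule linop_comp_ops) (use Suc in \<open>auto intro!: linop_sop\<close>)
  have "tri n (sop (Suc m)) (mv i m) (mv i (Suc m)) (\<lambda>_. 1 :: 'a)"
    using tri_sop[of "Suc m" n "mv i m"] Suc unfolding swpt_mv_up by simp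
  from tri_comp[OF _ this l] Suc
  have "tri n (\<lambda>F. sop (Suc m) (comp_ops (map sop (rev [1..<m + 1])) F)) (mv i 0) (mv i (Suc m)) (\<lambda>_. 1 :: 'a)"
    by fastforce
  moreover have "[1..<Suc m + 1] = [1..<m + 1] @ [Suc m]" by (simp add: One_nat_def)
  ultimately show ?case by (simp add: comp_ops_def flip: Suc_eq_plus1)
qed

lemma tri_Ts:
  assumes "i \<le> m" "m \<le> n - 1"
  shows "tri n (comp_ops (map T [m + 1..<n])) (mv i (n - 1)) (mv i m)
    (\<lambda>\<mu>. \<Prod>p\<in>{m + 1..<n}. if \<mu> ! p \<le> \<mu> ! i then t else 1)"
  using assms(2,1)
proof (induction rule: inc_induct)
  case base
  show ?case using n_pos by (simp add: tri_def)
next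
  case (step m)
  have "tri n (T (Suc m)) (mv i (Suc m)) (swpt (Suc m) (mv i (Suc m)))
      (\<lambda>\<mu>. if \<mu> ! mv i (Suc m) (Suc m - 1) \<le> \<mu> ! mv i (Suc m) (Suc m) then t else 1)"
    by (rule tri_T) (use step assms in \<open>auto intro!: perm_on_mv simp: mv_def\<close>)
  then have "tri n (T (Suc m)) (mv i (Suc m)) (mv i m) (\<lambda>\<mu>. if \<mu> ! Suc m \<le> \<mu> ! i then t else 1)"
    unfolding swpt_mv_down using step.hyps step.prems by (simp add: mv_def flip: Suc_eq_plus1)
  from tri_comp[OF step.IH this linop_Ts]
  have "tri n (\<lambda>F. T (Suc m) (comp_ops (map T [Suc m + 1..<n]) F)) (mv i (n - 1)) (mv i m)
    (\<lambda>\<mu>. (if \<mu> ! Suc m \<le> \<mu> ! i then t else 1) * (\<Prod>p\<in>{Suc m + 1..<n}. if \<mu> ! p \<le> \<mu> ! i then t else 1))"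
    using step by auto
  moreover have "[m + 1..<n] = Suc m # [Suc m + 1..<n]" using step by (simp add: upt_conv_Cons)
  moreover have "{m + 1..<n} = insert (Suc m) {Suc m + 1..<n}" using step by auto
  ultimately show ?case by (simp add: comp_ops_def)
qed

text \<open>The joint eigenvalue \<open>eigval\<close> in a form that makes sense for the integer
  exponents among which a leading one is sought.\<close>

definition lead :: "nat \<Rightarrow> int list \<Rightarrow> 'a" where
  "lead i \<mu> = q powi (\<mu> ! (i - 1)) * t powi (- int (card {m. m < i - 1 \<and> \<mu> ! (i - 1) \<le> \<mu> ! m}
     + card {m. i - 1 < m \<and> m < n \<and> \<mu> ! (i - 1) < \<mu> ! m}))"

lemma prod_if_power:
  assumes "finite A"
  shows "(\<Prod>p\<in>A. if P p then c else 1) = (c :: 'a) ^ card {p\<in>A. P p}"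
  using assms by (simp add: prod.If_cases Int_def)

lemma lead_eq:
  assumes i: "i < n"
  shows "t powi (int (i + 1) - int n) * ((\<Prod>p\<in>{i + 1..<n}. if \<mu> ! p \<le> \<mu> ! i then t else 1) *
    (q powi (\<mu> ! i) * (\<Prod>p\<in>{0..<i}. if \<mu> ! i \<le> \<mu> ! p then inverse t else 1))) = lead (i + 1) \<mu>"
proof -
  let ?A = "{p\<in>{i + 1..<n}. \<mu> ! p \<le> \<mu> ! i}" and ?B = "{p\<in>{i + 1..<n}. \<not> \<mu> ! p \<le> \<mu> ! i}"
  \<comment> \<open>Counting the complement converts the later entries that are at most
    \<open>\<mu> ! i\<close> into those that exceed it; this absorbs the prefactor of
    \<open>Y\<close>.\<close>
  have "card ?A + card ?B = card {i + 1..<n}"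
    by (subst card_Un_disjoint[symmetric]) (auto simp del: card_atLeastLessThan intro!: arg_cong[where f = card])
  then have A: "int (card ?A) = int n - int (i + 1) - int (card ?B)" using i by auto
  have B: "?B = {m. i < m \<and> m < n \<and> \<mu> ! i < \<mu> ! m}" by auto
  have C: "{p\<in>{0..<i}. \<mu> ! i \<le> \<mu> ! p} = {m. m < i \<and> \<mu> ! i \<le> \<mu> ! m}" by auto
  have "t powi (int (i + 1) - int n) * t ^ card ?A * inverse t ^ card {p\<in>{0..<i}. \<mu> ! i \<le> \<mu> ! p}
    = t powi (int (i + 1) - int n) * t powi int (card ?A) * t powi (- int (card {p\<in>{0..<i}. \<mu> ! i \<le> \<mu> ! p}))"
    by (simp only: power_int_minus power_int_of_nat power_inverse)
  also have "\<dots> = t powi (int (i + 1) - int n + int (card ?A) - int (card {p\<in>{0..<i}. \<mu> ! i \<le> \<mu> ! p}))"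
    using t_nz by (simp only: power_int_add[symmetric] simp_thms) simp
  also have "int (i + 1) - int n + int (card ?A) - int (card {p\<in>{0..<i}. \<mu> ! i \<le> \<mu> ! p})
    = - int (card {m. m < i \<and> \<mu> ! i \<le> \<mu> ! m} + card {m. i < m \<and> m < n \<and> \<mu> ! i < \<mu> ! m})"
    unfolding A B C by simp
  finally have *: "t powi (int (i + 1) - int n) * t ^ card ?A * inverse t ^ card {p\<in>{0..<i}. \<mu> ! i \<le> \<mu> ! p}
    = t powi (- int (card {m. m < i \<and> \<mu> ! i \<le> \<mu> ! m} + card {m. i < m \<and> m < n \<and> \<mu> ! i < \<mu> ! m}))" .
  show ?thesis
    unfolding lead_def prod_if_power[OF finite_atLeastLessThan] add_diff_cancel_right'
    unfolding *[symmetric] by (simp only: mult_ac)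
qed

text \<open>The entry at position i is followed through the factors of Y_i: the inverses carry it to
  the front, \<open>tauop\<close> contributes its power of \<open>q\<close>, the transpositions
  carry it to the end and the remaining generators back to i. The net relabelling is the identity,
  and the diagonal entries multiply to \<open>lead\<close>.\<close>

lemma Y_leading:
  assumes F: "laurent n F" and mu: "length \<mu> = n" and v: "\<And>\<nu>. sbelow \<mu> \<nu> \<Longrightarrow> F \<nu> = 0"
    and i: "1 \<le> i" "i \<le> n"
  shows "Y i F \<mu> = lead i \<mu> * F \<mu>"
proof -
  obtain j where j: "i = j + 1" "j < n" using i by (metis Suc_eq_plus1 Suc_le_D Suc_le_eq One_nat_def)
  let ?d1 = "\<lambda>\<mu>. \<Prod>p\<in>{0..<j}. if \<mu> ! j \<le> \<mu> ! p then inverse t else 1"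
  let ?d2 = "\<lambda>\<mu>. q powi (\<mu> ! j)"
  let ?d4 = "\<lambda>\<mu>. \<Prod>p\<in>{j + 1..<n}. if \<mu> ! p \<le> \<mu> ! j then t else 1"
  let ?V = "comp_ops (map Ti [1..<j + 1])" and ?W = "comp_ops (map T [j + 1..<n])"
  have V: "tri n ?V (mv j j) (mv j 0) ?d1" using tri_Tis[of 0 j] j by simp
  have tau: "tri n (tauop q 1) (mv j 0) (mv j 0) ?d2"
    using tri_tauop[OF n_pos, of q "mv j 0"] by (simp add: mv_def)
  have S: "tri n (comp_ops (map sop (rev [1..<n]))) (mv j 0) (mv j (n - 1)) (\<lambda>_. 1 :: 'a)"
    using tri_sops[of "n - 1" j] n_pos by simp
  have "tri n (\<lambda>F. comp_ops (map sop (rev [1..<n])) (tauop q 1 F)) (mv j 0) (mv j (n - 1)) (\<lambda>\<mu>. 1 * ?d2 \<mu>)"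
    by (rule tri_comp[OF tau S linop_tauop])
  moreover have "om = (\<lambda>F. comp_ops (map sop (rev [1..<n])) (tauop q 1 F))"
    by (rule ext) (simp add: omega_def)
  ultimately have om: "tri n om (mv j 0) (mv j (n - 1)) ?d2" by simp
  have W: "tri n ?W (mv j (n - 1)) (mv j j) ?d4" using tri_Ts[of j j] j by simp
  have lV: "linop n ?V" by (rule linop_Tis) (use j in auto)
  have "tri n (\<lambda>F. om (?V F)) (mv j j) (mv j (n - 1)) (\<lambda>\<mu>. ?d2 \<mu> * ?d1 \<mu>)"
    by (rule tri_comp[OF V om lV])
  from tri_comp[OF this W linop_comp[OF linop_omega lV]]
  have "tri n (\<lambda>F. ?W (om (?V F))) (mv j j) (mv j j) (\<lambda>\<mu>. ?d4 \<mu> * (?d2 \<mu> * ?d1 \<mu>))" .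
  then have "?W (om (?V F)) \<mu> = ?d4 \<mu> * (?d2 \<mu> * ?d1 \<mu>) * F \<mu>"
    using F mu v unfolding tri_def mv_id pm_id by blast
  then have "Y i F \<mu> = t powi (int (j + 1) - int n) * (?d4 \<mu> * (?d2 \<mu> * ?d1 \<mu>)) * F \<mu>"
    unfolding Y_eq j(1) by (simp only: mult.assoc)
  then show ?thesis unfolding lead_eq[OF j(2)] j(1) .
qed

end

section \<open>Nonsymmetric Macdonald polynomials\<close>

lemma int_partsum: "p \<le> length L \<Longrightarrow> int (partsum L p) = (\<Sum>i<p. int (L ! i))"
  unfolding partsum_def by (simp add: sum_list_sum_nth atLeast0LessThan)

lemma excess_map_int: "excess c (map int L) = (\<Sum>i<length L. max (int (L ! i) - c) 0)"
  by (simp add: excess_def)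

text \<open>With \<open>partsum_eq_excess\<close>, the p-th partial sum of a decreasing list is the
  minimum over c of p c plus the excess at c, attained at the p-th entry. This is the bridge between
  thresholds and dominance.\<close>

lemma partsum_le_excess:
  assumes "p \<le> length L"
  shows "int (partsum L p) \<le> int p * c + excess c (map int L)"
proof -
  have "int (partsum L p) \<le> (\<Sum>i<p. c + max (int (L ! i) - c) 0)"
    unfolding int_partsum[OF assms] by (rule sum_mono) auto
  also have "\<dots> = int p * c + (\<Sum>i<p. max (int (L ! i) - c) 0)" by (simp add: sum.distrib)
  also have "(\<Sum>i<p. max (int (L ! i) - c) 0) \<le> excess c (map int L)"
    unfolding excess_map_int by (rule sum_mono2) (use assms in auto)
  finally show ?thesis by simp
qed

lemma partsum_eq_excess:
  assumes "sorted_wrt (\<ge>) L" "1 \<le> p" "p \<le> length L"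
  shows "int (partsum L p) = int p * int (L ! (p - 1)) + excess (int (L ! (p - 1))) (map int L)"
proof -
  let ?c = "int (L ! (p - 1))"
  have ge: "L ! i \<ge> L ! (p - 1)" if "i < p" for i
    using sorted_wrt_nth_less[OF assms(1), of i "p - 1"] assms that by (cases "i = p - 1") auto
  have le: "L ! i \<le> L ! (p - 1)" if "p \<le> i" "i < length L" for i
    using sorted_wrt_nth_less[OF assms(1), of "p - 1" i] assms that by auto
  have "excess ?c (map int L) = (\<Sum>i<p. max (int (L ! i) - ?c) 0)"
    unfolding excess_map_int
    by (rule sum.mono_neutral_right) (use assms le in \<open>auto simp: not_less\<close>)
  also have "\<dots> = (\<Sum>i<p. int (L ! i) - ?c)" by (rule sum.cong) (use ge in auto)
  also have "\<dots> = int (partsum L p) - int p * ?c"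
    by (simp add: sum_subtractf int_partsum[OF assms(3)])
  finally show ?thesis by simp
qed

lemma excess_perm:
  assumes "mset L = mset M"
  shows "excess c (map int L) = excess c (map int M)"
proof -
  have "excess c (map int L) = sum_mset (image_mset (\<lambda>x. max (int x - c) 0) (mset L))" for L
  proof -
    have "excess c (map int L) = sum_list (map (\<lambda>x. max (int x - c) 0) L)"
      unfolding excess_map_int by (simp add: sum_list_sum_nth atLeast0LessThan)
    then show ?thesis by (simp only: mset_map[symmetric] sum_mset_sum_list)
  qed
  then show ?thesis using assms by simp
qed

text \<open>If the sorted forms agree, all excesses agree and the comparison of partial sums
  remains; otherwise the thresholds at the entries of the sorted \<eta> give dominance.\<close>

lemma below_mac_prec:
  assumes len: "length \<nu> = length \<eta>" and b: "below (map int \<nu>) (map int \<eta>)"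
  shows "\<nu> = \<eta> \<or> mac_prec \<nu> \<eta>"
proof (cases "plus_part \<nu> = plus_part \<eta>")
  case True
  then have "mset \<nu> = mset \<eta>" unfolding plus_part_def by (metis mset_rev mset_sort)
  then have "excess c (map int \<nu>) = excess c (map int \<eta>)" for c by (rule excess_perm)
  then have ps: "psum (map int \<nu>) p \<le> psum (map int \<eta>) p" if "p \<le> length \<nu>" for p
    using b that by (auto simp: below_def)
  have "partsum \<nu> p \<le> partsum \<eta> p" if "p \<le> length \<nu>" for p
  proof -
    have "int (partsum \<nu> p) = psum (map int \<nu>) p" "int (partsum \<eta> p) = psum (map int \<eta>) p"
      unfolding psum_def using that len by (auto simp: int_partsum intro!: sum.cong)
    then show ?thesis using ps[OF that] by simp
  qed
  then show ?thesis using True len by (auto simp: mac_prec_def dom_le_def)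
next
  case False
  have desc: "sorted_wrt (\<ge>) (plus_part \<eta>)"
    unfolding plus_part_def sorted_wrt_rev by simp
  have lens: "length (plus_part \<nu>) = length \<eta>" "length (plus_part \<eta>) = length \<eta>"
    using len by (simp_all add: plus_part_def)
  have ex: "excess c (map int (plus_part \<zeta>)) = excess c (map int \<zeta>)" for c \<zeta>
    by (rule excess_perm) (simp add: plus_part_def)
  have "partsum (plus_part \<nu>) p \<le> partsum (plus_part \<eta>) p" if "1 \<le> p" "p \<le> length \<eta>" for p
  proof -
    let ?c = "int (plus_part \<eta> ! (p - 1))"
    have "int (partsum (plus_part \<nu>) p) \<le> int p * ?c + excess ?c (map int (plus_part \<nu>))"
      by (rule partsum_le_excess) (use that lens in simp)
    also have "\<dots> \<le> int p * ?c + excess ?c (map int (plus_part \<eta>))"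
      unfolding ex using b by (auto simp: below_def)
    also have "\<dots> = int (partsum (plus_part \<eta>) p)"
      by (rule partsum_eq_excess[symmetric, OF desc]) (use that lens in auto)
    finally show ?thesis by simp
  qed
  then show ?thesis using False lens by (auto simp: mac_prec_def dom_le_def)
qed

text \<open>At threshold 0 the excess is the sum of the positive entries. A negative entry would
  push it above the total, which is the excess of \<eta>. So eigenfunctions turn out to be
  polynomials.\<close>

lemma below_nonneg:
  assumes "below a (map int \<eta>)" "i < length a"
  shows "0 \<le> a ! i"
proof (rule ccontr)
  assume neg: "\<not> 0 \<le> a ! i"
  have "(\<Sum>i<length a. a ! i) < (\<Sum>i<length a. max (a ! i - 0) 0)"
    by (rule sum_strict_mono_ex1) (use neg assms in \<open>auto intro!: bexI[of _ i]\<close>)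
  also have "\<dots> \<le> excess 0 (map int \<eta>)" using assms unfolding excess_def[of 0 a, symmetric] below_def by blast
  also have "\<dots> = (\<Sum>i<length \<eta>. int (\<eta> ! i))" by (simp add: excess_map_int)
  also have "\<dots> = psum (map int \<eta>) (length (map int \<eta>))" by (simp add: psum_def)
  also have "\<dots> = psum a (length a)" using assms(1) by (auto simp: below_def)
  also have "\<dots> = (\<Sum>i<length a. a ! i)" by (simp add: psum_def)
  finally show False by simp
qed

text \<open>The number l' of the English statement and minus the exponent of t in the eigenvalue.
  One set with a disjunction, rather than two cardinalities, can be moved by a single bijection of
  positions.\<close>

definition level :: "nat list \<Rightarrow> nat \<Rightarrow> nat" where
  "level \<eta> k = card {m. m < length \<eta> \<and> (m < k \<and> \<eta> ! k \<le> \<eta> ! m \<or> k < m \<and> \<eta> ! k < \<eta> ! m)}"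

lemma level_split:
  assumes "k < length \<eta>"
  shows "level \<eta> k = card {m. m < k \<and> \<eta> ! k \<le> \<eta> ! m} + card {m. k < m \<and> m < length \<eta> \<and> \<eta> ! k < \<eta> ! m}"
  unfolding level_def
  by (subst card_Un_disjoint[symmetric]) (use assms in \<open>auto intro!: arg_cong[where f = card]\<close>)

lemma eigval_level:
  "1 \<le> i \<Longrightarrow> i \<le> length \<eta> \<Longrightarrow> eigval q t \<eta> i = q ^ (\<eta> ! (i - 1)) * t powi (- int (level \<eta> (i - 1)))"
  by (simp add: eigval_def Let_def level_split)

section \<open>Exchange and rotation of the parts of a composition\<close>

definition nswp :: "nat \<Rightarrow> nat list \<Rightarrow> nat list" where
  "nswp i \<eta> = \<eta>[i - 1 := \<eta> ! i, i := \<eta> ! (i - 1)]"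

lemma length_nswp [simp]: "length (nswp i \<eta>) = length \<eta>"
  by (simp add: nswp_def)

lemma map_int_nswp: "1 \<le> i \<Longrightarrow> i < length \<eta> \<Longrightarrow> map int (nswp i \<eta>) = swp i (map int \<eta>)"
  by (simp add: nswp_def swp_def map_update)

lemma nswp_nswp: "1 \<le> i \<Longrightarrow> i < length \<eta> \<Longrightarrow> nswp i (nswp i \<eta>) = \<eta>"
  by (auto simp: nswp_def nth_list_update list_eq_iff_nth_eq)

definition tr :: "nat \<Rightarrow> nat \<Rightarrow> nat" where
  "tr i k = (if k = i - 1 then i else if k = i then i - 1 else k)"

lemma tr_tr: "tr i (tr i k) = k"
  by (auto simp: tr_def)

lemma tr_less: "1 \<le> i \<Longrightarrow> i < n \<Longrightarrow> tr i k < n \<longleftrightarrow> k < n"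
  by (auto simp: tr_def)

lemma nth_nswp: "1 \<le> i \<Longrightarrow> i < length \<eta> \<Longrightarrow> k < length \<eta> \<Longrightarrow> nswp i \<eta> ! k = \<eta> ! tr i k"
  by (auto simp: nswp_def tr_def nth_list_update)

lemma level_nswp:
  assumes i: "1 \<le> i" "i < length \<eta>" and ne: "\<eta> ! (i - 1) \<noteq> \<eta> ! i" and k: "k < length \<eta>"
  shows "level (nswp i \<eta>) k = level \<eta> (tr i k)"
proof -
  let ?n = "length \<eta>"
  let ?A = "{m. m < ?n \<and> (m < k \<and> nswp i \<eta> ! k \<le> nswp i \<eta> ! m \<or> k < m \<and> nswp i \<eta> ! k < nswp i \<eta> ! m)}"
  let ?B = "{m. m < ?n \<and> (m < tr i k \<and> \<eta> ! tr i k \<le> \<eta> ! m \<or> tr i k < m \<and> \<eta> ! tr i k < \<eta> ! m)}"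
  have eq: "m \<in> ?A \<longleftrightarrow> tr i m \<in> ?B" for m
  proof (cases "m < ?n")
    case True
    \<comment> \<open>Only the pair of exchanged positions changes its relative order; there weak
      and strict comparison agree since the entries differ.\<close>
    have *: "m < k \<and> \<eta> ! tr i k \<le> \<eta> ! tr i m \<or> k < m \<and> \<eta> ! tr i k < \<eta> ! tr i m \<longleftrightarrow>
      tr i m < tr i k \<and> \<eta> ! tr i k \<le> \<eta> ! tr i m \<or> tr i k < tr i m \<and> \<eta> ! tr i k < \<eta> ! tr i m"
    proof (cases "(m = i - 1 \<or> m = i) \<and> (k = i - 1 \<or> k = i)")
      case True
      then show ?thesis using i ne by (auto simp: tr_def)
    next
      case False
      then have "tr i m < tr i k \<longleftrightarrow> m < k" "tr i k < tr i m \<longleftrightarrow> k < m"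
        using i by (auto simp: tr_def split: if_splits)
      then show ?thesis by simp
    qed
    show ?thesis using True i k * by (simp add: nth_nswp tr_less)
  qed (use i tr_less in auto)
  have "card ?A = card ?B"
  proof (rule bij_betw_same_card[of "tr i"], rule bij_betw_byWitness[where f' = "tr i"])
    show "tr i ` ?A \<subseteq> ?B" using eq by blast
    show "tr i ` ?B \<subseteq> ?A"
    proof
      fix x assume "x \<in> tr i ` ?B"
      then obtain m where m: "m \<in> ?B" "x = tr i m" by blast
      then have "tr i x \<in> ?B" unfolding m(2) tr_tr by blast
      then show "x \<in> ?A" unfolding eq .
    qed
  qed (simp_all add: tr_tr)
  then show ?thesis by (simp add: level_def)
qed

definition nphi :: "nat list \<Rightarrow> nat list" where
  "nphi \<eta> = tl \<eta> @ [Suc (hd \<eta>)]"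

lemma length_nphi [simp]: "\<eta> \<noteq> [] \<Longrightarrow> length (nphi \<eta>) = length \<eta>"
  by (simp add: nphi_def Suc_diff_1)

lemma nth_nphi:
  assumes "k < length \<eta>"
  shows "nphi \<eta> ! k = (if Suc k = length \<eta> then Suc (\<eta> ! 0) else \<eta> ! Suc k)"
  using assms by (cases \<eta>) (auto simp: nphi_def nth_append)

text \<open>The rotated entry passes from before all others to after them, which exchanges weak and
  strict comparison; the added 1 compensates exactly.\<close>

lemma level_nphi:
  assumes ne: "\<eta> \<noteq> []" and k: "k < length \<eta>"
  shows "level (nphi \<eta>) k = (if Suc k = length \<eta> then level \<eta> 0 else level \<eta> (Suc k))"
proof -
  let ?n = "length \<eta>"
  define r where "r m = (if Suc m = ?n then 0 else Suc m)" for m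
  define r' where "r' m = (if m = 0 then ?n - 1 else m - 1)" for m
  have n0: "0 < ?n" using ne by simp
  let ?A = "{m. m < ?n \<and> (m < k \<and> nphi \<eta> ! k \<le> nphi \<eta> ! m \<or> k < m \<and> nphi \<eta> ! k < nphi \<eta> ! m)}"
  let ?B = "{m. m < ?n \<and> (m < r k \<and> \<eta> ! r k \<le> \<eta> ! m \<or> r k < m \<and> \<eta> ! r k < \<eta> ! m)}"
  have "card ?A = card ?B"
  proof (rule bij_betw_same_card[of r], rule bij_betw_byWitness[where f' = r'])
    show "\<forall>m\<in>?A. r' (r m) = m" "\<forall>m\<in>?B. r (r' m) = m" using n0 by (auto simp: r_def r'_def)
    show "r ` ?A \<subseteq> ?B" using k by (auto simp: r_def nth_nphi split: if_splits)
    show "r' ` ?B \<subseteq> ?A"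
    proof
      fix x assume "x \<in> r' ` ?B"
      then obtain m where m: "m \<in> ?B" "x = r' m" by auto
      show "x \<in> ?A"
      proof (cases m)
        case 0
        then show ?thesis using m k n0 by (auto simp: r_def r'_def nth_nphi split: if_splits)
      next
        case (Suc j)
        then show ?thesis using m k n0 by (auto simp: r_def r'_def nth_nphi split: if_splits)
      qed
    qed
  qed
  then show ?thesis using ne by (simp add: level_def r_def)
qed

section \<open>Spectrum, supports and uniqueness\<close>

context macdonald
begin

lemma lead_map_int:
  assumes "length \<eta> = n" "1 \<le> i" "i \<le> n"
  shows "lead i (map int \<eta>) = eigval q t \<eta> i"
proof -
  have "{m. m < i - 1 \<and> map int \<eta> ! (i - 1) \<le> map int \<eta> ! m} = {m. m < i - 1 \<and> \<eta> ! (i - 1) \<le> \<eta> ! m}"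
    "{m. i - 1 < m \<and> m < n \<and> map int \<eta> ! (i - 1) < map int \<eta> ! m} = {m. i - 1 < m \<and> m < n \<and> \<eta> ! (i - 1) < \<eta> ! m}"
    using assms by auto
  then show ?thesis unfolding lead_def using assms by (simp add: eigval_level level_split)
qed

lemma qt_cancel:
  assumes "q powi a * t powi b = q powi c * t powi d"
  shows "a = c \<and> b = d"
proof -
  have "q powi (a - c) * t powi (b - d) = (q powi a * t powi b) / (q powi c * t powi d)"
    using t_nz by (simp add: power_int_diff)
  also have "\<dots> = 1" unfolding assms using t_nz by (simp add: power_int_eq_0_iff)
  finally show ?thesis using independent by fastforce
qed

text \<open>Each entry is read off from the power of \<open>q\<close> alone.\<close>

lemma lead_inj:
  assumes "length \<mu> = n" "length \<nu> = n" "\<And>i. 1 \<le> i \<Longrightarrow> i \<le> n \<Longrightarrow> lead i \<mu> = lead i \<nu>"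
  shows "\<mu> = \<nu>"
proof (rule nth_equalityI)
  fix k assume "k < length \<mu>"
  then have "lead (Suc k) \<mu> = lead (Suc k) \<nu>" using assms by simp
  then show "\<mu> ! k = \<nu> ! k" unfolding lead_def using qt_cancel by fastforce
qed (use assms in simp)

text \<open>The maximum is taken above a prescribed \<open>a\<close> of the support. Once the
  eigenvalues identify \<mu>, independently of \<open>a\<close>, this bounds the whole
  support.\<close>

lemma joint_eigen_max:
  assumes F: "laurent n F" "F a \<noteq> 0" and Y: "\<And>i. 1 \<le> i \<Longrightarrow> i \<le> n \<Longrightarrow> Y i F = (\<lambda>a. y i * F a)"
  shows "\<exists>\<mu>. F \<mu> \<noteq> 0 \<and> below a \<mu> \<and> (\<forall>i. 1 \<le> i \<longrightarrow> i \<le> n \<longrightarrow> y i = lead i \<mu>)"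
proof -
  let ?S = "{\<mu>. F \<mu> \<noteq> 0 \<and> below a \<mu>}"
  have "finite ?S" using laurent_finite[OF F(1)] by (rule rev_finite_subset) auto
  moreover have "?S \<noteq> {}" using F(2) below_refl by auto
  moreover have "asymp_on ?S sbelow"
    by (rule asymp_onI) (auto simp: sbelow_def dest: below_antisym)
  moreover have "transp_on ?S sbelow" by (rule transp_onI) (auto intro: sbelow_trans)
  ultimately obtain \<mu> where mu: "\<mu> \<in> ?S" "\<forall>\<nu>\<in>?S. \<nu> \<noteq> \<mu> \<longrightarrow> \<not> sbelow \<mu> \<nu>"
    using Finite_Set.bex_max_element[of ?S sbelow] by blast
  have v: "F \<nu> = 0" if "sbelow \<mu> \<nu>" for \<nu>
  proof (rule ccontr)
    assume "F \<nu> \<noteq> 0"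
    moreover have "below a \<nu>" using mu(1) that below_trans by (auto simp: sbelow_def)
    ultimately show False using mu(2) that by (auto simp: sbelow_def)
  qed
  have len: "length \<mu> = n" using F(1) mu(1) laurent_length by blast
  have "y i = lead i \<mu>" if "1 \<le> i" "i \<le> n" for i
  proof -
    have "y i * F \<mu> = Y i F \<mu>" using Y[OF that] by simp
    also have "\<dots> = lead i \<mu> * F \<mu>" by (rule Y_leading[OF F(1) len v that])
    finally show ?thesis using mu(1) by simp
  qed
  then show ?thesis using mu(1) by blast
qed

definition eigfun :: "nat list \<Rightarrow> 'a lpoly \<Rightarrow> bool" where
  "eigfun \<eta> F \<longleftrightarrow> laurent n F \<and> (\<forall>i. 1 \<le> i \<longrightarrow> i \<le> n \<longrightarrow> Y i F = (\<lambda>a. eigval q t \<eta> i * F a))"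

lemma eigfun_support:
  assumes "eigfun \<eta> F" "length \<eta> = n" "F a \<noteq> 0"
  shows "below a (map int \<eta>)" "F (map int \<eta>) \<noteq> 0"
proof -
  obtain \<mu> where mu: "F \<mu> \<noteq> 0" "below a \<mu>" "\<forall>i. 1 \<le> i \<longrightarrow> i \<le> n \<longrightarrow> eigval q t \<eta> i = lead i \<mu>"
    using joint_eigen_max[of F a "eigval q t \<eta>"] assms unfolding eigfun_def by blast
  have "length \<mu> = n" using assms(1) mu(1) laurent_length unfolding eigfun_def by blast
  then have "\<mu> = map int \<eta>"
    by (rule lead_inj) (use mu assms in \<open>auto simp: lead_map_int\<close>)
  then show "below a (map int \<eta>)" "F (map int \<eta>) \<noteq> 0" using mu by auto
qed

lemma eigfun_comb:
  assumes "eigfun \<eta> F" "eigfun \<eta> G"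
  shows "eigfun \<eta> (\<lambda>a. c * F a + d * G a)"
proof -
  have l: "laurent n F" "laurent n G" using assms by (auto simp: eigfun_def)
  have "Y i (\<lambda>a. c * F a + d * G a) = (\<lambda>a. eigval q t \<eta> i * (c * F a + d * G a))" if "1 \<le> i" "i \<le> n" for i
    using linop_comb[OF linop_Y[OF that] l, of c d] assms that by (simp add: eigfun_def algebra_simps)
  then show ?thesis using laurent_comb[OF l] by (simp add: eigfun_def)
qed

abbreviation "E \<equiv> Emac n q t"

lemma eigfun_unique:
  assumes "eigfun \<eta> F" "eigfun \<eta> G" "length \<eta> = n" "F (map int \<eta>) = G (map int \<eta>)"
  shows "F = G"
proof (rule ccontr)
  assume "F \<noteq> G"
  then obtain a where "1 * F a + (- 1) * G a \<noteq> 0" by auto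
  then have "1 * F (map int \<eta>) + (- 1) * G (map int \<eta>) \<noteq> 0"
    using eigfun_support(2)[OF eigfun_comb[OF assms(1,2), of 1 "-1"] assms(3)] by blast
  then show False using assms(4) by simp
qed

text \<open>One nonzero eigenfunction, scaled to 1 at \<eta>, satisfies the whole description, and
  by \<open>eigfun_unique\<close> nothing else does; only then does \<open>THE\<close> denote
  it.\<close>

lemma Emac_of_eigfun:
  assumes F: "eigfun \<eta> F" "F a0 \<noteq> 0" and len: "length \<eta> = n"
  shows "eigfun \<eta> (E \<eta>) \<and> E \<eta> (map int \<eta>) = 1"
proof -
  let ?P = "\<lambda>E. laurent n E \<and> E (map int \<eta>) = 1 \<and>
      (\<forall>a. E a \<noteq> 0 \<longrightarrow> (\<exists>\<nu>. length \<nu> = n \<and> a = map int \<nu> \<and> (\<nu> = \<eta> \<or> mac_prec \<nu> \<eta>))) \<and>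
      (\<forall>i\<in>{1..n}. Y i E = (\<lambda>a. eigval q t \<eta> i * E a))"
  have eigP: "eigfun \<eta> G \<and> G (map int \<eta>) = 1" if "?P G" for G using that by (auto simp: eigfun_def)
  define G where "G = (\<lambda>a. inverse (F (map int \<eta>)) * F a + 0 * F a)"
  have nz: "F (map int \<eta>) \<noteq> 0" using eigfun_support(2)[OF F(1) len F(2)] .
  have G: "eigfun \<eta> G" unfolding G_def by (rule eigfun_comb[OF F(1) F(1)])
  have G1: "G (map int \<eta>) = 1" using nz by (simp add: G_def)
  have "\<exists>\<nu>. length \<nu> = n \<and> a = map int \<nu> \<and> (\<nu> = \<eta> \<or> mac_prec \<nu> \<eta>)" if "G a \<noteq> 0" for a
  proof -
    have b: "below a (map int \<eta>)" using eigfun_support(1)[OF G len that] .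
    then have la: "length a = n" using len by (simp add: below_def)
    have a: "a = map int (map nat a)"
      using below_nonneg[OF b] by (intro nth_equalityI) auto
    then have "below (map int (map nat a)) (map int \<eta>)" using b by simp
    then have "map nat a = \<eta> \<or> mac_prec (map nat a) \<eta>" using la len by (intro below_mac_prec) auto
    then show ?thesis using a la by (metis length_map)
  qed
  then have PG: "?P G" using G G1 by (auto simp: eigfun_def)
  have "H = G" if "?P H" for H
    using eigfun_unique[of \<eta> H G] eigP[OF that] G G1 len by simp
  then have "?P (E \<eta>)" unfolding Emac_def by (rule theI[of ?P, OF PG])
  then show ?thesis by (rule eigP)
qed

section \<open>Existence by raising and intertwining\<close>

definition one_lp :: "'a lpoly" where
  "one_lp a = (if a = replicate n 0 then 1 else 0)"

lemma laurent_one: "laurent n one_lp"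
  by (auto simp: laurent_def one_lp_def)

lemma ev_one: "ev one_lp x = 1"
proof -
  have "{a. one_lp a \<noteq> 0} = {replicate n 0}" by (auto simp: one_lp_def)
  then show ?thesis by (simp add: ev_def one_lp_def mon_def)
qed

lemma T_one: "1 \<le> i \<Longrightarrow> i < n \<Longrightarrow> T i one_lp = (\<lambda>a. t * one_lp a)"
proof (rule laurent_eqI[OF infinite_field, where n = n])
  assume i: "1 \<le> i" "i < n"
  show "laurent n (T i one_lp)" "laurent n (\<lambda>a. t * one_lp a)"
    using i laurent_one by (auto intro: laurent_T laurent_scale)
  fix x :: "nat \<Rightarrow> 'a" assume x: "generic_pt n x"
  have ne: "x (i - 1) \<noteq> x i" using generic_ptD(2)[OF x, of "i - 1" i] i by auto
  have "hecke_a t (x (i - 1)) (x i) + hecke_b t (x (i - 1)) (x i) = t"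
    using ne unfolding hecke_a_def hecke_b_def by (simp add: divide_simps) (simp add: algebra_simps)
  then show "ev (T i one_lp) x = ev (\<lambda>a. t * one_lp a) x"
    using x i by (simp add: ev_T_generic laurent_one ev_scale[OF laurent_one] ev_one)
qed

lemma Ti_one: "1 \<le> i \<Longrightarrow> i < n \<Longrightarrow> Ti i one_lp = (\<lambda>a. inverse t * one_lp a)"
  by (simp add: Tinv_def T_one fun_eq_iff left_diff_distrib)

lemma omega_one: "om one_lp = one_lp"
  by (rule laurent_eqI[OF infinite_field, where n = n])
    (auto intro: laurent_omega laurent_one simp: ev_omega[OF laurent_one] ev_one)

lemma eigfun_one: "eigfun (replicate n 0) one_lp"
proof -
  have scal: "comp_ops (map A ks) one_lp = (\<lambda>a. c ^ length ks * one_lp a)"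
    if "\<And>k. k \<in> set ks \<Longrightarrow> linop n (A k)" "\<And>k. k \<in> set ks \<Longrightarrow> A k one_lp = (\<lambda>a. c * one_lp a)"
    for A :: "nat \<Rightarrow> 'a lop" and ks c
    using that
  proof (induction ks)
    case (Cons k ks)
    have "comp_ops (map A (k # ks)) one_lp = A k (\<lambda>a. c ^ length ks * one_lp a)" using Cons by simp
    also have "\<dots> = (\<lambda>a. c ^ length ks * A k one_lp a)"
      by (rule linop_scale[OF _ laurent_one]) (use Cons in auto)
    finally show ?case using Cons by (simp add: mult_ac)
  qed simp
  have "Y i one_lp = (\<lambda>a. eigval q t (replicate n 0) i * one_lp a)" if i: "1 \<le> i" "i \<le> n" for i
  proof -
    have "comp_ops (map Ti [1..<i]) one_lp = (\<lambda>a. inverse t ^ (i - 1) * one_lp a)"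
      using scal[of "[1..<i]" Ti "inverse t"] i by (simp add: linop_Ti Ti_one)
    moreover have "om (\<lambda>a. inverse t ^ (i - 1) * one_lp a) = (\<lambda>a. inverse t ^ (i - 1) * one_lp a)"
      using linop_scale[OF linop_omega laurent_one] by (simp add: omega_one)
    moreover have "comp_ops (map T [i..<n]) (\<lambda>a. inverse t ^ (i - 1) * one_lp a)
      = (\<lambda>a. inverse t ^ (i - 1) * comp_ops (map T [i..<n]) one_lp a)"
      by (rule linop_scale[OF linop_Ts laurent_one]) (use i in auto)
    moreover have "comp_ops (map T [i..<n]) one_lp = (\<lambda>a. t ^ (n - i) * one_lp a)"
      using scal[of "[i..<n]" T t] i by (simp add: linop_T T_one)
    ultimately have "Y i one_lp = (\<lambda>a. t powi (int i - int n) * t ^ (n - i) * (inverse t ^ (i - 1) * one_lp a))"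
      unfolding Y_eq by (simp add: mult_ac)
    moreover have "eigval q t (replicate n 0) i = t powi (- int (i - 1))"
    proof -
      have "{m. m < n \<and> (m < i - 1 \<and> replicate n (0::nat) ! (i - 1) \<le> replicate n 0 ! m
        \<or> i - 1 < m \<and> replicate n (0::nat) ! (i - 1) < replicate n 0 ! m)} = {..<i - 1}" using i by auto
      then show ?thesis using i by (simp add: eigval_level level_def)
    qed
    moreover have "t powi (int i - int n) * t ^ (n - i) = 1"
    proof -
      have "int i - int n = - int (n - i)" using i by simp
      then show ?thesis using t_nz by (simp only: power_int_minus power_int_of_nat) simp
    qed
    moreover have "t powi (- int (i - 1)) = inverse t ^ (i - 1)"
      by (simp only: power_int_minus power_int_of_nat power_inverse)
    ultimately show ?thesis by simp
  qed
  then show ?thesis by (simp add: eigfun_def laurent_one)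
qed

lemma eigval_nphi:
  assumes "length \<eta> = n" "1 \<le> i" "i \<le> n"
  shows "eigval q t (nphi \<eta>) i = (if i = n then q * eigval q t \<eta> 1 else eigval q t \<eta> (i + 1))"
proof -
  have ne: "\<eta> \<noteq> []" using assms n_pos by auto
  show ?thesis using assms ne
    by (auto simp: eigval_level level_nphi nth_nphi Suc_diff_Suc)
qed

lemma eigfun_Phi:
  assumes F: "eigfun \<eta> F" and len: "length \<eta> = n"
  shows "eigfun (nphi \<eta>) (Phi F)"
proof -
  have lF: "laurent n F" using F by (simp add: eigfun_def)
  have "Y i (Phi F) = (\<lambda>a. eigval q t (nphi \<eta>) i * Phi F a)" if i: "1 \<le> i" "i \<le> n" for i
  proof (cases "i = n")
    case True
    have "Y n (Phi F) = (\<lambda>a. q * Phi (Y 1 F) a)" by (rule Y_n_Phi[OF lF])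
    also have "Y 1 F = (\<lambda>a. eigval q t \<eta> 1 * F a)" using F n_pos by (simp add: eigfun_def)
    also have "Phi \<dots> = (\<lambda>a. eigval q t \<eta> 1 * Phi F a)" by (rule linop_scale[OF linop_Phi[OF n_pos] lF])
    finally show ?thesis using True eigval_nphi[OF len i] by (simp add: mult.assoc)
  next
    case False
    then have i': "i < n" "1 \<le> i + 1" "i + 1 \<le> n" using i by auto
    have "Y i (Phi F) = Phi (Y (i + 1) F)" by (rule Y_Phi[OF lF i(1) i'(1)])
    also have "Y (i + 1) F = (\<lambda>a. eigval q t \<eta> (i + 1) * F a)" using F i' unfolding eigfun_def by blast
    also have "Phi \<dots> = (\<lambda>a. eigval q t \<eta> (i + 1) * Phi F a)" by (rule linop_scale[OF linop_Phi[OF n_pos] lF])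
    finally show ?thesis using False eigval_nphi[OF len i] by simp
  qed
  then show ?thesis using linop_laurent[OF linop_Phi[OF n_pos] lF] by (simp add: eigfun_def)
qed

lemma Phi_nonzero:
  assumes F: "laurent n F" "F \<noteq> (\<lambda>_. 0)"
  shows "Phi F \<noteq> (\<lambda>_. 0)"
proof
  assume 0: "Phi F = (\<lambda>_. 0)"
  have "comp_ops (map Ti (rev [1..<n])) F = mulxinv n (Phi F)"
    unfolding Phiop_def by (rule mulxinv_mulx[symmetric]) (use F n_pos in \<open>auto intro!: laurent_Tis\<close>)
  also have "\<dots> = (\<lambda>_. 0)" unfolding 0 by (simp add: mulxinv_def)
  finally have "F = comp_ops (map T [1..<n]) (\<lambda>_. 0)"
    using Tis_Ts(2)[OF F(1), of "[1..<n]"] by simp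
  also have "\<dots> = (\<lambda>_. 0)" by (rule linop_zero[OF linop_Ts]) auto
  finally show False using F(2) by simp
qed

text \<open>The scalar for which T_i - \<open>alpha\<close> exchanges the eigenvalues of Y_i and
  Y_{i+1}; for distinct neighbouring entries it is also the diagonal coefficient of T_i on
  \<open>E \<eta>\<close>.\<close>

definition alpha :: "nat list \<Rightarrow> nat \<Rightarrow> 'a" where
  "alpha \<eta> i = (t - 1) * eigval q t \<eta> i / (eigval q t \<eta> i - eigval q t \<eta> (i + 1))"

lemma intertwiner:
  assumes F: "eigfun \<eta> F" and i: "1 \<le> i" "i < n" and j: "1 \<le> j" "j \<le> n"
    and ne: "eigval q t \<eta> i \<noteq> eigval q t \<eta> (i + 1)"
  defines "G \<equiv> \<lambda>a. T i F a - alpha \<eta> i * F a"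
  shows "Y j G = (\<lambda>a. eigval q t \<eta> (if j = i then i + 1 else if j = i + 1 then i else j) * G a)"
proof -
  let ?y = "eigval q t \<eta>"
  have lF: "laurent n F" using F by (simp add: eigfun_def)
  have lT: "laurent n (T i F)" using lF i by (rule laurent_T)
  have YF: "Y k F = (\<lambda>a. ?y k * F a)" if "1 \<le> k" "k \<le> n" for k using F that by (simp add: eigfun_def)
  have i1: "1 \<le> i + 1" "i + 1 \<le> n" using i by auto
  have al: "alpha \<eta> i * (?y i - ?y (i + 1)) = (t - 1) * ?y i" using ne by (simp add: alpha_def)
  have lY: "laurent n (Y (i + 1) (T i F))" by (rule laurent_Y[OF lT i1])
  have YG: "Y j G = (\<lambda>a. Y j (T i F) a - alpha \<eta> i * (?y j * F a))"
    using linop_comb[OF linop_Y[OF j] lT lF, of 1 "- alpha \<eta> i"] YF[OF j] by (simp add: G_def)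
  \<comment> \<open>Obtained by cancelling the left T_i in T_i Y_{i+1} T_i = t Y_i.\<close>
  have Y1: "Y (i + 1) (T i F) = (\<lambda>a. ?y i * T i F a + (1 - t) * ?y i * F a)"
  proof -
    have "Y (i + 1) (T i F) = Ti i (T i (Y (i + 1) (T i F)))" using lY i by simp
    also have "\<dots> = Ti i (\<lambda>a. t * Y i F a)" unfolding T_Y_T[OF lF i] ..
    also have "\<dots> = Ti i (\<lambda>a. (t * ?y i) * F a)" using YF[of i] i by (simp add: mult.assoc)
    also have "\<dots> = (\<lambda>a. (t * ?y i) * Ti i F a)" by (rule linop_scale[OF linop_Ti[OF i] lF])
    also have "\<dots> = (\<lambda>a. ?y i * T i F a + (1 - t) * ?y i * F a)"
      unfolding Tinv_def using t_nz by (simp add: fun_eq_iff field_simps)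
    finally show ?thesis .
  qed
  \<comment> \<open>The same relation applied to T_i F; the quadratic relation reduces the squares
    of T_i.\<close>
  have Y0: "Y i (T i F) = (\<lambda>a. ?y (i + 1) * T i F a + (t - 1) * ?y i * F a)"
  proof -
    have "(\<lambda>a. t * Y i (T i F) a) = T i (Y (i + 1) (T i (T i F)))" by (rule T_Y_T[OF lT i, symmetric])
    also have "T i (T i F) = (\<lambda>a. (t - 1) * T i F a + t * F a)" by (rule T_quadratic[OF lF i])
    also have "Y (i + 1) \<dots> = (\<lambda>a. (t - 1) * Y (i + 1) (T i F) a + t * Y (i + 1) F a)"
      by (rule linop_comb[OF linop_Y[OF i1] lT lF])
    also have "\<dots> = (\<lambda>a. ((t - 1) * ?y i) * T i F a + (t * ?y (i + 1) - (t - 1) * (t - 1) * ?y i) * F a)"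
      unfolding Y1 YF[OF i1] by (simp add: fun_eq_iff algebra_simps)
    also have "T i \<dots> = (\<lambda>a. ((t - 1) * ?y i) * T i (T i F) a + (t * ?y (i + 1) - (t - 1) * (t - 1) * ?y i) * T i F a)"
      by (rule linop_comb[OF linop_T[OF i] lT lF])
    also have "\<dots> = (\<lambda>a. t * (?y (i + 1) * T i F a + (t - 1) * ?y i * F a))"
      unfolding T_quadratic[OF lF i] by (simp add: fun_eq_iff algebra_simps)
    finally show ?thesis using t_nz by (simp add: fun_eq_iff)
  qed
  consider "j = i" | "j = i + 1" | "j \<noteq> i" "j \<noteq> i + 1" by blast
  then show ?thesis
  proof cases
    case 1
    have "Y j G a = ?y (i + 1) * G a" for a
    proof -
      have "Y j G a = ?y (i + 1) * T i F a + ((t - 1) * ?y i - alpha \<eta> i * ?y i) * F a"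
        unfolding YG unfolding 1 Y0 by (simp add: algebra_simps)
      also have "(t - 1) * ?y i - alpha \<eta> i * ?y i = - alpha \<eta> i * ?y (i + 1)"
        unfolding al[symmetric] by (simp add: algebra_simps)
      finally show ?thesis by (simp add: G_def algebra_simps)
    qed
    then show ?thesis using 1 by auto
  next
    case 2
    have "Y j G a = ?y i * G a" for a
    proof -
      have "Y j G a = ?y i * T i F a - ((t - 1) * ?y i + alpha \<eta> i * ?y (i + 1)) * F a"
        unfolding YG unfolding 2 Y1 by (simp add: algebra_simps)
      also have "(t - 1) * ?y i + alpha \<eta> i * ?y (i + 1) = alpha \<eta> i * ?y i"
        unfolding al[symmetric] by (simp add: algebra_simps)
      finally show ?thesis by (simp add: G_def algebra_simps)
    qed
    then show ?thesis using 2 by auto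
  next
    case 3
    have "Y j (T i F) = T i (Y j F)" by (rule T_Y_commute[OF lF i j 3, symmetric])
    also have "\<dots> = (\<lambda>a. ?y j * T i F a)" unfolding YF[OF j] by (rule linop_scale[OF linop_T[OF i] lF])
    finally show ?thesis using 3 unfolding YG by (simp add: G_def fun_eq_iff algebra_simps)
  qed
qed

end

lemma excess_swp:
  assumes "1 \<le> i" "i < length a"
  shows "excess c (swp i a) = excess c a"
  using sum_update2[of "i - 1" a i "\<lambda>v. max (v - c) 0" "a ! i" "a ! (i - 1)"] assms
  by (simp add: excess_def swp_def)

lemma level_equal:
  assumes "1 \<le> i" "i < length \<eta>" "\<eta> ! (i - 1) = \<eta> ! i"
  shows "level \<eta> i = Suc (level \<eta> (i - 1))"
proof -
  let ?A = "{m. m < length \<eta> \<and> (m < i - 1 \<and> \<eta> ! (i - 1) \<le> \<eta> ! m \<or> i - 1 < m \<and> \<eta> ! (i - 1) < \<eta> ! m)}"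
  have "{m. m < length \<eta> \<and> (m < i \<and> \<eta> ! i \<le> \<eta> ! m \<or> i < m \<and> \<eta> ! i < \<eta> ! m)} = insert (i - 1) ?A"
  proof (rule set_eqI)
    fix m
    consider "m < i - 1" | "m = i - 1" | "m = i" | "i < m" using assms(1) by linarith
    then show "m \<in> {m. m < length \<eta> \<and> (m < i \<and> \<eta> ! i \<le> \<eta> ! m \<or> i < m \<and> \<eta> ! i < \<eta> ! m)}
      \<longleftrightarrow> m \<in> insert (i - 1) ?A"
      by cases (use assms in auto)
  qed
  then show ?thesis unfolding level_def by simp
qed

context macdonald
begin

lemma eigval_powi:
  assumes "length \<eta> = n" "1 \<le> i" "i \<le> n"
  shows "eigval q t \<eta> i = q powi int (\<eta> ! (i - 1)) * t powi (- int (level \<eta> (i - 1)))"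
  using assms by (simp add: eigval_level)

lemma eigval_ratio:
  assumes "length \<eta> = n" "1 \<le> i" "i \<le> n" "1 \<le> j" "j \<le> n" "eigval q t \<eta> i = t powi m * eigval q t \<eta> j"
  shows "\<eta> ! (i - 1) = \<eta> ! (j - 1)"
proof -
  have "q powi int (\<eta> ! (i - 1)) * t powi (- int (level \<eta> (i - 1)))
      = q powi int (\<eta> ! (j - 1)) * t powi (m - int (level \<eta> (j - 1)))"
    using assms(6) assms(1-5) t_nz by (simp add: eigval_powi power_int_diff power_int_minus field_simps)
  then show ?thesis using qt_cancel by fastforce
qed

lemma eigval_nonzero: "length \<eta> = n \<Longrightarrow> 1 \<le> i \<Longrightarrow> i \<le> n \<Longrightarrow> eigval q t \<eta> i \<noteq> 0"
  using t_nz by (simp add: eigval_powi power_int_eq_0_iff)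

lemma eigval_nswp:
  assumes "length \<eta> = n" "1 \<le> i" "i < n" "\<eta> ! (i - 1) \<noteq> \<eta> ! i" "1 \<le> j" "j \<le> n"
  shows "eigval q t (nswp i \<eta>) j = eigval q t \<eta> (if j = i then i + 1 else if j = i + 1 then i else j)"
proof -
  have "tr i (j - 1) = (if j = i then i + 1 else if j = i + 1 then i else j) - 1"
    using assms by (auto simp: tr_def)
  then show ?thesis using assms by (simp add: eigval_level level_nswp nth_nswp)
qed

lemma eigval_neighbours:
  assumes "length \<eta> = n" "1 \<le> i" "i < n" "\<eta> ! (i - 1) \<noteq> \<eta> ! i"
  shows "eigval q t \<eta> i \<noteq> t powi m * eigval q t \<eta> (i + 1)"
  using eigval_ratio[of \<eta> i "i + 1" m] assms by auto

text \<open>The values t and -1 are the roots of the quadratic relation. \<open>alpha\<close> meets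
  one of them only if the two eigenvalues have ratio t or t^{-1}, which forces equal
  entries.\<close>

lemma alpha_special:
  assumes "length \<eta> = n" "1 \<le> i" "i < n" "\<eta> ! (i - 1) \<noteq> \<eta> ! i"
  shows "alpha \<eta> i \<noteq> t" "alpha \<eta> i \<noteq> - 1" "eigval q t \<eta> i \<noteq> eigval q t \<eta> (i + 1)"
proof -
  let ?y = "eigval q t \<eta>"
  show ne: "?y i \<noteq> ?y (i + 1)" using eigval_neighbours[OF assms, of 0] by simp
  have 1: "?y i \<noteq> t * ?y (i + 1)" using eigval_neighbours[OF assms, of 1] by simp
  have 2: "t * ?y i \<noteq> ?y (i + 1)"
    using eigval_neighbours[OF assms, of "-1"] t_nz by (simp add: power_int_minus field_simps)
  show "alpha \<eta> i \<noteq> t" using ne 1 unfolding alpha_def by (simp add: divide_simps) (simp add: algebra_simps)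
  show "alpha \<eta> i \<noteq> - 1" using ne 2 unfolding alpha_def by (simp add: divide_simps) (simp add: algebra_simps)
qed

lemma eigfun_swap:
  assumes F: "eigfun \<eta> F" and len: "length \<eta> = n" and i: "1 \<le> i" "i < n" and ne: "\<eta> ! (i - 1) \<noteq> \<eta> ! i"
  shows "eigfun (nswp i \<eta>) (\<lambda>a. T i F a - alpha \<eta> i * F a)"
proof -
  have lF: "laurent n F" using F by (simp add: eigfun_def)
  have "laurent n (\<lambda>a. T i F a - alpha \<eta> i * F a)"
    using laurent_comb[OF laurent_T[OF lF i] lF, of 1 "- alpha \<eta> i"] by simp
  then show ?thesis unfolding eigfun_def
    using intertwiner[OF F i _ _ alpha_special(3)[OF len i ne]] eigval_nswp[OF len i ne] by simp
qed

text \<open>If the difference vanished, \<open>F\<close> would be an eigenvector of T_i and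
  \<open>alpha\<close> a root of the quadratic relation.\<close>

lemma eigfun_swap_nonzero:
  assumes F: "eigfun \<eta> F" "F \<noteq> (\<lambda>_. 0)" and len: "length \<eta> = n" and i: "1 \<le> i" "i < n"
    and ne: "\<eta> ! (i - 1) \<noteq> \<eta> ! i"
  shows "(\<lambda>a. T i F a - alpha \<eta> i * F a) \<noteq> (\<lambda>_. 0)"
proof
  let ?c = "alpha \<eta> i"
  have lF: "laurent n F" using F by (simp add: eigfun_def)
  assume "(\<lambda>a. T i F a - ?c * F a) = (\<lambda>_. 0)"
  then have TF: "T i F = (\<lambda>a. ?c * F a)" by (auto simp: fun_eq_iff)
  then have "T i (T i F) = (\<lambda>a. ?c * (?c * F a))" using linop_scale[OF linop_T[OF i] lF, of ?c] by simp
  then have "?c * (?c * F a) = (t - 1) * (?c * F a) + t * F a" for a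
    using T_quadratic[OF lF i] TF by (simp add: fun_eq_iff)
  then have "(?c - t) * (?c + 1) * F a = 0" for a by (simp add: algebra_simps)
  then have "(?c - t) * (?c + 1) = 0" using F(2) by (auto simp: fun_eq_iff)
  then show False using alpha_special(1,2)[OF len i ne] by (auto simp: eq_neg_iff_add_eq_0)
qed

text \<open>The outer induction is on the degree, which drops when the last entry is positive and
  \<eta> is thus in the image of \<open>nphi\<close>. Otherwise the last nonzero entry is exchanged
  with the 0 on its right; the weights n - k decrease to the right, so the inner measure drops at
  equal degree.\<close>

lemma eigfun_exists:
  assumes "length \<eta> = n"
  shows "\<exists>F. eigfun \<eta> F \<and> F \<noteq> (\<lambda>_. 0)"
  using assms
proof (induction "sum_list \<eta>" arbitrary: \<eta> rule: less_induct)
  case less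
  show ?case
    using less.prems less.hyps
  proof (induction "\<Sum>k<n. (n - k) * \<eta> ! k" arbitrary: \<eta> rule: less_induct)
    case less
    have len: "length \<eta> = n" by fact
    show ?case
    proof (cases "\<eta> = replicate n 0")
      case True
      have "one_lp \<noteq> (\<lambda>_. 0)" by (auto simp: one_lp_def fun_eq_iff)
      then show ?thesis using True eigfun_one by blast
    next
      case False
      show ?thesis
      proof (cases "\<eta> ! (n - 1) = 0")
        case False
        define \<zeta> where "\<zeta> = (\<eta> ! (n - 1) - 1) # butlast \<eta>"
        have ne: "\<eta> \<noteq> []" using len n_pos by auto
        then have la: "last \<eta> = \<eta> ! (n - 1)" using len by (simp add: last_conv_nth)
        have z: "nphi \<zeta> = \<eta>" using False append_butlast_last_id[OF ne] la by (simp add: \<zeta>_def nphi_def)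
        have lz: "length \<zeta> = n" using len n_pos by (simp add: \<zeta>_def)
        have "sum_list \<eta> = sum_list (butlast \<eta>) + last \<eta>"
          using ne by (metis append_butlast_last_id sum_list.Cons sum_list.Nil sum_list_append add_0_right)
        then have "sum_list \<zeta> < sum_list \<eta>" using False la by (simp add: \<zeta>_def)
        then obtain F where F: "eigfun \<zeta> F" "F \<noteq> (\<lambda>_. 0)" using less.prems(2) lz by blast
        then have "eigfun \<eta> (Phi F)" using eigfun_Phi[OF F(1) lz] z by simp
        moreover have "Phi F \<noteq> (\<lambda>_. 0)" using Phi_nonzero F by (auto simp: eigfun_def)
        ultimately show ?thesis by blast
      next
        case True
        let ?S = "{k. k < n \<and> \<eta> ! k \<noteq> 0}"
        have "?S \<noteq> {}" using False len by (auto simp: list_eq_iff_nth_eq)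
        then have mx: "Max ?S \<in> ?S" by (intro Max_in) auto
        define i where "i = Suc (Max ?S)"
        have "Max ?S \<noteq> n - 1" "Max ?S < n" using mx True by auto
        then have i: "1 \<le> i" "i < n" by (simp_all add: i_def)
        have z: "\<eta> ! i = 0"
        proof (rule ccontr)
          assume "\<eta> ! i \<noteq> 0"
          then have "i \<le> Max ?S" using i by (intro Max_ge) auto
          then show False by (simp add: i_def)
        qed
        have nz: "\<eta> ! (i - 1) \<noteq> 0" using mx by (simp add: i_def)
        define \<zeta> where "\<zeta> = nswp i \<eta>"
        have lz: "length \<zeta> = n" using len by (simp add: \<zeta>_def)
        have zz: "\<zeta> ! (i - 1) = 0" "\<zeta> ! i = \<eta> ! (i - 1)"
          using i z len by (auto simp: \<zeta>_def nswp_def nth_list_update)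
        have ii: "i - 1 < n" "i < n" "i - 1 \<noteq> i" using i by auto
        have "(\<Sum>k\<in>{..<n} - {i - 1, i}. (n - k) * \<zeta> ! k) = (\<Sum>k\<in>{..<n} - {i - 1, i}. (n - k) * \<eta> ! k)"
          by (rule sum.cong) (auto simp: \<zeta>_def nswp_def)
        moreover have "(n - i) * \<eta> ! (i - 1) < (n - (i - 1)) * \<eta> ! (i - 1)" using i nz by auto
        ultimately have w: "(\<Sum>k<n. (n - k) * \<zeta> ! k) < (\<Sum>k<n. (n - k) * \<eta> ! k)"
          unfolding sum_split2[OF ii] using z zz by simp
        have "mset \<zeta> = mset \<eta>" unfolding \<zeta>_def nswp_def using i len by (intro mset_swap) auto
        then have "sum_list \<zeta> = sum_list \<eta>" by (metis sum_mset_sum_list)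
        then obtain F where F: "eigfun \<zeta> F" "F \<noteq> (\<lambda>_. 0)" using less.hyps[OF w lz] less.prems(2) by auto
        have ne: "\<zeta> ! (i - 1) \<noteq> \<zeta> ! i" using zz nz by simp
        have "nswp i \<zeta> = \<eta>" using i len by (simp add: \<zeta>_def nswp_nswp)
        then show ?thesis
          using eigfun_swap[OF F(1) lz i ne] eigfun_swap_nonzero[OF F lz i ne] by auto
      qed
    qed
  qed
qed

section \<open>Matrix entries on the polynomials \<open>E \<eta>\<close>\<close>

lemma eigfun_E: "length \<eta> = n \<Longrightarrow> eigfun \<eta> (E \<eta>)"
  and E_leading: "length \<eta> = n \<Longrightarrow> E \<eta> (map int \<eta>) = 1"
proof -
  have "eigfun \<eta> (E \<eta>) \<and> E \<eta> (map int \<eta>) = 1" if len: "length \<eta> = n"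
  proof -
    obtain F where F: "eigfun \<eta> F" "F \<noteq> (\<lambda>_. 0)" using eigfun_exists[OF len] by blast
    then obtain a where "F a \<noteq> 0" by auto
    then show ?thesis using Emac_of_eigfun F len by blast
  qed
  then show "length \<eta> = n \<Longrightarrow> eigfun \<eta> (E \<eta>)" "length \<eta> = n \<Longrightarrow> E \<eta> (map int \<eta>) = 1" by auto
qed

lemma laurent_E: "length \<eta> = n \<Longrightarrow> laurent n (E \<eta>)"
  using eigfun_E by (simp add: eigfun_def)

lemma eigfun_multiple:
  assumes "eigfun \<eta> F" "length \<eta> = n"
  shows "F = (\<lambda>a. F (map int \<eta>) * E \<eta> a)"
proof (rule eigfun_unique[OF assms(1) _ assms(2)])
  show "eigfun \<eta> (\<lambda>a. F (map int \<eta>) * E \<eta> a)"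
    using eigfun_comb[OF eigfun_E eigfun_E, of \<eta> "F (map int \<eta>)" 0] assms by simp
qed (use E_leading assms in simp)

lemma E_support: "length \<eta> = n \<Longrightarrow> E \<eta> a \<noteq> 0 \<Longrightarrow> below a (map int \<eta>)"
  using eigfun_support(1)[OF eigfun_E] .

lemma E_above: "length \<eta> = n \<Longrightarrow> sbelow (map int \<eta>) a \<Longrightarrow> E \<eta> a = 0"
  using E_support below_antisym unfolding sbelow_def by blast

lemma T_E_ascent:
  assumes len: "length \<eta> = n" and i: "1 \<le> i" "i < n" and lt: "\<eta> ! (i - 1) < \<eta> ! i"
  shows "T i (E \<eta>) = (\<lambda>a. alpha \<eta> i * E \<eta> a + t * E (nswp i \<eta>) a)"
proof -
  let ?e = "map int \<eta>"
  let ?G = "\<lambda>a. T i (E \<eta>) a - alpha \<eta> i * E \<eta> a"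
  have ii: "i - 1 < length ?e" "i < length ?e" "i - 1 \<noteq> i" using i len by auto
  have G: "eigfun (nswp i \<eta>) ?G"
    by (rule eigfun_swap[OF eigfun_E[OF len] len i]) (use lt in simp)
  have m: "map int (nswp i \<eta>) = swp i ?e" using i len by (simp add: map_int_nswp)
  have s: "swp i ?e ! (i - 1) = ?e ! i" "swp i ?e ! i = ?e ! (i - 1)" using ii by (auto simp: swp_def nth_list_update)
  have "sbelow ?e (swp i ?e)"
    unfolding swp_def using ii i lt by (intro sbelow_swap) auto
  then have E0: "E \<eta> (swp i ?e) = 0" by (rule E_above[OF len])
  have "E \<eta> ((swp i ?e)[i - 1 := x, i := y]) = 0"
    if "x + y = swp i ?e ! (i - 1) + swp i ?e ! i" "max x y > max (swp i ?e ! (i - 1)) (swp i ?e ! i)" for x y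
  proof -
    have "sbelow ?e (?e[i - 1 := x, i := y])"
      by (rule sbelow_spread[OF ii]) (use that in \<open>auto simp: s\<close>)
    moreover have "(swp i ?e)[i - 1 := x, i := y] = ?e[i - 1 := x, i := y]"
      using ii by (intro nth_equalityI) (auto simp: swp_def nth_list_update)
    ultimately show ?thesis using E_above[OF len] by metis
  qed
  \<comment> \<open>One coefficient suffices: the intertwined function is a multiple of the
    polynomial at s_i \<eta>, and \<open>E \<eta>\<close> vanishes at that exponent.\<close>
  then have "T i (E \<eta>) (swp i ?e) = t * E \<eta> (swp i (swp i ?e))"
    using T_coeff[OF laurent_E[OF len] i, of "swp i ?e"] len lt ii s by simp
  then have "T i (E \<eta>) (swp i ?e) = t" using i len by (simp add: swp_swp E_leading)
  then have "?G (map int (nswp i \<eta>)) = t" unfolding m using E0 by simp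
  then have "?G = (\<lambda>a. t * E (nswp i \<eta>) a)"
    using eigfun_multiple[OF G] len by simp
  then show ?thesis by (simp add: fun_eq_iff algebra_simps)
qed

text \<open>For equal entries \<open>alpha\<close> is t, and the intertwined function would have
  exchanged eigenvalues. Its leading exponent has the same entries, hence is \<eta>, whose
  eigenvalues are not exchanged; so the function is zero.\<close>

lemma T_E_equal:
  assumes len: "length \<eta> = n" and i: "1 \<le> i" "i < n" and eq: "\<eta> ! (i - 1) = \<eta> ! i"
  shows "T i (E \<eta>) = (\<lambda>a. t * E \<eta> a)"
proof -
  let ?y = "eigval q t \<eta>"
  have y: "?y i = t * ?y (i + 1)"
  proof -
    have "t * t powi (- int (Suc m)) = t powi (- int m)" for m
      using power_int_add[of t 1 "- int (Suc m)"] t_nz by simp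
    then show ?thesis using len i eq level_equal[of i \<eta>]
      by (simp add: eigval_level mult.left_commute del: of_nat_Suc)
  qed
  have t1: "t \<noteq> 1" using independent[of 0 1] by auto
  have y0: "?y (i + 1) \<noteq> 0" using eigval_nonzero[OF len] i by simp
  have ne: "?y i \<noteq> ?y (i + 1)" unfolding y using t1 y0 by simp
  have al: "alpha \<eta> i = t" unfolding alpha_def y using t1 y0 by (simp add: divide_simps) (simp add: algebra_simps)
  let ?G = "\<lambda>a. T i (E \<eta>) a - t * E \<eta> a"
  have lG: "laurent n ?G"
    using laurent_comb[OF laurent_T[OF laurent_E[OF len] i] laurent_E[OF len], of 1 "- t"] by simp
  have "?G a = 0" for a
  proof (rule ccontr)
    assume nz: "?G a \<noteq> 0"
    let ?y' = "\<lambda>j. ?y (if j = i then i + 1 else if j = i + 1 then i else j)"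
    have "Y j ?G = (\<lambda>a. ?y' j * ?G a)" if "1 \<le> j" "j \<le> n" for j
      using intertwiner[OF eigfun_E[OF len] i that ne] unfolding al .
    then obtain \<mu> where mu: "?G \<mu> \<noteq> 0" "\<And>j. 1 \<le> j \<Longrightarrow> j \<le> n \<Longrightarrow> ?y' j = lead j \<mu>"
      using joint_eigen_max[OF lG nz, of ?y'] by blast
    have lm: "length \<mu> = n" using mu(1) lG laurent_length by blast
    have "\<mu> = map int \<eta>"
    proof (rule nth_equalityI)
      fix k assume k: "k < length \<mu>"
      let ?j = "if Suc k = i then i + 1 else if Suc k = i + 1 then i else Suc k"
      have "?y ?j = lead (Suc k) \<mu>" using mu(2)[of "Suc k"] k lm by simp
      moreover have "1 \<le> ?j" "?j \<le> n" using i k lm by auto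
      ultimately have "q powi int (\<eta> ! (?j - 1)) * t powi (- int (level \<eta> (?j - 1))) = lead (Suc k) \<mu>"
        using eigval_powi[OF len, of ?j] by simp
      then have "int (\<eta> ! (?j - 1)) = \<mu> ! k" unfolding lead_def using qt_cancel by fastforce
      moreover have "\<eta> ! (?j - 1) = \<eta> ! k" using eq i by auto
      ultimately show "\<mu> ! k = map int \<eta> ! k" using k lm len by simp
    qed (use lm len in simp)
    then have "?y (i + 1) = ?y i" using mu(2)[of i] i lead_map_int[OF len, of i] by simp
    then show False using ne by simp
  qed
  then show ?thesis by (simp add: fun_eq_iff)
qed

text \<open>The two diagonal entries add up to t - 1, the trace of T_i on the span of
  \<open>E \<eta>\<close> and \<open>E (nswp i \<eta>)\<close>.\<close>

lemma alpha_nswp: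
  assumes "length \<eta> = n" "1 \<le> i" "i < n" "\<eta> ! (i - 1) \<noteq> \<eta> ! i"
  shows "alpha (nswp i \<eta>) i = t - 1 - alpha \<eta> i"
proof -
  have "eigval q t (nswp i \<eta>) i = eigval q t \<eta> (i + 1)" "eigval q t (nswp i \<eta>) (i + 1) = eigval q t \<eta> i"
    using eigval_nswp[OF assms] assms by auto
  then show ?thesis using alpha_special(3)[OF assms] unfolding alpha_def
    by (simp add: divide_simps) (simp add: algebra_simps)
qed

text \<open>Applying T_i to the ascent formula for s_i \<eta> and reducing by the quadratic relation
  solves for \<open>T i (E \<eta>)\<close>.\<close>

lemma T_E_descent:
  assumes len: "length \<eta> = n" and i: "1 \<le> i" "i < n" and lt: "\<eta> ! i < \<eta> ! (i - 1)"
  shows "T i (E \<eta>) = (\<lambda>a. alpha \<eta> i * E \<eta> a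
    + inverse t * (t - alpha (nswp i \<eta>) i) * (1 + alpha (nswp i \<eta>) i) * E (nswp i \<eta>) a)"
proof -
  define \<zeta> where "\<zeta> = nswp i \<eta>"
  have lz: "length \<zeta> = n" using len by (simp add: \<zeta>_def)
  have ii: "i - 1 < length \<eta>" "i < length \<eta>" "i - 1 \<noteq> i" using i len by auto
  have zlt: "\<zeta> ! (i - 1) < \<zeta> ! i" using ii lt by (simp add: \<zeta>_def nswp_def nth_list_update)
  have ze: "nswp i \<zeta> = \<eta>" using i len by (simp add: \<zeta>_def nswp_nswp)
  let ?c = "alpha \<zeta> i"
  have al: "alpha \<eta> i = t - 1 - ?c" using alpha_nswp[OF lz i] zlt ze by simp
  have TZ: "T i (E \<zeta>) = (\<lambda>a. ?c * E \<zeta> a + t * E \<eta> a)" using T_E_ascent[OF lz i zlt] ze by simp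
  have "T i (T i (E \<zeta>)) = (\<lambda>a. ?c * T i (E \<zeta>) a + t * T i (E \<eta>) a)"
    using linop_comb[OF linop_T[OF i] laurent_E[OF lz] laurent_E[OF len], of ?c t] unfolding TZ[symmetric] .
  then have tT: "t * T i (E \<eta>) a = (t - 1) * T i (E \<zeta>) a + t * E \<zeta> a - ?c * T i (E \<zeta>) a" for a
    using T_quadratic[OF laurent_E[OF lz] i] by (simp add: fun_eq_iff algebra_simps)
  then have "t * T i (E \<eta>) a = t * (alpha \<eta> i * E \<eta> a + inverse t * (t - ?c) * (1 + ?c) * E \<zeta> a)" for a
  proof -
    have "t * (alpha \<eta> i * E \<eta> a + inverse t * (t - ?c) * (1 + ?c) * E \<zeta> a)
      = t * alpha \<eta> i * E \<eta> a + (t - ?c) * (1 + ?c) * E \<zeta> a"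
      using t_nz by (simp add: distrib_left mult.assoc[symmetric])
    then show ?thesis using tT[of a] unfolding TZ al by (simp add: algebra_simps)
  qed
  then show ?thesis unfolding \<zeta>_def[symmetric] using t_nz by (simp add: fun_eq_iff)
qed

text \<open>The coefficient of \<open>Phi (E \<eta>)\<close> at its leading exponent; a factor
  t^{-1} arises when the first entry passes one not exceeding it.\<close>

definition gam :: "nat list \<Rightarrow> 'a" where
  "gam \<eta> = (\<Prod>k\<in>{1..<n}. if \<eta> ! k \<le> \<eta> ! 0 then inverse t else 1)"

lemma gam_nonzero: "gam \<eta> \<noteq> 0"
  unfolding gam_def using t_nz by (auto simp: prod_zero_iff split: if_splits)

text \<open>While the factors of \<open>Ti (n - 1) \<circ> \<dots> \<circ> Ti 1\<close> are applied to \<open>E \<eta>\<close>, every exponent in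
  the top orbit keeps the entry at the moving position bounded by the first entry of \<open>\<eta>\<close>;
  hence only one path reaches the exponent \<open>(\<eta>_2, \<dots>, \<eta>_n, \<eta>_1)\<close>.\<close>

lemma Tis_E_leading:
  assumes len: "length \<eta> = n" and k: "k < n"
  defines "e \<equiv> map int \<eta>"
  defines "F \<equiv> \<lambda>k. comp_ops (map Ti (rev [1..<k + 1])) (E \<eta>)"
  shows "(\<forall>\<nu>. F k \<nu> \<noteq> 0 \<longrightarrow> (\<forall>c. excess c \<nu> \<le> excess c e) \<and>
        ((\<exists>c. excess c \<nu> < excess c e) \<or> \<nu> ! k \<le> e ! 0))
    \<and> F k (pm (mv 0 k) e) = (\<Prod>j\<in>{1..<k + 1}. if \<eta> ! j \<le> \<eta> ! 0 then inverse t else 1)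
    \<and> (\<forall>c. excess c (pm (mv 0 k) e) = excess c e)"
  using k
proof (induction k)
  case 0
  have "(\<exists>c. excess c \<nu> < excess c e) \<or> \<nu> ! 0 \<le> e ! 0" "\<forall>c. excess c \<nu> \<le> excess c e" if nz: "E \<eta> \<nu> \<noteq> 0" for \<nu>
  proof -
    have b: "below \<nu> e" using E_support[OF len nz] by (simp add: e_def)
    then show "\<forall>c. excess c \<nu> \<le> excess c e" by (simp add: below_def)
    have "1 \<le> length \<nu>" using b len n_pos by (simp add: below_def e_def)
    then show "(\<exists>c. excess c \<nu> < excess c e) \<or> \<nu> ! 0 \<le> e ! 0"
      using b unfolding below_def by (metis One_nat_def lessThan_0 lessThan_Suc psum_def sum.empty sum.insert finite.emptyI empty_iff add.right_neutral)
  qed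
  then show ?case using E_leading[OF len] by (simp add: F_def mv_id e_def)
next
  case (Suc k)
  let ?G = "F k" and ?m = "pm (mv 0 k) e"
  have kn: "1 \<le> Suc k" "Suc k < n" using Suc by auto
  have FS: "F (Suc k) = Ti (Suc k) ?G" unfolding F_def by (simp add: One_nat_def)
  have lG: "laurent n ?G" unfolding F_def by (rule laurent_Tis[OF laurent_E[OF len]]) (use Suc in auto)
  have IH1: "?G \<nu> \<noteq> 0 \<Longrightarrow> excess c \<nu> \<le> excess c e"
    "?G \<nu> \<noteq> 0 \<Longrightarrow> (\<exists>c. excess c \<nu> < excess c e) \<or> \<nu> ! k \<le> e ! 0" for \<nu> c using Suc by auto
  have IH2: "?G ?m = (\<Prod>j\<in>{1..<k + 1}. if \<eta> ! j \<le> \<eta> ! 0 then inverse t else 1)" using Suc by simp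
  have IH3: "excess c ?m = excess c e" for c using Suc by simp
  have le: "length e = n" using len by (simp add: e_def)
  have m': "pm (mv 0 (Suc k)) e = swp (Suc k) ?m"
    using pm_swpt[of "Suc k" e "mv 0 k"] kn le by (simp add: swpt_mv_up)
  have ex': "excess c (pm (mv 0 (Suc k)) e) = excess c e" for c
    unfolding m' using excess_swp[of "Suc k" ?m] kn le IH3 by simp
  \<comment> \<open>Either a spread exponent lies in the support, and then \<nu> is strictly below
    the orbit in some excess, or the two-term formula applies; then the moving entry comes from
    position k or is smaller than the entry there.\<close>
  have inv: "(\<forall>c. excess c \<nu> \<le> excess c e) \<and> ((\<exists>c. excess c \<nu> < excess c e) \<or> \<nu> ! Suc k \<le> e ! 0)"
    if nz: "Ti (Suc k) ?G \<nu> \<noteq> 0" for \<nu>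
  proof -
    have ln: "length \<nu> = n" using nz laurent_Ti[OF lG kn] laurent_length by blast
    have kk: "k < length \<nu>" "Suc k < length \<nu>" "k \<noteq> Suc k" using kn ln by auto
    have swn: "swp (Suc k) \<nu> ! k = \<nu> ! Suc k" using kk by (simp add: swp_def nth_list_update)
    show ?thesis
    proof (cases "\<exists>x y. x + y = \<nu> ! k + \<nu> ! Suc k \<and> max x y > max (\<nu> ! k) (\<nu> ! Suc k) \<and> ?G (\<nu>[k := x, Suc k := y]) \<noteq> 0")
      case True
      then obtain x y where xy: "x + y = \<nu> ! k + \<nu> ! Suc k" "max x y > max (\<nu> ! k) (\<nu> ! Suc k)"
        "?G (\<nu>[k := x, Suc k := y]) \<noteq> 0" by blast
      have 1: "excess c (\<nu>[k := x, Suc k := y]) \<le> excess c e" for c using IH1(1)[OF xy(3)] .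
      show ?thesis
        using excess_spread[OF kk xy(1,2)] 1 by (meson order_trans less_le_trans)
    next
      case False
      have c: "Ti (Suc k) ?G \<nu> = (if \<nu> ! k > \<nu> ! Suc k then ?G (swp (Suc k) \<nu>) + (inverse t - 1) * ?G \<nu>
         else inverse t * ?G (swp (Suc k) \<nu>))"
        using Ti_coeff[OF lG kn ln] False by auto
      show ?thesis
      proof (cases "?G (swp (Suc k) \<nu>) = 0")
        case False
        have "excess c (swp (Suc k) \<nu>) = excess c \<nu>" for c using excess_swp[of "Suc k" \<nu>] kk kn by simp
        then show ?thesis using IH1[OF False] swn by simp
      next
        case True
        then have "\<nu> ! k > \<nu> ! Suc k" "?G \<nu> \<noteq> 0" using c nz by (auto split: if_splits)
        then show ?thesis using IH1[of \<nu>] by auto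
      qed
    qed
  qed
  have val: "Ti (Suc k) ?G (swp (Suc k) ?m) = (if \<eta> ! Suc k \<le> \<eta> ! 0 then inverse t else 1) * ?G ?m"
  proof -
    let ?s = "swp (Suc k) ?m"
    have ls: "length ?s = n" using le by simp
    have kk: "k < length ?s" "Suc k < length ?s" "k \<noteq> Suc k" using kn ls by auto
    have s1: "?s ! k = int (\<eta> ! Suc k)" "?s ! Suc k = int (\<eta> ! 0)"
      using kn len n_pos by (auto simp: swp_def nth_list_update e_def mv_def)
    have exs: "excess c ?s = excess c e" for c using ex' m' by simp
    have spread: "?G (?s[Suc k - 1 := x, Suc k := y]) = 0"
      if xy: "x + y = ?s ! (Suc k - 1) + ?s ! Suc k" "max x y > max (?s ! (Suc k - 1)) (?s ! Suc k)" for x y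
    proof (rule ccontr)
      assume nz: "?G (?s[Suc k - 1 := x, Suc k := y]) \<noteq> 0"
      obtain c where "excess c ?s < excess c (?s[k := x, Suc k := y])"
        using excess_spread(2)[OF kk] xy by auto
      moreover have "excess c (?s[k := x, Suc k := y]) \<le> excess c e" using IH1(1)[OF nz] by simp
      ultimately show False using exs by simp
    qed
    have c: "Ti (Suc k) ?G ?s = (if ?s ! k > ?s ! Suc k then ?G (swp (Suc k) ?s) + (inverse t - 1) * ?G ?s
         else inverse t * ?G (swp (Suc k) ?s))"
      using Ti_coeff[OF lG kn ls spread] by simp
    have ss: "swp (Suc k) ?s = ?m" using kn le by (simp add: swp_swp)
    \<comment> \<open>Here the entry at the moving position would exceed the first entry of \<eta>,
      against the bound carried along.\<close>
    have "?G ?s = 0" if "\<eta> ! Suc k > \<eta> ! 0"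
    proof (rule ccontr)
      assume "?G ?s \<noteq> 0"
      then have "?s ! k \<le> e ! 0" using IH1(2) exs by fastforce
      then show False using s1 that len n_pos by (simp add: e_def)
    qed
    then show ?thesis unfolding c ss s1 by auto
  qed
  have "{1..<Suc k + 1} = insert (Suc k) {1..<k + 1}" by auto
  then show ?case unfolding FS using inv val IH2 ex' unfolding m' by simp
qed

lemma Phi_E:
  assumes len: "length \<eta> = n"
  shows "Phi (E \<eta>) = (\<lambda>a. gam \<eta> * E (nphi \<eta>) a)"
proof -
  have ne: "\<eta> \<noteq> []" using len n_pos by auto
  have ln: "length (nphi \<eta>) = n" using len ne by simp
  let ?e = "map int \<eta>" and ?b = "map int (nphi \<eta>)"
  have b: "?b[n - 1 := ?b ! (n - 1) - 1] = pm (mv 0 (n - 1)) ?e"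
  proof (rule nth_equalityI)
    fix p assume "p < length (?b[n - 1 := ?b ! (n - 1) - 1])"
    then have "p < n" using ln by simp
    then show "?b[n - 1 := ?b ! (n - 1) - 1] ! p = pm (mv 0 (n - 1)) ?e ! p"
      using len ln n_pos by (auto simp: nth_list_update nth_nphi mv_def simp flip: Suc_eq_plus1)
  qed (use len ln in simp)
  have n1: "n - 1 < n" "n - 1 + 1 = n" using n_pos by auto
  have "Phi (E \<eta>) ?b = comp_ops (map Ti (rev [1..<n])) (E \<eta>) (pm (mv 0 (n - 1)) ?e)"
    unfolding Phiop_def mulx_def b ..
  also have "\<dots> = gam \<eta>"
    using Tis_E_leading[OF len n1(1)] unfolding n1(2) gam_def by blast
  finally show ?thesis
    using eigfun_multiple[OF eigfun_Phi[OF eigfun_E[OF len] len] ln] by simp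
qed

lemma Phihat_E:
  assumes len: "length \<eta> = n"
  shows "Phihat n q t (E (nphi \<eta>)) = (\<lambda>a. (1 - q * t ^ (n - 1) * eigval q t \<eta> 1) / gam \<eta> * E \<eta> a)"
proof -
  have ne: "\<eta> \<noteq> []" using len n_pos by auto
  have ln: "length (nphi \<eta>) = n" using len ne by simp
  have "E (nphi \<eta>) = (\<lambda>a. inverse (gam \<eta>) * Phi (E \<eta>) a)"
    using gam_nonzero[of \<eta>] by (simp add: Phi_E[OF len] mult.assoc[symmetric])
  also have "\<dots> = Phi (\<lambda>a. inverse (gam \<eta>) * E \<eta> a)"
    by (rule linop_scale[OF linop_Phi[OF n_pos] laurent_E[OF len], symmetric])
  finally have "Phihat n q t (E (nphi \<eta>)) = (\<lambda>a. inverse (gam \<eta>) * E \<eta> a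
      - q * t ^ (n - 1) * Y 1 (\<lambda>a. inverse (gam \<eta>) * E \<eta> a) a)"
    using Phihat_Phi[OF laurent_scale[OF laurent_E[OF len]], of "inverse (gam \<eta>)"] by simp
  also have "Y 1 (\<lambda>a. inverse (gam \<eta>) * E \<eta> a) = (\<lambda>a. inverse (gam \<eta>) * Y 1 (E \<eta>) a)"
    by (rule linop_scale[OF linop_Y laurent_E[OF len]]) (use n_pos in auto)
  also have "Y 1 (E \<eta>) = (\<lambda>a. eigval q t \<eta> 1 * E \<eta> a)" using eigfun_E[OF len] n_pos by (simp add: eigfun_def)
  finally show ?thesis by (simp add: fun_eq_iff divide_inverse algebra_simps)
qed

text \<open>A last entry 0 has all others weakly above it, so Y_n has eigenvalue t^(1-n) and 1 -
  t^(n-1) Y_n kills \<open>E \<eta>\<close>.\<close>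

lemma Phihat_E_zero:
  assumes len: "length \<eta> = n" and z: "\<eta> ! (n - 1) = 0"
  shows "Phihat n q t (E \<eta>) = (\<lambda>_. 0)"
proof -
  have "{m. m < length \<eta> \<and> (m < n - 1 \<and> \<eta> ! (n - 1) \<le> \<eta> ! m \<or> n - 1 < m \<and> \<eta> ! (n - 1) < \<eta> ! m)} = {..<n - 1}"
    using len z by auto
  then have "level \<eta> (n - 1) = n - 1" unfolding level_def by simp
  then have "eigval q t \<eta> n = t powi (- int (n - 1))" using len z n_pos by (simp add: eigval_level)
  then have "t ^ (n - 1) * eigval q t \<eta> n = 1"
    using t_nz by (simp only: power_int_minus power_int_of_nat) simp
  moreover have "Y n (E \<eta>) = (\<lambda>a. eigval q t \<eta> n * E \<eta> a)" using eigfun_E[OF len] n_pos by (simp add: eigfun_def)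
  ultimately have "Dop n q t n (E \<eta>) = (\<lambda>_. 0)" unfolding Dop_n by (simp add: mult.assoc[symmetric] mulxinv_def)
  then show ?thesis using linop_zero[OF linop_Ts, of "[1..<n]"] by (simp add: Phihat_def)
qed

end

section \<open>The coefficients of the kernel\<close>

text \<open>The leg with rows counted from 0 and both conditions in one set, ready for transport
  along a bijection of rows.\<close>

definition nleg :: "nat list \<Rightarrow> nat \<Rightarrow> nat \<Rightarrow> nat" where
  "nleg \<eta> k j = card {m. m < length \<eta> \<and> (k < m \<and> j \<le> \<eta> ! m \<and> \<eta> ! m \<le> \<eta> ! k
     \<or> m < k \<and> j \<le> Suc (\<eta> ! m) \<and> Suc (\<eta> ! m) \<le> \<eta> ! k)}"

lemma leg_Suc:
  assumes "k < length \<eta>"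
  shows "leg \<eta> (Suc k) j = nleg \<eta> k j"
proof -
  let ?A = "{m. k < m \<and> m < length \<eta> \<and> j \<le> \<eta> ! m \<and> \<eta> ! m \<le> \<eta> ! k}"
  let ?B = "{m. m < k \<and> j \<le> Suc (\<eta> ! m) \<and> Suc (\<eta> ! m) \<le> \<eta> ! k}"
  have "{m. Suc k < m \<and> m \<le> length \<eta> \<and> j \<le> \<eta> ! (m - 1) \<and> \<eta> ! (m - 1) \<le> \<eta> ! (Suc k - 1)} = Suc ` ?A"
  proof (rule set_eqI)
    fix m show "m \<in> {m. Suc k < m \<and> m \<le> length \<eta> \<and> j \<le> \<eta> ! (m - 1) \<and> \<eta> ! (m - 1) \<le> \<eta> ! (Suc k - 1)} \<longleftrightarrow> m \<in> Suc ` ?A"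
      by (cases m) auto
  qed
  moreover have "{m. 1 \<le> m \<and> m < Suc k \<and> j \<le> \<eta> ! (m - 1) + 1 \<and> \<eta> ! (m - 1) + 1 \<le> \<eta> ! (Suc k - 1)} = Suc ` ?B"
  proof (rule set_eqI)
    fix m show "m \<in> {m. 1 \<le> m \<and> m < Suc k \<and> j \<le> \<eta> ! (m - 1) + 1 \<and> \<eta> ! (m - 1) + 1 \<le> \<eta> ! (Suc k - 1)} \<longleftrightarrow> m \<in> Suc ` ?B"
      by (cases m) auto
  qed
  ultimately have "leg \<eta> (Suc k) j = card ?A + card ?B"
    unfolding leg_def by (simp add: card_image)
  also have "\<dots> = nleg \<eta> k j"
    unfolding nleg_def
    by (subst card_Un_disjoint[symmetric]) (use assms in \<open>auto intro!: arg_cong[where f = card]\<close>)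
  finally show ?thesis .
qed

lemma coleg_Suc:
  assumes "k < length \<eta>"
  shows "coleg \<eta> (Suc k) j = level \<eta> k"
proof -
  let ?A = "{m. k < m \<and> m < length \<eta> \<and> \<eta> ! k < \<eta> ! m}" and ?B = "{m. m < k \<and> \<eta> ! k \<le> \<eta> ! m}"
  have "{m. Suc k < m \<and> m \<le> length \<eta> \<and> \<eta> ! (m - 1) > \<eta> ! (Suc k - 1)} = Suc ` ?A"
  proof (rule set_eqI)
    fix m show "m \<in> {m. Suc k < m \<and> m \<le> length \<eta> \<and> \<eta> ! (m - 1) > \<eta> ! (Suc k - 1)} \<longleftrightarrow> m \<in> Suc ` ?A"
      by (cases m) auto
  qed
  moreover have "{m. 1 \<le> m \<and> m < Suc k \<and> \<eta> ! (m - 1) \<ge> \<eta> ! (Suc k - 1)} = Suc ` ?B"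
  proof (rule set_eqI)
    fix m show "m \<in> {m. 1 \<le> m \<and> m < Suc k \<and> \<eta> ! (m - 1) \<ge> \<eta> ! (Suc k - 1)} \<longleftrightarrow> m \<in> Suc ` ?B"
      by (cases m) auto
  qed
  ultimately show ?thesis unfolding coleg_def level_split[OF assms] by (simp add: card_image)
qed

text \<open>One row of d for \<open>e\<close> = 1 and of d' for \<open>e\<close> = 0.\<close>

definition drow :: "'a::field \<Rightarrow> 'a \<Rightarrow> nat \<Rightarrow> nat list \<Rightarrow> nat \<Rightarrow> 'a" where
  "drow q t e \<eta> k = (\<Prod>j\<in>{1..\<eta> ! k}. 1 - q ^ (\<eta> ! k - j + 1) * t ^ (nleg \<eta> k j + e))"

definition erow :: "nat \<Rightarrow> 'a::field \<Rightarrow> 'a \<Rightarrow> nat \<Rightarrow> nat \<Rightarrow> 'a" where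
  "erow n q t l v = (\<Prod>j\<in>{1..v}. 1 - q ^ j * t ^ (n - l))"

lemma nodeprod_rows: "nodeprod \<eta> F = (\<Prod>k<length \<eta>. \<Prod>j\<in>{1..\<eta> ! k}. F (Suc k) j)"
  unfolding nodeprod_def by (simp add: One_nat_def prod.atLeast1_atMost_eq)

lemma dconst_rows: "dconst q t \<eta> = (\<Prod>k<length \<eta>. drow q t 1 \<eta> k)"
  unfolding dconst_def nodeprod_rows drow_def
  by (intro prod.cong refl) (simp add: arm_def leg_Suc)

lemma dconst'_rows: "dconst' q t \<eta> = (\<Prod>k<length \<eta>. drow q t 0 \<eta> k)"
  unfolding dconst'_def nodeprod_rows drow_def
  by (intro prod.cong refl) (simp add: arm_def leg_Suc)

lemma econst_rows: "econst n q t \<eta> = (\<Prod>k<length \<eta>. erow n q t (level \<eta> k) (\<eta> ! k))"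
  unfolding econst_def nodeprod_rows erow_def
  by (intro prod.cong refl) (simp add: coarm_def coleg_Suc)

section \<open>Effect of exchange and rotation on the node products\<close>

lemma inj_tr: "inj (tr i)"
  by (metis injI tr_tr)

text \<open>Rows match under \<open>tr\<close>. The only discrepancy is the node of the longer row
  just past the end of the shorter one: its leg counts the shorter row before the exchange, when
  that row precedes it, but not afterwards.\<close>

lemma nleg_nswp:
  assumes i: "1 \<le> i" "i < length \<eta>" and lt: "\<eta> ! (i - 1) < \<eta> ! i" and k: "k < length \<eta>"
  shows "nleg \<eta> (tr i k) j = nleg (nswp i \<eta>) k j + (if k = i - 1 \<and> j = Suc (\<eta> ! (i - 1)) then 1 else 0)"
proof -
  let ?n = "length \<eta>" and ?s = "nswp i \<eta>"
  let ?A = "{m. m < ?n \<and> (k < m \<and> j \<le> ?s ! m \<and> ?s ! m \<le> ?s ! k \<or> m < k \<and> j \<le> Suc (?s ! m) \<and> Suc (?s ! m) \<le> ?s ! k)}"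
  let ?B = "{m. m < ?n \<and> (tr i k < m \<and> j \<le> \<eta> ! m \<and> \<eta> ! m \<le> \<eta> ! tr i k
     \<or> m < tr i k \<and> j \<le> Suc (\<eta> ! m) \<and> Suc (\<eta> ! m) \<le> \<eta> ! tr i k)}"
  \<comment> \<open>The discrepancy as a set: empty, or the position of the shorter row.\<close>
  let ?X = "if k = i - 1 \<and> j = Suc (\<eta> ! (i - 1)) then {i - 1} else {}"
  have eq: "tr i m \<in> ?B \<longleftrightarrow> m \<in> ?A \<or> tr i m \<in> ?X" for m
  proof (cases "m < ?n")
    case True
    have tm: "tr i m < ?n" using True i by (simp add: tr_less)
    consider "m = i - 1" "k = i" | "m = i" "k = i - 1" | "m = k" | "m \<noteq> k" "\<not> (m = i - 1 \<and> k = i)" "\<not> (m = i \<and> k = i - 1)" by blast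
    then show ?thesis
    proof cases
      case 1
      then have "tr i m = i" "tr i k = i - 1" "i \<noteq> i - 1" using i by (auto simp: tr_def)
      then show ?thesis using 1 i lt True k by (simp add: nth_nswp)
    next
      case 2
      then have "tr i m = i - 1" "tr i k = i" using i by (auto simp: tr_def)
      then show ?thesis using 2 i lt True k by (auto simp: nth_nswp)
    next
      case 3
      then show ?thesis using i by (auto simp: tr_def)
    next
      case 4
      then have "tr i m < tr i k \<longleftrightarrow> m < k" "tr i k < tr i m \<longleftrightarrow> k < m"
        using i by (auto simp: tr_def split: if_splits)
      moreover have "tr i m \<notin> ?X" using 4 i by (auto simp: tr_def split: if_splits)
      ultimately show ?thesis using True tm i k by (simp add: nth_nswp)
    qed
  qed (use i tr_less[of i ?n m] in auto)
  have "?B = tr i ` ?A \<union> ?X"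
  proof (rule set_eqI)
    fix x
    have 1: "x \<in> ?B \<longleftrightarrow> tr i x \<in> ?A \<or> x \<in> ?X" using eq[of "tr i x"] unfolding tr_tr .
    have 2: "x \<in> tr i ` ?A \<longleftrightarrow> tr i x \<in> ?A"
      using inj_image_mem_iff[OF inj_tr, of i "tr i x"] unfolding tr_tr .
    show "x \<in> ?B \<longleftrightarrow> x \<in> tr i ` ?A \<union> ?X" by (simp only: 1 2 Un_iff)
  qed
  moreover have "tr i ` ?A \<inter> ?X = {}"
  proof (cases "k = i - 1 \<and> j = Suc (\<eta> ! (i - 1))")
    case True
    have "i \<notin> ?A" using True i lt k by (auto simp: nth_nswp tr_def)
    then have "tr i i \<notin> tr i ` ?A" by (simp only: inj_image_mem_iff[OF inj_tr] not_False_eq_True)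
    moreover have tri: "tr i i = i - 1" using i by (simp add: tr_def)
    ultimately have nx: "i - 1 \<notin> tr i ` ?A" by (simp only: tri not_False_eq_True)
    have X: "?X = {i - 1}" using True by simp
    show ?thesis unfolding X Int_insert_right_if0[OF nx] Int_empty_right ..
  next
    case False
    then show ?thesis by (simp only: if_False) blast
  qed
  ultimately have "card ?B = card (tr i ` ?A) + card ?X"
    by (simp add: card_Un_disjoint)
  also have "card (tr i ` ?A) = card ?A" by (rule card_image) (rule inj_on_subset[OF inj_tr subset_UNIV])
  finally show ?thesis by (simp add: nleg_def)
qed

text \<open>The rows counted in the level of the shorter row but not of the longer are those in the
  leg of the node just past the shorter row. This links the ratio of neighbouring eigenvalues to the
  special node.\<close>

lemma level_diff:
  assumes i: "1 \<le> i" "i < length \<eta>" and lt: "\<eta> ! (i - 1) < \<eta> ! i"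
  shows "level \<eta> (i - 1) = level \<eta> i + nleg \<eta> i (Suc (\<eta> ! (i - 1)))"
proof -
  let ?n = "length \<eta>" and ?a = "\<eta> ! (i - 1)" and ?b = "\<eta> ! i"
  let ?L = "{m. m < ?n \<and> (m < i - 1 \<and> ?a \<le> \<eta> ! m \<or> i - 1 < m \<and> ?a < \<eta> ! m)}"
  let ?M = "{m. m < ?n \<and> (m < i \<and> ?b \<le> \<eta> ! m \<or> i < m \<and> ?b < \<eta> ! m)}"
  let ?N = "{m. m < ?n \<and> (i < m \<and> Suc ?a \<le> \<eta> ! m \<and> \<eta> ! m \<le> ?b \<or> m < i \<and> Suc ?a \<le> Suc (\<eta> ! m) \<and> Suc (\<eta> ! m) \<le> ?b)}"
  have eq: "tr i m \<in> ?L \<longleftrightarrow> m \<in> ?M \<union> ?N" for m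
  proof -
    consider "m = i - 1" | "m = i" | "m < i - 1" | "i < m" using i by linarith
    then show ?thesis
    proof cases
      case 1
      then have "tr i m = i" by (simp add: tr_def)
      then show ?thesis using 1 i lt by auto
    next
      case 2
      then have "tr i m = i - 1" using i by (simp add: tr_def)
      then show ?thesis using 2 i lt by auto
    next
      case 3
      then have "tr i m = m" by (simp add: tr_def)
      then show ?thesis using 3 i lt by auto
    next
      case 4
      then have "tr i m = m" by (simp add: tr_def)
      then show ?thesis using 4 i lt by auto
    qed
  qed
  have "?L = tr i ` (?M \<union> ?N)"
  proof (rule set_eqI)
    fix x
    have "x \<in> ?L \<longleftrightarrow> tr i x \<in> ?M \<union> ?N" using eq[of "tr i x"] unfolding tr_tr .
    also have "\<dots> \<longleftrightarrow> x \<in> tr i ` (?M \<union> ?N)" using inj_image_mem_iff[OF inj_tr, of i "tr i x"] unfolding tr_tr ..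
    finally show "x \<in> ?L \<longleftrightarrow> x \<in> tr i ` (?M \<union> ?N)" .
  qed
  moreover have "card (tr i ` S) = card S" for S
    by (rule card_image) (rule inj_on_subset[OF inj_tr subset_UNIV])
  ultimately have "card ?L = card (?M \<union> ?N)" by (simp only:)
  also have "\<dots> = card ?M + card ?N" by (rule card_Un_disjoint) auto
  finally show ?thesis by (simp add: level_def nleg_def)
qed

lemma drow_swap:
  assumes i: "1 \<le> i" "i < length \<eta>" and lt: "\<eta> ! (i - 1) < \<eta> ! i" and k: "k < length \<eta>" "k \<noteq> i - 1"
  shows "drow q t e (nswp i \<eta>) k = drow q t e \<eta> (tr i k)"
  unfolding drow_def using i k by (intro prod.cong) (auto simp: nth_nswp nleg_nswp[OF i lt])

text \<open>\<open>X\<close> is q^(arm+1) t^leg at the special node of the exchanged composition.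
  The cross-multiplied form holds for all \<open>q\<close> and \<open>t\<close>.\<close>

lemma drow_swap_special:
  fixes q t :: "'a::field"
  assumes i: "1 \<le> i" "i < length \<eta>" and lt: "\<eta> ! (i - 1) < \<eta> ! i"
  defines "X \<equiv> q ^ (\<eta> ! i - \<eta> ! (i - 1)) * t ^ nleg (nswp i \<eta>) (i - 1) (Suc (\<eta> ! (i - 1)))"
  shows "drow q t e (nswp i \<eta>) (i - 1) * (1 - X * t ^ (1 + e)) = drow q t e \<eta> i * (1 - X * t ^ e)"
proof -
  let ?s = "nswp i \<eta>" and ?a = "\<eta> ! (i - 1)" and ?b = "\<eta> ! i"
  have k: "i - 1 < length \<eta>" using i by simp
  have tri: "tr i (i - 1) = i" by (simp add: tr_def)
  have sb: "?s ! (i - 1) = ?b" using i k by (simp add: nth_nswp tri)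
  have mem: "Suc ?a \<in> {1..?b}" using lt by auto
  let ?f = "\<lambda>\<zeta> k j. 1 - q ^ (?b - j + 1) * t ^ (nleg \<zeta> k j + e)"
  have rest: "(\<Prod>j\<in>{1..?b} - {Suc ?a}. ?f ?s (i - 1) j) = (\<Prod>j\<in>{1..?b} - {Suc ?a}. ?f \<eta> i j)"
    by (rule prod.cong) (use nleg_nswp[OF i lt k] tri in auto)
  have nl: "nleg \<eta> i (Suc ?a) = Suc (nleg ?s (i - 1) (Suc ?a))" using nleg_nswp[OF i lt k, of "Suc ?a"] tri by simp
  have ba: "?b - Suc ?a + 1 = ?b - ?a" using lt by simp
  have "?f ?s (i - 1) (Suc ?a) = 1 - X * t ^ e" "?f \<eta> i (Suc ?a) = 1 - X * t ^ (1 + e)"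
    unfolding nl ba X_def by (simp_all add: power_add mult_ac)
  moreover have "drow q t e ?s (i - 1) = ?f ?s (i - 1) (Suc ?a) * (\<Prod>j\<in>{1..?b} - {Suc ?a}. ?f ?s (i - 1) j)"
    unfolding drow_def sb using mem by (subst prod.remove[of _ "Suc ?a"]) auto
  moreover have "drow q t e \<eta> i = ?f \<eta> i (Suc ?a) * (\<Prod>j\<in>{1..?b} - {Suc ?a}. ?f \<eta> i j)"
    unfolding drow_def using mem by (subst prod.remove[of _ "Suc ?a"]) auto
  ultimately show ?thesis unfolding rest by (simp add: mult_ac)
qed

lemma drow_prod_swap:
  fixes q t :: "'a::field"
  assumes i: "1 \<le> i" "i < length \<eta>" and lt: "\<eta> ! (i - 1) < \<eta> ! i"
  defines "X \<equiv> q ^ (\<eta> ! i - \<eta> ! (i - 1)) * t ^ nleg (nswp i \<eta>) (i - 1) (Suc (\<eta> ! (i - 1)))"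
  shows "(\<Prod>k<length \<eta>. drow q t e (nswp i \<eta>) k) * (1 - X * t ^ (1 + e))
    = (\<Prod>k<length \<eta>. drow q t e \<eta> k) * (1 - X * t ^ e)"
proof -
  have ii: "i - 1 < length \<eta>" "i < length \<eta>" "i - 1 \<noteq> i" using i by auto
  have "(\<Prod>k\<in>{..<length \<eta>} - {i - 1, i}. drow q t e (nswp i \<eta>) k)
      = (\<Prod>k\<in>{..<length \<eta>} - {i - 1, i}. drow q t e \<eta> k)"
    by (rule prod.cong) (auto simp: drow_swap[OF i lt] tr_def)
  moreover have "drow q t e (nswp i \<eta>) i = drow q t e \<eta> (i - 1)"
    using drow_swap[OF i lt, of i] i ii(3)[symmetric] by (simp add: tr_def)
  moreover have "drow q t e (nswp i \<eta>) (i - 1) * (1 - X * t ^ (1 + e)) = drow q t e \<eta> i * (1 - X * t ^ e)"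
    unfolding X_def by (rule drow_swap_special[OF i lt])
  ultimately show ?thesis unfolding prod_split2[OF ii] by (simp add: mult_ac)
qed

text \<open>The product depends only on the pairs of entry and level, and these are merely
  permuted.\<close>

lemma econst_nswp:
  assumes i: "1 \<le> i" "i < length \<eta>" and ne: "\<eta> ! (i - 1) \<noteq> \<eta> ! i"
  shows "econst n q t (nswp i \<eta>) = econst n q t \<eta>"
  unfolding econst_rows length_nswp
  by (rule prod.reindex_bij_witness[of _ "tr i" "tr i"])
    (use i ne in \<open>auto simp: tr_tr tr_less level_nswp nth_nswp\<close>)

text \<open>Rotation keeps legs, with the columns of the lengthened row shifted by one. Its new
  first column corresponds to column 0 of the old first row, where \<open>nleg\<close> still makes
  sense.\<close>

lemma nleg_nphi:
  assumes ne: "\<eta> \<noteq> []" and k: "k < length \<eta>"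
  shows "nleg (nphi \<eta>) k (if Suc k = length \<eta> then Suc j else j)
    = nleg \<eta> (if Suc k = length \<eta> then 0 else Suc k) j"
proof -
  let ?n = "length \<eta>"
  define r where "r m = (if Suc m = ?n then 0 else Suc m)" for m
  define r' where "r' m = (if m = 0 then ?n - 1 else m - 1)" for m
  define j' where "j' = (if Suc k = ?n then Suc j else j)"
  have n0: "0 < ?n" using ne by simp
  let ?s = "nphi \<eta>"
  let ?A = "{m. m < ?n \<and> (k < m \<and> j' \<le> ?s ! m \<and> ?s ! m \<le> ?s ! k \<or> m < k \<and> j' \<le> Suc (?s ! m) \<and> Suc (?s ! m) \<le> ?s ! k)}"
  let ?B = "{m. m < ?n \<and> (r k < m \<and> j \<le> \<eta> ! m \<and> \<eta> ! m \<le> \<eta> ! r k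
     \<or> m < r k \<and> j \<le> Suc (\<eta> ! m) \<and> Suc (\<eta> ! m) \<le> \<eta> ! r k)}"
  have "card ?A = card ?B"
  proof (rule bij_betw_same_card[of r], rule bij_betw_byWitness[where f' = r'])
    show "\<forall>m\<in>?A. r' (r m) = m" "\<forall>m\<in>?B. r (r' m) = m" using n0 by (auto simp: r_def r'_def)
    show "r ` ?A \<subseteq> ?B" using k by (auto simp: r_def j'_def nth_nphi split: if_splits)
    show "r' ` ?B \<subseteq> ?A"
    proof
      fix x assume "x \<in> r' ` ?B"
      then obtain m where m: "m \<in> ?B" "x = r' m" by auto
      show "x \<in> ?A"
      proof (cases m)
        case 0
        then show ?thesis using m k n0 by (auto simp: r_def r'_def j'_def nth_nphi split: if_splits)
      next
        case (Suc l)
        then show ?thesis using m k n0 by (auto simp: r_def r'_def j'_def nth_nphi split: if_splits)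
      qed
    qed
  qed
  then show ?thesis using ne by (simp add: nleg_def r_def j'_def)
qed

lemma prod_atLeast1_Suc_shift:
  fixes f :: "nat \<Rightarrow> 'a::comm_monoid_mult"
  shows "(\<Prod>j\<in>{1..Suc v}. f j) = f 1 * (\<Prod>j\<in>{1..v}. f (Suc j))"
  unfolding One_nat_def by (simp only: prod.atLeast_Suc_atMost_Suc_shift prod.atLeast_Suc_atMost[of 0 v, simplified]) (simp add: prod.atLeast_Suc_atMost o_def)

lemma drow_prod_nphi:
  assumes ne: "\<eta> \<noteq> []"
  shows "(\<Prod>k<length \<eta>. drow q t e (nphi \<eta>) k)
    = (1 - q ^ Suc (\<eta> ! 0) * t ^ (nleg \<eta> 0 0 + e)) * (\<Prod>k<length \<eta>. drow q t e \<eta> k)"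
proof -
  obtain m where m: "length \<eta> = Suc m" using ne by (cases \<eta>) auto
  have "drow q t e (nphi \<eta>) k = drow q t e \<eta> (Suc k)" if "k < m" for k
  proof -
    have "nleg (nphi \<eta>) k j = nleg \<eta> (Suc k) j" for j using nleg_nphi[OF ne, of k j] that m by simp
    then show ?thesis unfolding drow_def using that m by (simp add: nth_nphi)
  qed
  then have "(\<Prod>k<m. drow q t e (nphi \<eta>) k) = (\<Prod>k<m. drow q t e \<eta> (Suc k))" by simp
  moreover have "drow q t e (nphi \<eta>) m = (1 - q ^ Suc (\<eta> ! 0) * t ^ (nleg \<eta> 0 0 + e)) * drow q t e \<eta> 0"
  proof -
    have nl: "nleg (nphi \<eta>) m (Suc j) = nleg \<eta> 0 j" for j using nleg_nphi[OF ne, of m j] m by simp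
    have v: "nphi \<eta> ! m = Suc (\<eta> ! 0)" using m by (simp add: nth_nphi)
    have "drow q t e (nphi \<eta>) m = (\<Prod>j\<in>{1..Suc (\<eta> ! 0)}. 1 - q ^ (Suc (\<eta> ! 0) - j + 1) * t ^ (nleg (nphi \<eta>) m j + e))"
      by (simp add: drow_def v)
    also have "\<dots> = (1 - q ^ (Suc (\<eta> ! 0) - 1 + 1) * t ^ (nleg (nphi \<eta>) m (Suc 0) + e)) *
        (\<Prod>j\<in>{1..\<eta> ! 0}. 1 - q ^ (Suc (\<eta> ! 0) - Suc j + 1) * t ^ (nleg (nphi \<eta>) m (Suc j) + e))"
      unfolding prod_atLeast1_Suc_shift by (simp add: One_nat_def)
    finally show ?thesis unfolding nl drow_def by (simp flip: Suc_eq_plus1)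
  qed
  ultimately show ?thesis unfolding m prod.lessThan_Suc[of "drow q t e (nphi \<eta>)"]
      prod.lessThan_Suc_shift[of "drow q t e \<eta>"]
    by (simp only: mult_ac)
qed

text \<open>Coarms are counted from the left, so the new factor belongs to the last column of the
  lengthened row, whereas in d and d' it belongs to the first.\<close>

lemma econst_nphi:
  assumes ne: "\<eta> \<noteq> []"
  shows "econst n q t (nphi \<eta>) = (1 - q ^ Suc (\<eta> ! 0) * t ^ (n - level \<eta> 0)) * econst n q t \<eta>"
proof -
  obtain m where m: "length \<eta> = Suc m" using ne by (cases \<eta>) auto
  have ln: "length (nphi \<eta>) = Suc m" using ne m by simp
  have "erow n q t (level (nphi \<eta>) k) (nphi \<eta> ! k) = erow n q t (level \<eta> (Suc k)) (\<eta> ! Suc k)" if "k < m" for k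
    using that m level_nphi[OF ne, of k] by (simp add: nth_nphi)
  then have "(\<Prod>k<m. erow n q t (level (nphi \<eta>) k) (nphi \<eta> ! k)) = (\<Prod>k<m. erow n q t (level \<eta> (Suc k)) (\<eta> ! Suc k))"
    by simp
  moreover have "erow n q t (level (nphi \<eta>) m) (nphi \<eta> ! m)
    = (1 - q ^ Suc (\<eta> ! 0) * t ^ (n - level \<eta> 0)) * erow n q t (level \<eta> 0) (\<eta> ! 0)"
    using m level_nphi[OF ne, of m] by (simp add: nth_nphi erow_def mult_ac)
  ultimately show ?thesis unfolding econst_rows ln m
      prod.lessThan_Suc[of "\<lambda>k. erow n q t (level (nphi \<eta>) k) (nphi \<eta> ! k)"]
      prod.lessThan_Suc_shift[of "\<lambda>k. erow n q t (level \<eta> k) (\<eta> ! k)"]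
    by (simp only: mult_ac)
qed

text \<open>Every other row is either at most as long as the first and counted in
  \<open>nleg\<close>, or longer and counted in \<open>level\<close>.\<close>

lemma nleg_zero:
  assumes "\<eta> \<noteq> []"
  shows "nleg \<eta> 0 0 + level \<eta> 0 + 1 = length \<eta>"
proof -
  let ?A = "{m. 0 < m \<and> m < length \<eta> \<and> \<eta> ! m \<le> \<eta> ! 0}" and ?B = "{m. 0 < m \<and> m < length \<eta> \<and> \<eta> ! 0 < \<eta> ! m}"
  have "nleg \<eta> 0 0 = card ?A" unfolding nleg_def by (rule arg_cong[where f = card]) auto
  moreover have "level \<eta> 0 = card ?B" unfolding level_def by (rule arg_cong[where f = card]) auto
  moreover have "card ?A + card ?B = card (?A \<union> ?B)" by (rule card_Un_disjoint[symmetric]) auto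
  moreover have "?A \<union> ?B = {1..<length \<eta>}" by auto
  ultimately have "nleg \<eta> 0 0 + level \<eta> 0 = length \<eta> - 1" by simp
  then show ?thesis using assms by (cases \<eta>) auto
qed

section \<open>Ratios of kernel coefficients\<close>

context macdonald
begin

lemma one_minus_qt_nonzero: "1 - q ^ Suc a * t ^ b \<noteq> 0"
proof
  assume "1 - q ^ Suc a * t ^ b = 0"
  then have "q powi int (Suc a) * t powi int b = 1" by (simp only: power_int_of_nat) simp
  then have "int (Suc a) = 0" using independent by blast
  then show False by simp
qed

lemma drow_nonzero: "drow q t e \<eta> k \<noteq> 0"
  unfolding drow_def using one_minus_qt_nonzero by (auto simp: prod_zero_iff simp flip: Suc_eq_plus1)

lemma erow_nonzero: "erow n q t l v \<noteq> 0"
proof -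
  have "1 - q ^ j * t ^ (n - l) \<noteq> 0" if "j \<in> {1..v}" for j
    using that one_minus_qt_nonzero[of "j - 1" "n - l"] by simp
  then show ?thesis unfolding erow_def by (simp add: prod_zero_iff)
qed

definition coef :: "nat list \<Rightarrow> 'a" where
  "coef \<eta> = dconst q t \<eta> / (dconst' q t \<eta> * econst n q t \<eta>)"

lemma const_nonzero: "dconst q t \<eta> \<noteq> 0" "dconst' q t \<eta> \<noteq> 0" "econst n q t \<eta> \<noteq> 0"
  unfolding dconst_rows dconst'_rows econst_rows
  using drow_nonzero erow_nonzero by (simp_all add: prod_zero_iff)

text \<open>The existential hides the special node; what matters is that the same \<open>X\<close>
  governs the ratio of coefficients and that of eigenvalues, hence \<open>alpha\<close>.\<close>

lemma coef_swap:
  assumes len: "length \<eta> = n" and i: "1 \<le> i" "i < n" and lt: "\<eta> ! (i - 1) < \<eta> ! i"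
  shows "\<exists>X. coef \<eta> * ((1 - X * t) * (1 - X * t)) = coef (nswp i \<eta>) * ((1 - X * t * t) * (1 - X))
    \<and> eigval q t \<eta> (i + 1) = X * t * eigval q t \<eta> i"
proof -
  let ?l = "nleg (nswp i \<eta>) (i - 1) (Suc (\<eta> ! (i - 1)))"
  define X where "X = q ^ (\<eta> ! i - \<eta> ! (i - 1)) * t ^ ?l"
  have il: "i < length \<eta>" using i len by simp
  note il' = i(1) il lt
  have d: "dconst q t (nswp i \<eta>) * (1 - X * t * t) = dconst q t \<eta> * (1 - X * t)"
    using drow_prod_swap[OF il', of q t 1] by (simp add: dconst_rows X_def power_add power2_eq_square mult.assoc)
  have d': "dconst' q t (nswp i \<eta>) * (1 - X * t) = dconst' q t \<eta> * (1 - X)"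
    using drow_prod_swap[OF il', of q t 0] by (simp add: dconst'_rows X_def)
  have e: "econst n q t (nswp i \<eta>) = econst n q t \<eta>"
    by (rule econst_nswp[OF i(1) il]) (use lt in simp)
  have c: "coef \<eta> * ((1 - X * t) * (1 - X * t)) = coef (nswp i \<eta>) * ((1 - X * t * t) * (1 - X))"
  proof -
    let ?D = "dconst q t \<eta>" and ?E = "dconst' q t \<eta>" and ?S = "dconst q t (nswp i \<eta>)" and ?R = "dconst' q t (nswp i \<eta>)"
    have "coef \<eta> * ((1 - X * t) * (1 - X * t)) = (?D * (1 - X * t)) * (?R * (1 - X * t)) / (?E * ?R * econst n q t \<eta>)"
      unfolding coef_def using const_nonzero[of \<eta>] const_nonzero[of "nswp i \<eta>"] by (simp add: field_simps)
    also have "\<dots> = (?S * (1 - X * t * t)) * (?E * (1 - X)) / (?E * ?R * econst n q t \<eta>)"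
      unfolding d d' ..
    also have "\<dots> = coef (nswp i \<eta>) * ((1 - X * t * t) * (1 - X))"
      unfolding coef_def e using const_nonzero[of \<eta>] const_nonzero[of "nswp i \<eta>"] by (simp add: field_simps)
    finally show ?thesis .
  qed
  have l: "level \<eta> (i - 1) = level \<eta> i + Suc ?l"
  proof -
    have "i - 1 < length \<eta>" using il by simp
    from nleg_nswp[OF il' this, of "Suc (\<eta> ! (i - 1))"]
    have "nleg \<eta> i (Suc (\<eta> ! (i - 1))) = Suc ?l" by (simp add: tr_def)
    then show ?thesis using level_diff[OF il'] by simp
  qed
  have "X * t * eigval q t \<eta> i = (q ^ (\<eta> ! i - \<eta> ! (i - 1)) * q ^ (\<eta> ! (i - 1))) * (t ^ Suc ?l * t powi (- int (level \<eta> (i - 1))))"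
    using i len by (simp add: X_def eigval_level mult_ac)
  also have "q ^ (\<eta> ! i - \<eta> ! (i - 1)) * q ^ (\<eta> ! (i - 1)) = q ^ (\<eta> ! i)"
    using lt by (simp add: power_add[symmetric])
  also have "t ^ Suc ?l * t powi (- int (level \<eta> (i - 1))) = t powi (int (Suc ?l) + - int (level \<eta> (i - 1)))"
    using t_nz by (simp only: power_int_add power_int_of_nat simp_thms)
  also have "int (Suc ?l) + - int (level \<eta> (i - 1)) = - int (level \<eta> i)" unfolding l by simp
  finally have "eigval q t \<eta> (i + 1) = X * t * eigval q t \<eta> i" using i len by (simp add: eigval_level)
  then show ?thesis using c by blast
qed

text \<open>By \<open>nleg_zero\<close> the new factors of d and e coincide and cancel. The new
  factor of d' is the eigenvalue of \<open>Phihat\<close> after \<open>Phi\<close> on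
  \<open>E \<eta>\<close>.\<close>

lemma coef_nphi:
  assumes len: "length \<eta> = n"
  shows "coef (nphi \<eta>) * (1 - q * t ^ (n - 1) * eigval q t \<eta> 1) = coef \<eta>"
proof -
  have ne: "\<eta> \<noteq> []" using len n_pos by auto
  have ln: "length (nphi \<eta>) = length \<eta>" using ne by simp
  let ?l = "nleg \<eta> 0 0"
  have nl: "?l + level \<eta> 0 + 1 = n" using nleg_zero[OF ne] len by simp
  have d: "dconst q t (nphi \<eta>) = (1 - q ^ Suc (\<eta> ! 0) * t ^ Suc ?l) * dconst q t \<eta>"
    unfolding dconst_rows ln using drow_prod_nphi[OF ne, of q t 1] by (simp flip: Suc_eq_plus1)
  have d': "dconst' q t (nphi \<eta>) = (1 - q ^ Suc (\<eta> ! 0) * t ^ ?l) * dconst' q t \<eta>"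
    unfolding dconst'_rows ln using drow_prod_nphi[OF ne, of q t 0] by simp
  have "n - level \<eta> 0 = Suc ?l" using nl by simp
  then have e: "econst n q t (nphi \<eta>) = (1 - q ^ Suc (\<eta> ! 0) * t ^ Suc ?l) * econst n q t \<eta>"
    using econst_nphi[OF ne, of n q t] by simp
  have "q * t ^ (n - 1) * eigval q t \<eta> 1 = q ^ Suc (\<eta> ! 0) * (t ^ (n - 1) * t powi (- int (level \<eta> 0)))"
    using len n_pos by (simp add: eigval_level mult_ac)
  also have "t ^ (n - 1) * t powi (- int (level \<eta> 0)) = t powi (int (n - 1) + - int (level \<eta> 0))"
    using t_nz by (simp only: power_int_add power_int_of_nat simp_thms)
  also have "int (n - 1) + - int (level \<eta> 0) = int ?l" using nl by simp
  finally have y: "q * t ^ (n - 1) * eigval q t \<eta> 1 = q ^ Suc (\<eta> ! 0) * t ^ ?l" by (simp only: power_int_of_nat)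
  show ?thesis unfolding y coef_def d d' e
    using one_minus_qt_nonzero[of "\<eta> ! 0" "Suc ?l"] one_minus_qt_nonzero[of "\<eta> ! 0" ?l] const_nonzero[of \<eta>]
    by (simp del: power_Suc)
qed

end

section \<open>The reproducing kernel\<close>

text \<open>Degree shift by \<open>e\<close>, phrased through supports: it bounds the terms of the
  kernel that reach a given coefficient.\<close>

definition homog :: "nat \<Rightarrow> 'a::field lop \<Rightarrow> int \<Rightarrow> bool" where
  "homog n A e \<longleftrightarrow> (\<forall>f d. laurent n f \<longrightarrow> (\<forall>a. f a \<noteq> 0 \<longrightarrow> sum_list a = d) \<longrightarrow>
     (\<forall>a. A f a \<noteq> 0 \<longrightarrow> sum_list a = d + e))"

lemma homogD:
  "homog n A e \<Longrightarrow> laurent n f \<Longrightarrow> (\<And>a. f a \<noteq> 0 \<Longrightarrow> sum_list a = d) \<Longrightarrow> A f a \<noteq> 0 \<Longrightarrow> sum_list a = d + e"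
  unfolding homog_def by blast

lemma homog_comp:
  assumes A: "homog n A e" and B: "homog n B e'" and l: "linop n B"
  shows "homog n (\<lambda>f. A (B f)) (e' + e)"
  unfolding homog_def
proof (intro allI impI)
  fix f d a assume f: "laurent n f" and d: "\<forall>a. f a \<noteq> 0 \<longrightarrow> sum_list a = d" and nz: "A (B f) a \<noteq> 0"
  have "sum_list a = d + e'" if "B f a \<noteq> 0" for a using homogD[OF B f _ that, of d] d by blast
  then show "sum_list a = d + (e' + e)" using homogD[OF A linop_laurent[OF l f] _ nz, of "d + e'"] by simp
qed

lemma homog_id: "homog n (\<lambda>f. f) 0"
  by (simp add: homog_def)

lemma homog_plus:
  assumes "homog n A e" "homog n B e"
  shows "homog n (\<lambda>f a. A f a + B f a) e"
  unfolding homog_def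
proof (intro allI impI)
  fix f d a assume f: "laurent n f" and d: "\<forall>a. f a \<noteq> 0 \<longrightarrow> sum_list a = d" and nz: "A f a + B f a \<noteq> 0"
  from nz have "A f a \<noteq> 0 \<or> B f a \<noteq> 0" by auto
  then show "sum_list a = d + e" using homogD[OF assms(1) f] homogD[OF assms(2) f] d by blast
qed

lemma homog_scaled: "homog n A e \<Longrightarrow> homog n (\<lambda>f a. c * A f a) e"
  unfolding homog_def by auto

lemma homog_setsum:
  "(\<And>j. j \<in> J \<Longrightarrow> homog n (A j) e) \<Longrightarrow> homog n (\<lambda>f a. \<Sum>j\<in>J. A j f a) e"
proof (induction J rule: infinite_finite_induct)
  case (insert j J)
  then show ?case using homog_plus[of n "A j" e "\<lambda>f a. \<Sum>j\<in>J. A j f a"] by simp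
qed (simp_all add: homog_def)

lemma homog_comp_ops:
  assumes "\<And>A. A \<in> set As \<Longrightarrow> homog n A 0 \<and> linop n A"
  shows "homog n (comp_ops As) 0"
  using assms
proof (induction As)
  case Nil
  then show ?case by (simp add: homog_def)
next
  case (Cons A As)
  have "homog n (\<lambda>f. A (comp_ops As f)) (0 + 0)"
    by (rule homog_comp) (use Cons in \<open>auto intro!: linop_comp_ops\<close>)
  then show ?case by (simp add: comp_ops_def)
qed

lemma sum_list_update2:
  fixes a :: "int list"
  assumes "j < length a" "k < length a" "j \<noteq> k"
  shows "sum_list (a[j := x, k := y]) = sum_list a - a ! j - a ! k + x + y"
  using sum_update2[OF assms, of "\<lambda>v. v" x y] by (simp add: sum_list_sum_nth atLeast0LessThan)

lemma sum_list_swp: "1 \<le> i \<Longrightarrow> i < length a \<Longrightarrow> sum_list (swp i a) = sum_list (a :: int list)"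
  unfolding swp_def by (subst sum_list_update2) auto

lemma homog_sop:
  assumes "1 \<le> i" "i < n"
  shows "homog n (sop i) 0"
  unfolding homog_def sop_def
proof (intro allI impI)
  fix f :: "'a::field lpoly" and d a
  assume f: "laurent n f" and d: "\<forall>a. f a \<noteq> 0 \<longrightarrow> sum_list a = d" and nz: "f (swp i a) \<noteq> 0"
  have "length (swp i a) = n" using f nz laurent_length by blast
  then show "sum_list a = d + 0" using d nz assms sum_list_swp[of i a] by simp
qed

lemma homog_tauop: "homog n (tauop q i) 0"
  by (simp add: homog_def tauop_def)

lemma sum_list_update_int:
  fixes a :: "int list"
  shows "k < length a \<Longrightarrow> sum_list (a[k := x]) = sum_list a - a ! k + x"
proof (induction a arbitrary: k)
  case (Cons y a)
  then show ?case by (cases k) auto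
qed simp

lemma homog_mulx:
  assumes "1 \<le> i" "i \<le> n"
  shows "homog n (mulx i) 1"
  unfolding homog_def mulx_def
proof (intro allI impI)
  fix f :: "'a::field lpoly" and d a
  assume f: "laurent n f" and d: "\<forall>a. f a \<noteq> 0 \<longrightarrow> sum_list a = d" and nz: "f (a[i - 1 := a ! (i - 1) - 1]) \<noteq> 0"
  have "length (a[i - 1 := a ! (i - 1) - 1]) = n" using f nz laurent_length by blast
  then have "i - 1 < length a" using assms by simp
  then have "sum_list (a[i - 1 := a ! (i - 1) - 1]) = sum_list a - 1" by (simp add: sum_list_update_int)
  then show "sum_list a = d + 1" using d nz by force
qed

lemma homog_mulxinv:
  assumes "1 \<le> i" "i \<le> n"
  shows "homog n (mulxinv i) (- 1)"
  unfolding homog_def mulxinv_def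
proof (intro allI impI)
  fix f :: "'a::field lpoly" and d a
  assume f: "laurent n f" and d: "\<forall>a. f a \<noteq> 0 \<longrightarrow> sum_list a = d" and nz: "f (a[i - 1 := a ! (i - 1) + 1]) \<noteq> 0"
  have "length (a[i - 1 := a ! (i - 1) + 1]) = n" using f nz laurent_length by blast
  then have "i - 1 < length a" using assms by simp
  then have "sum_list (a[i - 1 := a ! (i - 1) + 1]) = sum_list a + 1" by (simp add: sum_list_update_int)
  then show "sum_list a = d + - 1" using d nz by force
qed

context hecke
begin

text \<open>At an exponent of another degree all coefficients entering \<open>T_coeff\<close>
  vanish, so the formula applies and gives 0 without unfolding the divided difference.\<close>

lemma homog_T:
  assumes i: "1 \<le> i" "i < n"
  shows "homog n (T i) 0"
  unfolding homog_def
proof (intro allI impI, rule ccontr)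
  fix f :: "'a lpoly" and d a
  assume f: "laurent n f" and d: "\<forall>a. f a \<noteq> 0 \<longrightarrow> sum_list a = d" and nz: "T i f a \<noteq> 0" and ne: "sum_list a \<noteq> d + 0"
  have len: "length a = n" using nz laurent_T[OF f i] laurent_length by blast
  have ii: "i - 1 < length a" "i < length a" "i - 1 \<noteq> i" using i len by auto
  have "f (a[i - 1 := x, i := y]) = 0" if "x + y = a ! (i - 1) + a ! i" for x y
    using d ne sum_list_update2[OF ii, of x y] that by fastforce
  moreover have "f (swp i a) = 0" using d ne sum_list_swp[of i a] i len by force
  moreover have "f a = 0" using d ne by auto
  ultimately have "T i f a = 0" using T_coeff[OF f i len] by simp
  then show False using nz by simp
qed

lemma homog_Ti: "1 \<le> i \<Longrightarrow> i < n \<Longrightarrow> homog n (Ti i) 0"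
  using homog_plus[OF homog_scaled[OF homog_id] homog_scaled[OF homog_T], of i "inverse t - 1" "inverse t"]
  by (simp add: Tinv_def[abs_def])

lemma homog_Ts: "set ks \<subseteq> {1..<n} \<Longrightarrow> homog n (comp_ops (map T ks)) 0"
  by (rule homog_comp_ops) (auto intro!: homog_T linop_T)

lemma homog_Tis: "set ks \<subseteq> {1..<n} \<Longrightarrow> homog n (comp_ops (map Ti ks)) 0"
  by (rule homog_comp_ops) (auto intro!: homog_Ti linop_Ti)

lemma homog_Phi: "1 \<le> n \<Longrightarrow> homog n Phi 1"
proof -
  assume "1 \<le> n"
  then have "homog n (\<lambda>f. mulx n (comp_ops (map Ti (rev [1..<n])) f)) (0 + 1)"
    by (intro homog_comp[of n "mulx n" 1 "comp_ops (map Ti (rev [1..<n]))" 0] homog_mulx homog_Tis linop_Tis) auto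
  then show ?thesis by (simp add: Phiop_def[abs_def])
qed

end

section \<open>Recursion for the operators D_i, and the matrix of T_i\<close>

context macdonald
begin

text \<open>The bracket in front of Y_i in D_i, without the factor t^(n-1).\<close>

definition Bop :: "nat \<Rightarrow> 'a lop" where
  "Bop i g = (\<lambda>a. g a + (inverse t - 1) * (\<Sum>j\<in>{i + 1..n}. t ^ (j - i) * Tijinv n t i j g a))"

lemma Dop_eq: "Dop n q t i f = mulxinv i (\<lambda>a. f a - t ^ (n - 1) * Bop i (Y i f) a)"
  by (simp add: Dop_def Bop_def Let_def)

lemma linop_Tijinv: "1 \<le> i \<Longrightarrow> j \<le> n \<Longrightarrow> linop n (Tijinv n t i j)"
  unfolding Tijinv_def by (rule linop_Tis) auto

lemma homog_Tijinv: "1 \<le> i \<Longrightarrow> j \<le> n \<Longrightarrow> homog n (Tijinv n t i j) 0"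
  unfolding Tijinv_def by (rule homog_Tis) auto

lemma linop_Bop: "1 \<le> i \<Longrightarrow> linop n (Bop i)"
  unfolding Bop_def[abs_def]
  by (rule linop_plus[OF linop_id], rule linop_scaled, rule linop_setsum, rule linop_scaled, rule linop_Tijinv) auto

lemma homog_Bop: "1 \<le> i \<Longrightarrow> homog n (Bop i) 0"
  unfolding Bop_def[abs_def]
  by (rule homog_plus[OF homog_id], rule homog_scaled, rule homog_setsum, rule homog_scaled, rule homog_Tijinv) auto

lemma homog_Y: "1 \<le> i \<Longrightarrow> i \<le> n \<Longrightarrow> homog n (Y i) 0"
proof -
  assume i: "1 \<le> i" "i \<le> n"
  have om: "homog n om 0"
    unfolding omega_def by (rule homog_comp_ops) (auto intro!: homog_sop homog_tauop linop_sop linop_tauop)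
  have "homog n (comp_ops (map T [i..<n] @ [om] @ map Ti [1..<i])) 0"
    by (rule homog_comp_ops) (use i om in \<open>auto intro!: linop_T linop_Ti linop_omega homog_T homog_Ti\<close>)
  from homog_scaled[OF this] show ?thesis by (simp add: Yop_def[abs_def] Let_def)
qed

lemma Dop_inner:
  assumes i: "1 \<le> i" "i \<le> n"
  shows "linop n (\<lambda>f a. f a - t ^ (n - 1) * Bop i (Y i f) a)"
    and "homog n (\<lambda>f a. f a - t ^ (n - 1) * Bop i (Y i f) a) 0"
proof -
  have l: "linop n (\<lambda>f. Bop i (Y i f))" by (rule linop_comp[OF linop_Bop[OF i(1)] linop_Y[OF i]])
  have h: "homog n (\<lambda>f. Bop i (Y i f)) 0"
    using homog_comp[OF homog_Bop[OF i(1)] homog_Y[OF i] linop_Y[OF i]] by simp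
  show "linop n (\<lambda>f a. f a - t ^ (n - 1) * Bop i (Y i f) a)"
    using linop_plus[OF linop_id linop_scaled[OF l, of "- (t ^ (n - 1))"]] by simp
  show "homog n (\<lambda>f a. f a - t ^ (n - 1) * Bop i (Y i f) a) 0"
    using homog_plus[OF homog_id homog_scaled[OF h, of "- (t ^ (n - 1))"]] by simp
qed

lemma linop_Dop: "1 \<le> i \<Longrightarrow> i \<le> n \<Longrightarrow> linop n (Dop n q t i)"
  unfolding Dop_eq[abs_def] by (rule linop_comp[OF linop_mulxinv Dop_inner(1)]) auto

lemma homog_Dop:
  assumes i: "1 \<le> i" "i \<le> n"
  shows "homog n (Dop n q t i) (- 1)"
  using homog_comp[OF homog_mulxinv[OF i] Dop_inner(2)[OF i] Dop_inner(1)[OF i]]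
  by (simp add: Dop_eq[abs_def])

lemma linop_Phihat: "linop n (Phihat n q t)"
  unfolding Phihat_def
  by (rule linop_comp_ops) (use n_pos in \<open>auto intro!: linop_T linop_Dop\<close>)

lemma t_Ti_Ti:
  assumes g: "laurent n g" and i: "1 \<le> i" "i < n"
  shows "t * Ti i (Ti i g) a = g a + (inverse t - 1) * (t * Ti i g a)"
proof -
  have "Ti i (Ti i g) a = (inverse t - 1) * Ti i g a + inverse t * T i (Ti i g) a" by (simp add: Tinv_def)
  then have "t * Ti i (Ti i g) a = (t * inverse t) * g a + (inverse t - 1) * (t * Ti i g a)"
    using g i by (simp add: distrib_left mult_ac)
  then show ?thesis using t_nz by simp
qed

text \<open>For j > i + 1 multiplication by T_i^{-1} on both sides turns T_{i+1,j}^{-1} into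
  T_{ij}^{-1}. The term j = i + 1 comes from the quadratic relation, which rewrites t T_i^{-2} as 1
  + (t^{-1} - 1) t T_i^{-1}.\<close>

lemma Bop_step:
  assumes g: "laurent n g" and i: "1 \<le> i" "i < n"
  shows "Bop i g = (\<lambda>a. t * Ti i (Bop (i + 1) (Ti i g)) a)"
proof -
  have lg: "laurent n (Ti i g)" using g i by (rule laurent_Ti)
  let ?J = "{i + 1 + 1..n}" and ?X = "\<lambda>j. Tijinv n t (i + 1) j (Ti i g)"
  have lX: "laurent n (?X j)" if "j \<in> ?J" for j
    using that linop_laurent[OF linop_Tijinv lg] by simp
  have X: "Tijinv n t i j g = Ti i (?X j)" if "j \<in> ?J" for j
  proof -
    have "i < j" "i < j - 1" using that by auto
    then have "[i..<j] = i # [i + 1..<j]" "[i..<j - 1] = i # [i + 1..<j - 1]"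
      by (simp_all add: upt_conv_Cons flip: Suc_eq_plus1)
    then show ?thesis by (simp add: Tijinv_def)
  qed
  have lS: "laurent n (\<lambda>a. \<Sum>j\<in>?J. t ^ (j - (i + 1)) * ?X j a)" by (rule laurent_sum) (rule lX)
  have "Ti i (Bop (i + 1) (Ti i g)) = Ti i (\<lambda>a. 1 * Ti i g a + (inverse t - 1) * (\<Sum>j\<in>?J. t ^ (j - (i + 1)) * ?X j a))"
    unfolding Bop_def by simp
  also have "\<dots> = (\<lambda>a. 1 * Ti i (Ti i g) a + (inverse t - 1) * Ti i (\<lambda>a. \<Sum>j\<in>?J. t ^ (j - (i + 1)) * ?X j a) a)"
    by (rule linop_comb[OF linop_Ti[OF i] lg lS])
  also have "Ti i (\<lambda>a. \<Sum>j\<in>?J. t ^ (j - (i + 1)) * ?X j a) = (\<lambda>a. \<Sum>j\<in>?J. t ^ (j - (i + 1)) * Ti i (?X j) a)"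
    by (rule linop_sum[OF linop_Ti[OF i]]) (rule lX)
  finally have 1: "t * Ti i (Bop (i + 1) (Ti i g)) a = t * Ti i (Ti i g) a
      + (inverse t - 1) * (\<Sum>j\<in>?J. t * (t ^ (j - (i + 1)) * Ti i (?X j) a))" for a
    by (simp add: distrib_left mult.left_commute[of t "inverse t - 1"] sum_distrib_left)
  have "(\<Sum>j\<in>?J. t * (t ^ (j - (i + 1)) * Ti i (?X j) a)) = (\<Sum>j\<in>?J. t ^ (j - i) * Tijinv n t i j g a)" for a
  proof (rule sum.cong[OF refl])
    fix j assume j: "j \<in> ?J"
    then have "j - i = Suc (j - (i + 1))" by auto
    then show "t * (t ^ (j - (i + 1)) * Ti i (?X j) a) = t ^ (j - i) * Tijinv n t i j g a"
      unfolding X[OF j] by (simp add: mult.assoc)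
  qed
  note 2 = this
  have J: "{i + 1..n} = insert (i + 1) ?J" using i by auto
  have "Tijinv n t i (i + 1) g = Ti i g" by (simp add: Tijinv_def flip: Suc_eq_plus1)
  then have 3: "(\<Sum>j\<in>{i + 1..n}. t ^ (j - i) * Tijinv n t i j g a)
      = t * Ti i g a + (\<Sum>j\<in>?J. t ^ (j - i) * Tijinv n t i j g a)" for a
    unfolding J by (subst sum.insert) auto
  show ?thesis
  proof
    fix a
    show "Bop i g a = t * Ti i (Bop (i + 1) (Ti i g)) a"
      unfolding 1 2 t_Ti_Ti[OF g i] unfolding Bop_def 3 by (simp add: algebra_simps)
  qed
qed

text \<open>Since Y_{i+1} T_i = t T_i^{-1} Y_i, the recursion for the bracket moves T_i to its left;
  the factor x_{i+1}^{-1} then sits between two generators and \<open>T_mulxinv_T\<close>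
  applies.\<close>

lemma Dop_step:
  assumes f: "laurent n f" and i: "1 \<le> i" "i < n"
  shows "T i (Dop n q t (i + 1) (T i f)) = (\<lambda>a. t * Dop n q t i f a)"
proof -
  have i1: "1 \<le> i + 1" "i + 1 \<le> n" "i \<le> n" using i by auto
  have lT: "laurent n (T i f)" using f i by (rule laurent_T)
  let ?g = "Y i f"
  have lg: "laurent n ?g" by (rule laurent_Y[OF f i(1) i1(3)])
  have lTg: "laurent n (Ti i ?g)" using lg i by (rule laurent_Ti)
  have lB: "laurent n (Bop (i + 1) (Ti i ?g))" by (rule linop_laurent[OF linop_Bop[OF i1(1)] lTg])
  have lBi: "laurent n (Bop i ?g)" by (rule linop_laurent[OF linop_Bop[OF i(1)] lg])
  have "Y (i + 1) (T i f) = (\<lambda>a. t * Ti i (Y i (Ti i (T i f))) a)" by (rule Y_step[OF lT i])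
  then have "Y (i + 1) (T i f) = (\<lambda>a. t * Ti i ?g a)" using f i by simp
  then have "Bop (i + 1) (Y (i + 1) (T i f)) = (\<lambda>a. t * Bop (i + 1) (Ti i ?g) a)"
    using linop_scale[OF linop_Bop[OF i1(1)] lTg, of t] by simp
  also have "\<dots> = T i (Bop i ?g)"
    using linop_scale[OF linop_T[OF i] laurent_Ti[OF lB i], of t] lB i by (simp add: Bop_step[OF lg i])
  finally have B: "Bop (i + 1) (Y (i + 1) (T i f)) = T i (Bop i ?g)" .
  let ?h = "\<lambda>a. f a - t ^ (n - 1) * Bop i ?g a"
  have lh: "laurent n ?h" using laurent_comb[OF f lBi, of 1 "- (t ^ (n - 1))"] by simp
  have "T i ?h = (\<lambda>a. T i f a - t ^ (n - 1) * T i (Bop i ?g) a)"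
    using linop_comb[OF linop_T[OF i] f lBi, of 1 "- (t ^ (n - 1))"] by simp
  then have "Dop n q t (i + 1) (T i f) = mulxinv (i + 1) (T i ?h)" unfolding Dop_eq B by simp
  then show ?thesis using T_mulxinv_T[OF lh i] unfolding Dop_eq[of i f] by simp
qed

lemma macdonald_dual: "macdonald n (inverse q) (inverse t)"
proof
  fix a b :: int
  assume "inverse q powi a * inverse t powi b = 1"
  then have "q powi (- a) * t powi (- b) = 1" by (simp add: power_int_minus power_int_inverse)
  then show "a = 0 \<and> b = 0" using independent by fastforce
qed (use n_pos t_nz in auto)

text \<open>With \<open>offT\<close>, the matrix of T_i in one formula for ascents, descents and
  equal entries, so that sums over compositions are treated without case distinction.\<close>

definition diagT :: "nat \<Rightarrow> nat list \<Rightarrow> 'a" where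
  "diagT i \<eta> = (if \<eta> ! (i - 1) = \<eta> ! i then t else alpha \<eta> i)"

definition offT :: "nat \<Rightarrow> nat list \<Rightarrow> 'a" where
  "offT i \<eta> = (if \<eta> ! (i - 1) = \<eta> ! i then 0 else if \<eta> ! (i - 1) < \<eta> ! i then t
     else inverse t * (t - alpha (nswp i \<eta>) i) * (1 + alpha (nswp i \<eta>) i))"

lemma T_E:
  assumes "length \<eta> = n" "1 \<le> i" "i < n"
  shows "T i (E \<eta>) = (\<lambda>a. diagT i \<eta> * E \<eta> a + offT i \<eta> * E (nswp i \<eta>) a)"
proof (cases "\<eta> ! (i - 1)" "\<eta> ! i" rule: linorder_cases)
  case less
  then show ?thesis using T_E_ascent[OF assms less] by (simp add: diagT_def offT_def)
next
  case equal
  then show ?thesis using T_E_equal[OF assms equal] by (simp add: diagT_def offT_def)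
next
  case greater
  then show ?thesis using T_E_descent[OF assms greater] by (simp add: diagT_def offT_def)
qed

lemma E_degree:
  assumes "length \<eta> = n" "E \<eta> a \<noteq> 0"
  shows "sum_list a = int (sum_list \<eta>)"
proof -
  have b: "below a (map int \<eta>)" using E_support[OF assms] .
  have "sum_list a = psum a (length a)" by (simp add: psum_def sum_list_sum_nth atLeast0LessThan)
  also have "\<dots> = psum (map int \<eta>) (length (map int \<eta>))" using b by (auto simp: below_def)
  also have "\<dots> = sum_list (map int \<eta>)" by (simp add: psum_def sum_list_sum_nth atLeast0LessThan)
  also have "\<dots> = int (sum_list \<eta>)" by (induction \<eta>) auto
  finally show ?thesis .
qed

end

lemma eigval_inverse: "eigval (inverse q) (inverse t) \<eta> i = inverse (eigval q t \<eta> i)"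
  by (simp add: eigval_def Let_def power_inverse power_int_inverse)

text \<open>Two instances of the theory side by side: \<open>E\<close> in the variables x,
  \<open>dual.E\<close> with inverted parameters in y.\<close>

locale macdonald_pair = macdonald n q t + dual: macdonald n "inverse q" "inverse t"
  for n :: nat and q t :: "'a::field"
begin

abbreviation "KK \<equiv> KA n q t"

definition compos :: "nat \<Rightarrow> nat list set" where
  "compos N = {\<eta>. length \<eta> = n \<and> sum_list \<eta> \<le> N}"

lemma finite_compos: "finite (compos N)"
proof (rule finite_subset)
  show "compos N \<subseteq> {xs. set xs \<subseteq> {..N} \<and> length xs = n}"
    using member_le_sum_list by (fastforce simp: compos_def)
qed (rule finite_lists_length_eq, simp)

lemma KA_term_eq: "KA_term n q t \<eta> a b = coef \<eta> * E \<eta> a * dual.E \<eta> b"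
  by (simp add: KA_term_def coef_def)

text \<open>Both factors of a term have degree |\<eta>|, so a bound on either exponent leaves
  finitely many compositions. The fixed range \<open>compos N\<close> replaces the set of nonzero
  terms, which varies with the exponents.\<close>

lemma KA_expand:
  assumes "sum_list a \<le> int N \<or> sum_list b \<le> int N"
  shows "KK a b = (\<Sum>\<eta>\<in>compos N. coef \<eta> * E \<eta> a * dual.E \<eta> b)"
proof -
  have "{\<eta>. length \<eta> = n \<and> KA_term n q t \<eta> a b \<noteq> 0} \<subseteq> compos N"
  proof
    fix \<eta> assume "\<eta> \<in> {\<eta>. length \<eta> = n \<and> KA_term n q t \<eta> a b \<noteq> 0}"
    then have len: "length \<eta> = n" and "E \<eta> a \<noteq> 0" "dual.E \<eta> b \<noteq> 0" by (auto simp: KA_term_eq)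
    then have "sum_list a = int (sum_list \<eta>)" "sum_list b = int (sum_list \<eta>)"
      using E_degree dual.E_degree by auto
    then show "\<eta> \<in> compos N" using assms len by (auto simp: compos_def)
  qed
  then show ?thesis unfolding KA_def KA_term_eq
    by (intro sum.mono_neutral_left[OF finite_compos]) (auto simp: compos_def KA_term_eq)
qed

lemma opx_expand:
  assumes A: "linop n A" and N: "sum_list b \<le> int N"
  shows "opx A KK a b = (\<Sum>\<eta>\<in>compos N. coef \<eta> * A (E \<eta>) a * dual.E \<eta> b)"
proof -
  have "(\<lambda>a'. KK a' b) = (\<lambda>a'. \<Sum>\<eta>\<in>compos N. (coef \<eta> * dual.E \<eta> b) * E \<eta> a')"
    using KA_expand[of _ N b] N by (simp add: mult_ac)
  then have "opx A KK a b = (\<Sum>\<eta>\<in>compos N. (coef \<eta> * dual.E \<eta> b) * A (E \<eta>) a)"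
    unfolding opx_def using linop_sum[OF A, of "compos N" E "\<lambda>\<eta>. coef \<eta> * dual.E \<eta> b"] laurent_E
    by (simp add: compos_def)
  then show ?thesis by (simp add: mult_ac)
qed

lemma opy_expand:
  assumes B: "linop n B" and N: "sum_list a \<le> int N"
  shows "opy B KK a b = (\<Sum>\<eta>\<in>compos N. coef \<eta> * E \<eta> a * B (dual.E \<eta>) b)"
proof -
  have "KK a = (\<lambda>b'. \<Sum>\<eta>\<in>compos N. (coef \<eta> * E \<eta> a) * dual.E \<eta> b')"
    using KA_expand[of a N] N by (simp add: fun_eq_iff)
  then show ?thesis
    unfolding opy_def using linop_sum[OF B, of "compos N" dual.E "\<lambda>\<eta>. coef \<eta> * E \<eta> a"] dual.laurent_E
    by (simp add: compos_def)
qed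

text \<open>For homogeneous operators the truncation can be chosen independently of the other variable,
  so that operators in \<open>x\<close> and in \<open>y\<close> commute on the kernel.\<close>

lemma opx_opy:
  assumes A: "linop n A" "homog n A e" and B: "linop n B" "homog n B e'"
  shows "opx A (opy B KK) = opy B (opx A KK)"
proof (intro ext)
  fix a b :: "int list"
  \<comment> \<open>Terms beyond \<open>N\<close> reach neither the coefficient at \<open>b\<close>
    after \<open>B\<close> nor the one at \<open>a\<close> after \<open>A\<close>, since degrees are
    shifted by \<open>e'\<close> and \<open>e\<close>.\<close>
  define N where "N = nat (max (sum_list b - e') (sum_list a - e))"
  have Nb: "sum_list b - e' \<le> int N" and Na: "sum_list a - e \<le> int N" by (auto simp: N_def)
  have sub: "compos N \<subseteq> compos M" if "N \<le> M" for M using that by (auto simp: compos_def)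
  have y: "opy B KK a' b = (\<Sum>\<eta>\<in>compos N. (coef \<eta> * B (dual.E \<eta>) b) * E \<eta> a')" for a'
  proof -
    \<comment> \<open>The general expansion depends on the degree of \<open>a'\<close>; the degree
      shift of \<open>B\<close> then cuts it down to \<open>N\<close>, uniformly in
      \<open>a'\<close>.\<close>
    define M where "M = max N (nat (sum_list a'))"
    have "opy B KK a' b = (\<Sum>\<eta>\<in>compos M. coef \<eta> * E \<eta> a' * B (dual.E \<eta>) b)"
      by (rule opy_expand[OF B(1)]) (simp add: M_def)
    also have "\<dots> = (\<Sum>\<eta>\<in>compos N. coef \<eta> * E \<eta> a' * B (dual.E \<eta>) b)"
    proof (rule sum.mono_neutral_right[OF finite_compos])
      show "compos N \<subseteq> compos M" by (rule sub) (simp add: M_def)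
      show "\<forall>\<eta>\<in>compos M - compos N. coef \<eta> * E \<eta> a' * B (dual.E \<eta>) b = 0"
      proof
        fix \<eta> assume "\<eta> \<in> compos M - compos N"
        then have len: "length \<eta> = n" and gt: "N < sum_list \<eta>" by (auto simp: compos_def)
        have "B (dual.E \<eta>) b = 0"
        proof (rule ccontr)
          assume "B (dual.E \<eta>) b \<noteq> 0"
          then have "sum_list b = int (sum_list \<eta>) + e'"
            using homogD[OF B(2) dual.laurent_E[OF len], of "int (sum_list \<eta>)" b] dual.E_degree[OF len] by blast
          then show False using Nb gt by simp
        qed
        then show "coef \<eta> * E \<eta> a' * B (dual.E \<eta>) b = 0" by simp
      qed
    qed
    finally show ?thesis by (simp add: mult_ac)
  qed
  have x: "opx A KK a b' = (\<Sum>\<eta>\<in>compos N. (coef \<eta> * A (E \<eta>) a) * dual.E \<eta> b')" for b'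
  proof -
    define M where "M = max N (nat (sum_list b'))"
    have "opx A KK a b' = (\<Sum>\<eta>\<in>compos M. coef \<eta> * A (E \<eta>) a * dual.E \<eta> b')"
      by (rule opx_expand[OF A(1)]) (simp add: M_def)
    also have "\<dots> = (\<Sum>\<eta>\<in>compos N. coef \<eta> * A (E \<eta>) a * dual.E \<eta> b')"
    proof (rule sum.mono_neutral_right[OF finite_compos])
      show "compos N \<subseteq> compos M" by (rule sub) (simp add: M_def)
      show "\<forall>\<eta>\<in>compos M - compos N. coef \<eta> * A (E \<eta>) a * dual.E \<eta> b' = 0"
      proof
        fix \<eta> assume "\<eta> \<in> compos M - compos N"
        then have len: "length \<eta> = n" and gt: "N < sum_list \<eta>" by (auto simp: compos_def)
        have "A (E \<eta>) a = 0"
        proof (rule ccontr)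
          assume "A (E \<eta>) a \<noteq> 0"
          then have "sum_list a = int (sum_list \<eta>) + e"
            using homogD[OF A(2) laurent_E[OF len], of "int (sum_list \<eta>)" a] E_degree[OF len] by blast
          then show False using Na gt by simp
        qed
        then show "coef \<eta> * A (E \<eta>) a * dual.E \<eta> b' = 0" by simp
      qed
    qed
    finally show ?thesis .
  qed
  have "opx A (opy B KK) a b = (\<Sum>\<eta>\<in>compos N. (coef \<eta> * B (dual.E \<eta>) b) * A (E \<eta>) a)"
    unfolding opx_def y using linop_sum[OF A(1), of "compos N" E "\<lambda>\<eta>. coef \<eta> * B (dual.E \<eta>) b"] laurent_E
    by (simp add: compos_def)
  moreover have "opy B (opx A KK) a b = (\<Sum>\<eta>\<in>compos N. (coef \<eta> * A (E \<eta>) a) * B (dual.E \<eta>) b)"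
    unfolding opy_def x using linop_sum[OF B(1), of "compos N" dual.E "\<lambda>\<eta>. coef \<eta> * A (E \<eta>) a"] dual.laurent_E
    by (simp add: compos_def)
  ultimately show "opx A (opy B KK) a b = opy B (opx A KK) a b" by (simp add: mult_ac)
qed

lemma laurent_KK_x: "laurent n (\<lambda>a. KK a b)"
proof -
  have "(\<lambda>a. KK a b) = (\<lambda>a. \<Sum>\<eta>\<in>compos (nat (sum_list b)). (coef \<eta> * dual.E \<eta> b) * E \<eta> a)"
    using KA_expand[of _ "nat (sum_list b)" b] by (simp add: mult_ac)
  moreover have "laurent n \<dots>" by (rule laurent_sum, rule laurent_E) (simp add: compos_def)
  ultimately show ?thesis by simp
qed

lemma laurent_KK_y: "laurent n (KK a)"
proof -
  have "KK a = (\<lambda>b. \<Sum>\<eta>\<in>compos (nat (sum_list a)). (coef \<eta> * E \<eta> a) * dual.E \<eta> b)"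
    using KA_expand[of a "nat (sum_list a)"] by (simp add: fun_eq_iff)
  moreover have "laurent n \<dots>" by (rule laurent_sum, rule dual.laurent_E) (simp add: compos_def)
  ultimately show ?thesis by simp
qed

text \<open>The inverse generator at the inverse parameters is t - 1 + t times the generator there;
  this matches its diagonal entry with that of T_i at (q,t).\<close>

lemma diagT_rel:
  assumes "length \<eta> = n" "1 \<le> i" "i < n"
  shows "diagT i \<eta> = t - 1 + t * dual.diagT i \<eta>"
proof (cases "\<eta> ! (i - 1) = \<eta> ! i")
  case True
  then show ?thesis using t_nz by (simp add: diagT_def dual.diagT_def)
next
  case False
  define y z where "y = eigval q t \<eta> i" and "z = eigval q t \<eta> (i + 1)"
  have nz: "y \<noteq> 0" "z \<noteq> 0" "y \<noteq> z"
    using eigval_nonzero[OF assms(1)] assms alpha_special(3)[OF assms False] by (auto simp: y_def z_def)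
  have a: "alpha \<eta> i = (t - 1) * y / (y - z)" by (simp add: alpha_def y_def z_def)
  have "inverse y - inverse z = (z - y) / (y * z)" using nz by (simp add: divide_simps)
  then have "dual.alpha \<eta> i = (inverse t - 1) * z / (z - y)"
    unfolding dual.alpha_def eigval_inverse y_def[symmetric] z_def[symmetric] using nz by (simp add: divide_simps)
  then have "t * dual.alpha \<eta> i = (1 - t) * z / (z - y)"
    using t_nz by (simp add: right_diff_distrib left_diff_distrib)
  then have "t - 1 + t * dual.alpha \<eta> i = alpha \<eta> i" unfolding a using nz
    by (simp add: divide_simps) (simp add: algebra_simps)
  then show ?thesis using False by (simp add: diagT_def dual.diagT_def)
qed

text \<open>In terms of the special node both factors are (1 - X t^2) (1 - X) / (1 - X t)^2,
  although \<open>alpha\<close> differs at the two sets of parameters.\<close>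

lemma coef_ratio:
  assumes len: "length \<eta> = n" and i: "1 \<le> i" "i < n" and lt: "\<eta> ! (i - 1) < \<eta> ! i"
  shows "coef \<eta> = coef (nswp i \<eta>) * (inverse t * (t - alpha \<eta> i) * (1 + alpha \<eta> i))"
    and "coef \<eta> = coef (nswp i \<eta>) * (t * (inverse t - dual.alpha \<eta> i) * (1 + dual.alpha \<eta> i))"
proof -
  obtain X where X: "coef \<eta> * ((1 - X * t) * (1 - X * t)) = coef (nswp i \<eta>) * ((1 - X * t * t) * (1 - X))"
    "eigval q t \<eta> (i + 1) = X * t * eigval q t \<eta> i" using coef_swap[OF assms] by blast
  define y where "y = eigval q t \<eta> i"
  have ne: "\<eta> ! (i - 1) \<noteq> \<eta> ! i" using lt by simp
  have nz: "y \<noteq> 0" "X * t * y \<noteq> 0" "X * t * y \<noteq> y"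
    using eigval_nonzero[OF len, of i] eigval_nonzero[OF len, of "i + 1"] alpha_special(3)[OF len i ne] i
    unfolding X(2)[symmetric] y_def by auto
  \<comment> \<open>Nonzero because the two neighbouring eigenvalues differ.\<close>
  define w where "w = 1 - X * t"
  have w: "w \<noteq> 0" "X \<noteq> 0" using nz by (auto simp: w_def)
  have "y - X * t * y = w * y" by (simp add: w_def algebra_simps)
  then have al: "alpha \<eta> i = (t - 1) / w"
    unfolding alpha_def X(2) y_def[symmetric] using nz by simp
  have 1: "(t - alpha \<eta> i) = (1 - X * t * t) / w" unfolding al using w by (simp add: divide_simps) (simp add: w_def algebra_simps)
  have 2: "1 + alpha \<eta> i = t * (1 - X) / w" unfolding al using w by (simp add: divide_simps) (simp add: w_def algebra_simps)
  have c: "coef \<eta> = coef (nswp i \<eta>) * ((1 - X * t * t) * (1 - X)) / (w * w)"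
    using X(1) w unfolding w_def[symmetric] by (simp add: divide_simps)
  show "coef \<eta> = coef (nswp i \<eta>) * (inverse t * (t - alpha \<eta> i) * (1 + alpha \<eta> i))"
    unfolding c 1 2 using t_nz w by (simp add: divide_simps)
  have "inverse y - inverse (X * t * y) = - w / (X * t * y)" using nz by (simp add: divide_simps) (simp add: w_def algebra_simps)
  then have al': "dual.alpha \<eta> i = (t - 1) * X / w"
    unfolding dual.alpha_def eigval_inverse X(2) y_def[symmetric] using nz w t_nz
    by (simp add: divide_simps) (simp add: algebra_simps)
  have 3: "inverse t - dual.alpha \<eta> i = (1 - X * t * t) / (t * w)"
    unfolding al' using w t_nz by (simp add: divide_simps) (simp add: w_def algebra_simps)
  have 4: "1 + dual.alpha \<eta> i = (1 - X) / w"
    unfolding al' using w by (simp add: divide_simps) (simp add: w_def algebra_simps)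
  show "coef \<eta> = coef (nswp i \<eta>) * (t * (inverse t - dual.alpha \<eta> i) * (1 + dual.alpha \<eta> i))"
    unfolding c 3 4 using t_nz w by (simp add: divide_simps)
qed

text \<open>Matches the off-diagonal terms after reindexing by s_i: an ascent uses the first form of
  \<open>coef_ratio\<close>, a descent the second at s_i \<eta>. The factor t is the one in the
  inverse generator at the inverse parameters.\<close>

lemma offT_rel:
  assumes len: "length \<eta> = n" and i: "1 \<le> i" "i < n"
  shows "coef (nswp i \<eta>) * offT i (nswp i \<eta>) = t * (coef \<eta> * dual.offT i \<eta>)"
proof -
  have il: "i < length \<eta>" using i len by simp
  have s: "nswp i \<eta> ! (i - 1) = \<eta> ! i" "nswp i \<eta> ! i = \<eta> ! (i - 1)"
    using i il by (auto simp: nswp_def nth_list_update)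
  have ss: "nswp i (nswp i \<eta>) = \<eta>" using i il by (simp add: nswp_nswp)
  have ls: "length (nswp i \<eta>) = n" using len by simp
  show ?thesis
  proof (cases "\<eta> ! (i - 1)" "\<eta> ! i" rule: linorder_cases)
    case less
    then show ?thesis using coef_ratio(1)[OF len i less] t_nz by (simp add: offT_def dual.offT_def s ss)
  next
    case equal
    then show ?thesis by (simp add: offT_def dual.offT_def s)
  next
    case greater
    then have lt: "nswp i \<eta> ! (i - 1) < nswp i \<eta> ! i" by (simp add: s)
    show ?thesis using coef_ratio(2)[OF ls i lt] greater by (simp add: offT_def dual.offT_def s ss mult_ac)
  qed
qed

lemma kernel_T:
  assumes i: "1 \<le> i" "i < n"
  shows "opx (T i) KK = opy (dual.Ti i) KK"
proof (intro ext)
  fix a b :: "int list"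
  define N where "N = nat (max (sum_list a) (sum_list b))"
  have N: "sum_list a \<le> int N" "sum_list b \<le> int N" by (auto simp: N_def)
  let ?S = "compos N" and ?E' = "dual.E"
  have inS: "length \<eta> = n" if "\<eta> \<in> ?S" for \<eta> using that by (simp add: compos_def)
  have swS: "nswp i \<eta> \<in> ?S" if "\<eta> \<in> ?S" for \<eta>
  proof -
    have "mset (nswp i \<eta>) = mset \<eta>" unfolding nswp_def using i inS[OF that] by (intro mset_swap) auto
    then have "sum_list (nswp i \<eta>) = sum_list \<eta>" by (metis sum_mset_sum_list)
    then show ?thesis using that by (simp add: compos_def)
  qed
  have ss: "nswp i (nswp i \<eta>) = \<eta>" if "\<eta> \<in> ?S" for \<eta> using i inS[OF that] by (simp add: nswp_nswp)
  have "opx (T i) KK a b = (\<Sum>\<eta>\<in>?S. coef \<eta> * T i (E \<eta>) a * ?E' \<eta> b)"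
    by (rule opx_expand[OF linop_T[OF i] N(2)])
  also have "\<dots> = (\<Sum>\<eta>\<in>?S. coef \<eta> * diagT i \<eta> * E \<eta> a * ?E' \<eta> b)
      + (\<Sum>\<eta>\<in>?S. coef \<eta> * offT i \<eta> * E (nswp i \<eta>) a * ?E' \<eta> b)"
    unfolding sum.distrib[symmetric]
    by (rule sum.cong[OF refl]) (simp add: T_E[OF inS i] algebra_simps)
  \<comment> \<open>Exchanging the summation index isolates \<open>E \<eta>\<close> in x, to be
    matched with the off-diagonal part in y.\<close>
  also have "(\<Sum>\<eta>\<in>?S. coef \<eta> * offT i \<eta> * E (nswp i \<eta>) a * ?E' \<eta> b)
      = (\<Sum>\<eta>\<in>?S. coef (nswp i \<eta>) * offT i (nswp i \<eta>) * E \<eta> a * ?E' (nswp i \<eta>) b)"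
    by (rule sum.reindex_bij_witness[of _ "nswp i" "nswp i"]) (use swS ss in auto)
  also have "\<dots> = (\<Sum>\<eta>\<in>?S. t * (coef \<eta> * dual.offT i \<eta>) * E \<eta> a * ?E' (nswp i \<eta>) b)"
    by (rule sum.cong[OF refl]) (simp add: offT_rel[OF inS i])
  also have "(\<Sum>\<eta>\<in>?S. coef \<eta> * diagT i \<eta> * E \<eta> a * ?E' \<eta> b)
      = (\<Sum>\<eta>\<in>?S. coef \<eta> * (t - 1 + t * dual.diagT i \<eta>) * E \<eta> a * ?E' \<eta> b)"
    by (rule sum.cong[OF refl]) (simp add: diagT_rel[OF inS i])
  also have "\<dots> + (\<Sum>\<eta>\<in>?S. t * (coef \<eta> * dual.offT i \<eta>) * E \<eta> a * ?E' (nswp i \<eta>) b)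
      = (\<Sum>\<eta>\<in>?S. coef \<eta> * E \<eta> a * dual.Ti i (?E' \<eta>) b)"
    unfolding sum.distrib[symmetric]
    by (rule sum.cong[OF refl]) (simp add: Tinv_def dual.T_E[OF inS i] algebra_simps)
  also have "\<dots> = opy (dual.Ti i) KK a b" by (rule opy_expand[OF dual.linop_Ti[OF i] N(1), symmetric])
  finally show "opx (T i) KK a b = opy (dual.Ti i) KK a b" .
qed

lemma kernel_Ti:
  assumes i: "1 \<le> i" "i < n"
  shows "opx (Ti i) KK = opy (dual.T i) KK"
proof (intro ext)
  fix a b :: "int list"
  have "opx (Ti i) KK a b = (inverse t - 1) * KK a b + inverse t * opx (T i) KK a b"
    by (simp add: opx_def Tinv_def)
  also have "opx (T i) KK a b = (t - 1) * KK a b + t * opy (dual.T i) KK a b"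
    unfolding kernel_T[OF i] by (simp add: opy_def Tinv_def)
  also have "(inverse t - 1) * KK a b + inverse t * ((t - 1) * KK a b + t * opy (dual.T i) KK a b)
      = opy (dual.T i) KK a b"
    using t_nz by (simp add: field_simps)
  finally show "opx (Ti i) KK a b = opy (dual.T i) KK a b" .
qed

text \<open>Every factor t^{-1} at (q,t) is a factor t at the inverse parameters.\<close>

lemma gam_dual: "gam \<eta> * dual.gam \<eta> = 1"
  unfolding gam_def dual.gam_def prod.distrib[symmetric] using t_nz by (intro prod.neutral) auto

lemma kernel_Phihat: "opx (Phihat n q t) KK = opy dual.Phi KK"
proof (intro ext)
  fix a b :: "int list"
  \<comment> \<open>The range on the left is one degree larger, as the terms that survive there are
    images under \<open>nphi\<close> of compositions in \<open>compos M\<close>.\<close>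
  define M where "M = nat (max (sum_list a) (sum_list b))"
  have M: "sum_list a \<le> int M" "sum_list b \<le> int (Suc M)" by (auto simp: M_def)
  let ?E' = "dual.E"
  have "opx (Phihat n q t) KK a b = (\<Sum>\<eta>\<in>compos (Suc M). coef \<eta> * Phihat n q t (E \<eta>) a * ?E' \<eta> b)"
    by (rule opx_expand[OF linop_Phihat M(2)])
  \<comment> \<open>The compositions dropped, with last entry 0, are exactly those outside the image
    of \<open>nphi\<close>.\<close>
  also have "\<dots> = (\<Sum>\<eta>\<in>{\<eta> \<in> compos (Suc M). \<eta> ! (n - 1) \<noteq> 0}. coef \<eta> * Phihat n q t (E \<eta>) a * ?E' \<eta> b)"
    by (rule sum.mono_neutral_right[OF finite_compos]) (auto simp: compos_def Phihat_E_zero)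
  also have "\<dots> = (\<Sum>\<zeta>\<in>compos M. coef (nphi \<zeta>) * Phihat n q t (E (nphi \<zeta>)) a * ?E' (nphi \<zeta>) b)"
  proof (rule sum.reindex_bij_witness[of _ nphi "\<lambda>\<eta>. (last \<eta> - 1) # butlast \<eta>"])
    fix \<eta> assume "\<eta> \<in> {\<eta> \<in> compos (Suc M). \<eta> ! (n - 1) \<noteq> 0}"
    then have len: "length \<eta> = n" and s: "sum_list \<eta> \<le> Suc M" and nz: "\<eta> ! (n - 1) \<noteq> 0" by (auto simp: compos_def)
    have ne: "\<eta> \<noteq> []" using len n_pos by auto
    have la: "last \<eta> = \<eta> ! (n - 1)" using ne len by (simp add: last_conv_nth)
    show eq: "nphi ((last \<eta> - 1) # butlast \<eta>) = \<eta>"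
      using nz la append_butlast_last_id[OF ne] by (simp add: nphi_def)
    have "sum_list \<eta> = sum_list (butlast \<eta>) + last \<eta>"
      using arg_cong[OF append_butlast_last_id[OF ne], of sum_list] by simp
    then show "(last \<eta> - 1) # butlast \<eta> \<in> compos M" using s nz la len n_pos by (auto simp: compos_def)
    show "coef (nphi ((last \<eta> - 1) # butlast \<eta>)) * Phihat n q t (E (nphi ((last \<eta> - 1) # butlast \<eta>))) a
        * ?E' (nphi ((last \<eta> - 1) # butlast \<eta>)) b = coef \<eta> * Phihat n q t (E \<eta>) a * ?E' \<eta> b"
      unfolding eq ..
  next
    fix \<zeta> assume "\<zeta> \<in> compos M"
    then have len: "length \<zeta> = n" and s: "sum_list \<zeta> \<le> M" by (auto simp: compos_def)
    obtain z zs where z: "\<zeta> = z # zs" using len n_pos by (cases \<zeta>) auto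
    show "(last (nphi \<zeta>) - 1) # butlast (nphi \<zeta>) = \<zeta>" by (simp add: nphi_def z)
    have "nphi \<zeta> ! (n - 1) \<noteq> 0" using len n_pos by (simp add: nth_nphi)
    then show "nphi \<zeta> \<in> {\<eta> \<in> compos (Suc M). \<eta> ! (n - 1) \<noteq> 0}"
      using s len by (simp add: compos_def z nphi_def)
  qed
  also have "\<dots> = (\<Sum>\<zeta>\<in>compos M. coef \<zeta> * E \<zeta> a * dual.Phi (?E' \<zeta>) b)"
  proof (rule sum.cong[OF refl])
    fix \<zeta> assume "\<zeta> \<in> compos M"
    then have len: "length \<zeta> = n" by (simp add: compos_def)
    have g: "inverse (gam \<zeta>) = dual.gam \<zeta>" using gam_dual[of \<zeta>] by (simp add: inverse_unique)
    have "coef (nphi \<zeta>) * Phihat n q t (E (nphi \<zeta>)) a * ?E' (nphi \<zeta>) b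
        = (coef (nphi \<zeta>) * (1 - q * t ^ (n - 1) * eigval q t \<zeta> 1)) * inverse (gam \<zeta>) * E \<zeta> a * ?E' (nphi \<zeta>) b"
      by (simp add: Phihat_E[OF len] divide_inverse mult_ac)
    also have "\<dots> = coef \<zeta> * E \<zeta> a * dual.Phi (?E' \<zeta>) b"
      unfolding coef_nphi[OF len] g dual.Phi_E[OF len] by (simp add: mult_ac)
    finally show "coef (nphi \<zeta>) * Phihat n q t (E (nphi \<zeta>)) a * ?E' (nphi \<zeta>) b
        = coef \<zeta> * E \<zeta> a * dual.Phi (?E' \<zeta>) b" .
  qed
  also have "\<dots> = opy dual.Phi KK a b"
    by (rule opy_expand[OF dual.linop_Phi[OF n_pos] M(1), symmetric])
  finally show "opx (Phihat n q t) KK a b = opy dual.Phi KK a b" .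
qed

text \<open>Each transfer from x to y reverses the order of the factors, because operators in
  different variables commute on the kernel.\<close>

lemma kernel_Tis:
  assumes "m \<le> n" "1 \<le> m"
  shows "opx (comp_ops (map Ti (rev [1..<m]))) KK = opy (comp_ops (map dual.T [1..<m])) KK"
  using assms(2,1)
proof (induction m rule: nat_induct_at_least)
  case base
  show ?case by (simp add: opx_def opy_def)
next
  case (Suc m)
  let ?L = "comp_ops (map Ti (rev [1..<m]))" and ?R = "comp_ops (map dual.T [1..<m])"
  have m: "1 \<le> m" "m < n" using Suc by auto
  have up: "[1..<Suc m] = [1..<m] @ [m]" using Suc.hyps by simp
  have "opx (comp_ops (map Ti (rev [1..<Suc m]))) KK = opx (Ti m) (opx ?L KK)"
    unfolding up by (simp add: opx_def)
  also have "opx ?L KK = opy ?R KK" using Suc by simp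
  also have "opx (Ti m) (opy ?R KK) = opy ?R (opx (Ti m) KK)"
    by (rule opx_opy) (use m in \<open>auto intro!: linop_Ti homog_Ti dual.linop_Ts dual.homog_Ts\<close>)
  also have "opx (Ti m) KK = opy (dual.T m) KK" by (rule kernel_Ti[OF m])
  also have "opy ?R (opy (dual.T m) KK) = opy (comp_ops (map dual.T [1..<Suc m])) KK"
    unfolding up by (simp add: opy_def)
  finally show ?case .
qed

text \<open>D_n is T_{n-1}^{-1} ... T_1^{-1} \<open>Phihat\<close>. Transferred to y, the chain
  becomes generators at the inverse parameters, which the inverses in \<open>dual.Phi\<close>
  cancel, leaving y_n.\<close>

lemma kernel_Dop_n: "opx (Dop n q t n) KK = opy (mulx n) KK"
proof -
  let ?L = "comp_ops (map Ti (rev [1..<n]))" and ?R = "comp_ops (map dual.T [1..<n])"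
  have "opx (Dop n q t n) KK = opx ?L (opx (Phihat n q t) KK)"
  proof (intro ext)
    fix a b
    have l: "laurent n (Dop n q t n (\<lambda>a. KK a b))"
      by (rule linop_laurent[OF linop_Dop laurent_KK_x]) (use n_pos in auto)
    show "opx (Dop n q t n) KK a b = opx ?L (opx (Phihat n q t) KK) a b"
      using Tis_Ts(1)[OF l, of "[1..<n]"] by (simp add: opx_def Phihat_def)
  qed
  also have "opx (Phihat n q t) KK = opy dual.Phi KK" by (rule kernel_Phihat)
  also have "opx ?L (opy dual.Phi KK) = opy dual.Phi (opx ?L KK)"
    by (rule opx_opy[OF linop_Tis homog_Tis dual.linop_Phi[OF n_pos] dual.homog_Phi[OF n_pos]]) auto
  also have "opx ?L KK = opy ?R KK" by (rule kernel_Tis) (use n_pos in auto)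
  also have "opy dual.Phi (opy ?R KK) = opy (mulx n) KK"
    using dual.Tis_Ts(1)[OF laurent_KK_y, of "[1..<n]"] by (simp add: opy_def Phiop_def)
  finally show ?thesis .
qed

lemma kernel_Dop:
  assumes "1 \<le> i" "i \<le> n"
  shows "opx (Dop n q t i) KK = opy (mulx i) KK"
  using assms(2,1)
proof (induction rule: inc_induct)
  case base
  show ?case by (rule kernel_Dop_n)
next
  case (step i)
  have i: "1 \<le> i" "i < n" using step by auto
  have i1: "1 \<le> i + 1" "i + 1 \<le> n" using i by auto
  let ?D = "Dop n q t (i + 1)" and ?T' = "dual.Ti i"
  have IH: "opx ?D KK = opy (mulx (i + 1)) KK" using step by (simp flip: Suc_eq_plus1)
  have lTm: "linop n (\<lambda>f. ?T' (mulx (i + 1) f))"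
    by (rule linop_comp[OF dual.linop_Ti[OF i] linop_mulx[OF i1]])
  have hTm: "homog n (\<lambda>f. ?T' (mulx (i + 1) f)) (1 + 0)"
    by (rule homog_comp[OF dual.homog_Ti[OF i] homog_mulx[OF i1] linop_mulx[OF i1]])
  have "opx (T i) (opx ?D (opx (T i) KK)) = opx (T i) (opx ?D (opy ?T' KK))" unfolding kernel_T[OF i] ..
  also have "opx ?D (opy ?T' KK) = opy ?T' (opx ?D KK)"
    by (rule opx_opy[OF linop_Dop[OF i1] homog_Dop[OF i1] dual.linop_Ti[OF i] dual.homog_Ti[OF i]])
  also have "\<dots> = opy (\<lambda>f. ?T' (mulx (i + 1) f)) KK" unfolding IH by (simp add: opy_def)
  also have "opx (T i) \<dots> = opy (\<lambda>f. ?T' (mulx (i + 1) f)) (opx (T i) KK)"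
    by (rule opx_opy[OF linop_T[OF i] homog_T[OF i] lTm hTm])
  also have "\<dots> = opy (\<lambda>f. ?T' (mulx (i + 1) (?T' f))) KK" unfolding kernel_T[OF i] by (simp add: opy_def)
  \<comment> \<open>The cross relation at the inverse parameters gives the factor t, the same as
    \<open>Dop_step\<close> gives on the x side.\<close>
  also have "\<dots> = (\<lambda>a b. t * opy (mulx i) KK a b)"
    unfolding opy_def using dual.Ti_mulx_Ti[OF laurent_KK_y i] by simp
  finally have R: "opx (T i) (opx ?D (opx (T i) KK)) = (\<lambda>a b. t * opy (mulx i) KK a b)" .
  have "opx (T i) (opx ?D (opx (T i) KK)) = (\<lambda>a b. t * opx (Dop n q t i) KK a b)"
    unfolding opx_def using Dop_step[OF laurent_KK_x i] by simp
  then show ?case using R t_nz by (simp add: fun_eq_iff)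
qed

end

section \<open>Independence of the two generators of the coefficient field\<close>

lemma qq_tt_monomial: "qq ^ m * tt ^ k = Fract (monom (monom 1 k) m) 1"
proof -
  have "qq ^ m = Fract (monom 1 m) 1"
    by (induction m) (auto simp: qq_def monom_Suc One_fract_def pCons_one monom_0 simp flip: one_pCons)
  moreover have "tt ^ k = Fract [:monom 1 k:] 1"
    by (induction k) (auto simp: tt_def monom_Suc One_fract_def monom_0 simp flip: one_pCons)
  ultimately show ?thesis by (simp add: mult.commute[of "monom 1 m"] smult_monom)
qed

lemma qq_tt_independent:
  fixes a b :: int
  assumes "qq powi a * tt powi b = 1"
  shows "a = 0 \<and> b = 0"
proof -
  have nz: "qq \<noteq> 0" "tt \<noteq> 0" by (auto simp: qq_def tt_def Zero_fract_def eq_fract)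
  \<comment> \<open>Moves the negative part of an exponent to the other side, so that the relation
    becomes one between monomials in the polynomial ring; of \<open>nat c\<close> and
    \<open>nat (- c)\<close> at least one is 0.\<close>
  have sp: "x powi c * x ^ nat (- c) = x ^ nat c" if "x \<noteq> 0" for x :: qtfield and c :: int
    using that by (cases "c \<ge> 0") (auto simp: power_int_def simp flip: power_mult_distrib)
  have "qq ^ nat a * tt ^ nat b = (qq powi a * qq ^ nat (- a)) * (tt powi b * tt ^ nat (- b))"
    using sp[OF nz(1), of a] sp[OF nz(2), of b] by simp
  also have "\<dots> = (qq powi a * tt powi b) * (qq ^ nat (- a) * tt ^ nat (- b))" by (simp add: mult_ac)
  also have "\<dots> = qq ^ nat (- a) * tt ^ nat (- b)" using assms by simp
  finally have "monom (monom (1::rat) (nat b)) (nat a) = monom (monom 1 (nat (- b))) (nat (- a))"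
    unfolding qq_tt_monomial by (simp add: eq_fract)
  then have "nat a = nat (- a)" "nat b = nat (- b)" by (auto simp: monom_eq_iff')
  then show ?thesis by linarith
qed

theorem theorem5p2:
  fixes n :: nat
  assumes "1 \<le> n"
  shows "(\<forall>i. 1 \<le> i \<and> i \<le> n - 1 \<longrightarrow>
            opx (Top n tt i) (KA n qq tt) = opy (Tinv n (inverse tt) i) (KA n qq tt) \<and>
            opx (Tinv n tt i) (KA n qq tt) = opy (Top n (inverse tt) i) (KA n qq tt))
       \<and> opx (Phihat n qq tt) (KA n qq tt) = opy (Phiop n (inverse tt)) (KA n qq tt)
       \<and> (\<forall>i. 1 \<le> i \<and> i \<le> n \<longrightarrow>
            opx (Dop n qq tt i) (KA n qq tt) = opy (mulx i) (KA n qq tt))"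
proof -
  interpret macdonald n qq tt
    using assms qq_tt_independent by unfold_locales (auto simp: qq_def tt_def Zero_fract_def eq_fract)
  interpret macdonald_pair n qq tt
    by (intro macdonald_pair.intro macdonald_dual) unfold_locales
  show ?thesis
    using kernel_T kernel_Ti kernel_Phihat kernel_Dop assms by auto
qed

end
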